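(* Let $A$ be a finite dimensional Hopf algebra over a field $k$ with invertible antipode $\gamma$. The map $J'$ on colored diagrams is an invariant under the equivalence relation $\sim'_c$; that is, $Z\sim'_c Z'$ implies $J'(Z)=J'(Z')$. If moreover $\gamma^2=1$, then $J'$ is also an invariant under the equivalence relation $\sim_c$; that is, $Z\sim_c Z'$ implies $J'(Z)=J'(Z')$.
   Context: **Algebra.** $\bar\gamma=\gamma^{-1}$; $A^*$ is the dual Hopf algebra, $\bar\gamma^*$ the transpose of $\bar\gamma$; $\{e_a\}$, $\{e^a\}$ dual bases of $A$, $A^*$; $\Delta(x)=\sum x'\otimes x''$. The Heisenberg double is $H(A)=A^*\otimes A$ with product $(f\otimes a)(g\otimes b)=\sum f\,g(?\,a')\otimes a''b$ ("?" is the place of the variable) and unit $1\otimes1$; write $x$ for $1\otimes x$, $f$ for $f\otimes1$. Let $\tilde e_a=\gamma(e_a)$, $\tilde e^a=\bar\gamma^*(e^a)$ and $S=\sum e_a\otimes e^a\in H(A)\otimes H(A)$, $S'=\sum\tilde e_a\otimes e^a\in H(A)^{\mathrm{op}}\otimes H(A)$, $S''=\sum e_a\otimes\tilde e^a\in H(A)\otimes H(A)^{\mathrm{op}}$, $\tilde S=\sum\tilde e_a\otimes\tilde e^a\in H(A)^{\mathrm{op}}\otimes H(A)^{\mathrm{op}}$. Inverses: $S^{-1}=\sum\gamma(e_a)\otimes e^a$, $(S')^{-1}=\sum\gamma(\tilde e_a)\otimes e^a$, $(S'')^{-1}=\sum\gamma(e_a)\otimes\tilde e^a$, $\tilde S^{-1}=\sum\gamma(\tilde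 e_a)\otimes\tilde e^a$. **Colored diagrams.** A colored diagram is an oriented virtual tangle diagram in a square, with ordered components, each component being thin or thick, obtained by pasting horizontally and vertically copies of: vertical strand, crossing $X_+$ (over-strand joining upper right to lower left), crossing $X_-$ (over-strand joining upper left to lower right), local maximum, local minimum, and the virtual crossing, called a symmetry (orientations and thickness arbitrary). "Crossing" means real crossing. **$J'$.** At each crossing let $Y=S,S',S'',\tilde S$ according to whether (under-strand, over-strand) is (thin, thin), (thick, thin), (thin, thick), (thick, thick). At an $X_+$ put the label $(\gamma'\otimes(\bar\gamma^* )')(Y)$, at an $X_-$ put $(\gamma'\otimes(\bar\gamma^* )')(Y^{-1})$, the first factor (in $A$) on the under-strand and the second (in $A^*$) on the over-strand; $\gamma'$ (resp. $(\bar\gamma^* )'$) is $\gamma$ (resp. $\bar\gamma^*$) if the strand concerned is oriented upwards and the identity otherwise. No other labels. For $Z=Z_1\cup\dots\cup Z_n$, the $i$th tensorand of $J'(Z)$ is the product of the labels on $Z_i$, read against the orientation and written from left to right, taken in $H(A)$ if $Z_i$ is thin and in $H(A)^{\mathrm{op}}$ if $Z_i$ is thick; if $Z_i$ is closed one starts at an arbitrary point and takes the class modulo $N_B=\mathrm{Span}_k\{ab-ba\mid a,b\in B\}$, $B=H(A)$ or $H(A)^{\mathrm{op}}$ respectively. **Colored moves** (local moves, both directions). (1) Colored Pachner $(2,3)$ moves. Three strands $1,2,3$ whose top endpoints are, from left to right, those of $1,2,3$, and whose bottom endpoints are those of $3,2,1$; all crossings are of type $X_+$, strand 1 being under strands 2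 and 3 and strand 2 under strand 3. Strands 1 and 3 have arbitrary orientation and thickness; strand 2 is oriented downwards. If strand 2 is thin: the diagram having from top to bottom the crossings of the pairs $\{2,3\},\{1,3\},\{1,2\}$ is exchanged with the diagram having from top to bottom the crossing of $\{1,2\}$, a symmetry of $\{1,3\}$, the crossing of $\{2,3\}$. If strand 2 is thick: the diagram having from top to bottom the crossings of $\{1,2\},\{1,3\},\{2,3\}$ is exchanged with the diagram having from top to bottom the crossing of $\{2,3\}$, a symmetry of $\{1,3\}$, the crossing of $\{1,2\}$. There are also versions with strand 2 oriented upwards; each of them is obtained from a version with strand 2 downwards by planar isotopies, so they do not enlarge $\sim_c$. (2) Colored $(0,2)$ moves: $X_+$ stacked on $X_-$, or $X_-$ stacked on $X_+$, is exchanged with two parallel vertical strands (arbitrary orientations and thickness). (3) Symmetry moves (arbitrary orientations and thickness): two stacked symmetries are exchanged with two vertical strands; the braid relation for three symmetries; a strand having symmetries with both strands of a crossing ($X_+$ or $X_-$) may be moved across that crossing; a strand having a symmetry with one leg of a maximum or minimum may be moved across it to have a symmetry with the other leg. (4) Planar isotopies (arbitrary orientations and thickness): exchange of heights of distant pieces; straightening of a zigzag (a maximum and a minimum cancelling); and the slide moves: a transversal strand passing from a point between the two legs of a maximum (resp. minimum) below (resp. above) it to the other side, and crossing the left leg, is exchanged with the same strand crossing the right leg, over/under information being preserved (both cases, transversal over or under, allowed). $\sim_c$ is the equivalence relation generated by all colored moves. $\sim'_c$ is the equivalence relation generated by all colored moves except: the slide moves in (4) of a (real) crossing across a maximum or minimum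 whose strand is oriented from left to right, and the colored Pachner $(2,3)$ moves with strand 2 oriented upwards. *)

theory Defs
  imports Complex_Main "HOL-Library.Poly_Mapping" "HOL-Library.FuncSet"
    "HOL-Library.Function_Algebras"
begin

section \<open>Tensor products of vector spaces\<close>

text \<open>
  Let \<open>C\<close> be a subspace of a vector space with scalar multiplication \<open>s\<close>, and let
  \<open>N 0, \<dots>, N (n - 1)\<close> be subsets of \<open>C\<close>.  The space
  \<open>C/span (N 0) \<otimes> \<dots> \<otimes> C/span (N (n - 1))\<close> is constructed in the usual way: it is the vector
  space freely generated by the lists of \<open>n\<close> elements of \<open>C\<close>, modulo the relations of
  multilinearity and modulo the lists having an element of \<open>N i\<close> at position \<open>i\<close>.  The elements
  of the quotient are represented as cosets, so equality in the tensor product is equality of sets.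
\<close>

definition free_scale :: "'k::field \<Rightarrow> ('b \<Rightarrow>\<^sub>0 'k) \<Rightarrow> ('b \<Rightarrow>\<^sub>0 'k)" where
  "free_scale c t = Poly_Mapping.map ((*) c) t"

definition tensor_relators ::
  "('k::field \<Rightarrow> 'v::ab_group_add \<Rightarrow> 'v) \<Rightarrow> 'v set \<Rightarrow> (nat \<Rightarrow> 'v set) \<Rightarrow> nat \<Rightarrow> ('v list \<Rightarrow>\<^sub>0 'k) set"
  where
  "tensor_relators s C N n =
     {Poly_Mapping.single (xs[i := x + y]) 1
        - Poly_Mapping.single (xs[i := x]) 1 - Poly_Mapping.single (xs[i := y]) 1
        | xs i x y. length xs = n \<and> set xs \<subseteq> C \<and> i < n \<and> x \<in> C \<and> y \<in> C} \<union>
     {Poly_Mapping.single (xs[i := s c x]) 1 - Poly_Mapping.single (xs[i := x]) c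
        | xs i c x. length xs = n \<and> set xs \<subseteq> C \<and> i < n \<and> x \<in> C} \<union>
     {Poly_Mapping.single (xs[i := x]) 1
        | xs i x. length xs = n \<and> set xs \<subseteq> C \<and> i < n \<and> x \<in> N i}"

definition tensor_class ::
  "('k::field \<Rightarrow> 'v::ab_group_add \<Rightarrow> 'v) \<Rightarrow> 'v set \<Rightarrow> (nat \<Rightarrow> 'v set) \<Rightarrow> nat \<Rightarrow>
     ('v list \<Rightarrow>\<^sub>0 'k) \<Rightarrow> ('v list \<Rightarrow>\<^sub>0 'k) set" where
  "tensor_class s C N n t = {t'. t' - t \<in> module.span free_scale (tensor_relators s C N n)}"

text \<open>The element \<open>\<Sum> x\<^sub>1 \<otimes> \<dots> \<otimes> x\<^sub>n\<close> of the \<open>n\<close>-th tensor power of the whole space, for a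
  finite list of terms \<open>[x\<^sub>1, \<dots>, x\<^sub>n]\<close>.\<close>

definition tensor_sum ::
  "('k::field \<Rightarrow> 'v::ab_group_add \<Rightarrow> 'v) \<Rightarrow> nat \<Rightarrow> 'v list list \<Rightarrow> ('v list \<Rightarrow>\<^sub>0 'k) set" where
  "tensor_sum s n ts =
     tensor_class s UNIV (\<lambda>_. {}) n (\<Sum>xs\<leftarrow>ts. Poly_Mapping.single xs 1)"

lemma vector_space_free_scale: "vector_space (free_scale :: 'k::field \<Rightarrow> ('b \<Rightarrow>\<^sub>0 'k) \<Rightarrow> _)"
proof -
  have l: "Poly_Mapping.lookup (free_scale c t) x = c * Poly_Mapping.lookup t x"
    for c :: 'k and t :: "'b \<Rightarrow>\<^sub>0 'k" and x
    by (simp add: free_scale_def Poly_Mapping.map.rep_eq when_def)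
  show ?thesis
    by (unfold_locales; rule poly_mapping_eqI) (simp_all add: l lookup_add algebra_simps)
qed


section \<open>Hopf algebras and the Heisenberg double\<close>

text \<open>
  The algebra \<open>A\<close> is the type \<open>'a\<close> with its ring structure and the scalar multiplication \<open>scale\<close>.
  The finite set \<open>Basis\<close> is the chosen basis \<open>e\<^sub>a\<close>.  As in Sweedler's notation
  \<open>\<Delta>(x) = \<Sum> x' \<otimes> x''\<close>, the element \<open>\<Delta>(x)\<close> of \<open>A \<otimes> A\<close> is given by a finite list
  \<open>comul x\<close> of pairs \<open>(x', x'')\<close>, which is an arbitrary choice of a representative;
  the axioms on \<open>\<Delta>\<close> are equations in \<open>A \<otimes> A\<close> and \<open>A \<otimes> A \<otimes> A\<close>.
\<close>

locale finite_dimensional_hopf_algebra = finite_dimensional_vector_space scale Basis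
  for scale :: "'k::field \<Rightarrow> 'a::ring_1 \<Rightarrow> 'a" (infixr \<open>*s\<close> 75) and Basis :: "'a set" +
  fixes comul :: "'a \<Rightarrow> ('a \<times> 'a) list"
    and counit :: "'a \<Rightarrow> 'k"
    and antipode :: "'a \<Rightarrow> 'a"
  assumes scale_mult_left: "(c *s x) * y = c *s (x * y)"
    and scale_mult_right: "x * (c *s y) = c *s (x * y)"
    and comul_add:
      "tensor_sum scale 2 [[x', x'']. (x', x'') \<leftarrow> comul (x + y)] =
       tensor_sum scale 2 [[x', x'']. (x', x'') \<leftarrow> comul x @ comul y]"
    and comul_scale:
      "tensor_sum scale 2 [[x', x'']. (x', x'') \<leftarrow> comul (c *s x)] =
       tensor_sum scale 2 [[c *s x', x'']. (x', x'') \<leftarrow> comul x]"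
    and coassoc:
      "tensor_sum scale 3 [[y', y'', x'']. (x', x'') \<leftarrow> comul x, (y', y'') \<leftarrow> comul x'] =
       tensor_sum scale 3 [[x', y', y'']. (x', x'') \<leftarrow> comul x, (y', y'') \<leftarrow> comul x'']"
    and counit_linear: "Vector_Spaces.linear scale (*) counit"
    and counit_left: "(\<Sum>(x', x'')\<leftarrow>comul x. counit x' *s x'') = x"
    and counit_right: "(\<Sum>(x', x'')\<leftarrow>comul x. counit x'' *s x') = x"
    and comul_one:
      "tensor_sum scale 2 [[x', x'']. (x', x'') \<leftarrow> comul 1] = tensor_sum scale 2 [[1, 1]]"
    and comul_mult:
      "tensor_sum scale 2 [[z', z'']. (z', z'') \<leftarrow> comul (x * y)] =
       tensor_sum scale 2 [[x' * y', x'' * y'']. (x', x'') \<leftarrow> comul x, (y', y'') \<leftarrow> comul y]"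
    and counit_one: "counit 1 = 1"
    and counit_mult: "counit (x * y) = counit x * counit y"
    and antipode_linear: "Vector_Spaces.linear scale scale antipode"
    and antipode_left: "(\<Sum>(x', x'')\<leftarrow>comul x. antipode x' * x'') = counit x *s 1"
    and antipode_right: "(\<Sum>(x', x'')\<leftarrow>comul x. x' * antipode x'') = counit x *s 1"
begin

definition dual_basis :: "'a \<Rightarrow> 'a \<Rightarrow> 'k" where
  "dual_basis b x = representation Basis x b"

definition dual_mult :: "('a \<Rightarrow> 'k) \<Rightarrow> ('a \<Rightarrow> 'k) \<Rightarrow> 'a \<Rightarrow> 'k" where
  "dual_mult f g x = (\<Sum>(x', x'')\<leftarrow>comul x. f x' * g x'')"

text \<open>
  Since \<open>A\<close> is finite dimensional, \<open>A\<^sup>* \<otimes> A\<close> is the space of linear maps from \<open>A\<close> to \<open>A\<close>,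
  the tensor \<open>f \<otimes> a\<close> being the map \<open>x \<mapsto> f(x) a\<close>; a linear map \<open>F\<close> is then the tensor
  \<open>\<Sum> e\<^sup>b \<otimes> F(e\<^sub>b)\<close>.  The product below is \<^emph>\<open>not\<close> the composition of linear maps: it is the
  bilinear extension of \<open>(f \<otimes> a)(g \<otimes> b) = \<Sum> f g(? a') \<otimes> a'' b\<close>,
  see \<open>heis_mult_tens\<close> below.
\<close>

definition tens :: "('a \<Rightarrow> 'k) \<Rightarrow> 'a \<Rightarrow> 'a \<Rightarrow> 'a" where
  "tens f a = (\<lambda>x. f x *s a)"

definition heis_carrier :: "('a \<Rightarrow> 'a) set" where
  "heis_carrier = {F. Vector_Spaces.linear scale scale F}"

definition heis_scale :: "'k \<Rightarrow> ('a \<Rightarrow> 'a) \<Rightarrow> 'a \<Rightarrow> 'a" where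
  "heis_scale c F = (\<lambda>x. c *s F x)"

definition heis_mult :: "('a \<Rightarrow> 'a) \<Rightarrow> ('a \<Rightarrow> 'a) \<Rightarrow> 'a \<Rightarrow> 'a" where
  "heis_mult F G =
     (\<Sum>b\<in>Basis. \<Sum>c\<in>Basis. \<Sum>(a', a'')\<leftarrow>comul (F b).
        tens (dual_mult (dual_basis b) (\<lambda>x. dual_basis c (x * a'))) (a'' * G c))"

definition heis_one :: "'a \<Rightarrow> 'a" where
  "heis_one = tens counit 1"

text \<open>The multiplication of \<open>H(A)\<close> for \<open>th = False\<close> and of \<open>H(A)\<^sup>o\<^sup>p\<close> for \<open>th = True\<close>.\<close>

definition colored_mult :: "bool \<Rightarrow> ('a \<Rightarrow> 'a) \<Rightarrow> ('a \<Rightarrow> 'a) \<Rightarrow> 'a \<Rightarrow> 'a" where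
  "colored_mult th F G = (if th then heis_mult G F else heis_mult F G)"

definition commutator_space :: "bool \<Rightarrow> ('a \<Rightarrow> 'a) set" where
  "commutator_space th = module.span heis_scale
     {colored_mult th F G - colored_mult th G F | F G. F \<in> heis_carrier \<and> G \<in> heis_carrier}"

end


section \<open>Colored diagrams\<close>

datatype orient = Up | Down
datatype direction = LR | RL
datatype sign = Pos | Neg

text \<open>A strand of a piece carries the index of the component of the diagram to which it belongs
  and its orientation.\<close>

type_synonym edge = "nat \<times> orient"

text \<open>
  The two edges of a crossing or a symmetry are the strand from the upper left to the lower right
  corner and then the strand from the upper right to the lower left corner.  A local maximum or
  minimum is oriented from left to right (\<open>LR\<close>) or from right to left (\<open>RL\<close>).
\<close>

datatype piece =
    Strand edge
  | XPlus edge edge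
  | XMinus edge edge
  | Sym edge edge
  | Maximum nat direction
  | Minimum nat direction

fun piece_top :: "piece \<Rightarrow> edge list" where
  "piece_top (Strand e) = [e]"
| "piece_top (XPlus a b) = [a, b]"
| "piece_top (XMinus a b) = [a, b]"
| "piece_top (Sym a b) = [a, b]"
| "piece_top (Maximum c d) = []"
| "piece_top (Minimum c d) = (if d = LR then [(c, Down), (c, Up)] else [(c, Up), (c, Down)])"

fun piece_bot :: "piece \<Rightarrow> edge list" where
  "piece_bot (Strand e) = [e]"
| "piece_bot (XPlus a b) = [b, a]"
| "piece_bot (XMinus a b) = [b, a]"
| "piece_bot (Sym a b) = [b, a]"
| "piece_bot (Maximum c d) = (if d = LR then [(c, Up), (c, Down)] else [(c, Down), (c, Up)])"
| "piece_bot (Minimum c d) = []"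

text \<open>Pieces pasted horizontally form a row; rows pasted vertically, from top to bottom, form a
  diagram.\<close>

type_synonym row = "piece list"

definition row_top :: "row \<Rightarrow> edge list" where "row_top R = concat (map piece_top R)"
definition row_bot :: "row \<Rightarrow> edge list" where "row_bot R = concat (map piece_bot R)"

text \<open>The components are numbered \<open>0, \<dots>, length (thick Z) - 1\<close>.\<close>

record diagram =
  rows :: "row list"
  thick :: "bool list"

text \<open>
  The point \<open>(r, i)\<close> is the \<open>i\<close>-th point from the left on the horizontal line above the \<open>r\<close>-th
  row, counting from \<open>0\<close>.  Each strand of a piece is an arc from a point (its tail) to a point (its
  head) on adjacent lines or, for a maximum or minimum, on the same line.  A crossing is named
  after its upper left corner.
\<close>

type_synonym point = "nat \<times> nat"

datatype passage = Plain | Under point sign orient | Over point sign orient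

record arc =
  tail :: point
  head :: point
  component :: nat
  passage :: passage

definition strand_arc :: "point \<Rightarrow> point \<Rightarrow> edge \<Rightarrow> passage \<Rightarrow> arc" where
  "strand_arc t b e p =
     (if snd e = Down then \<lparr>tail = t, head = b, component = fst e, passage = p\<rparr>
      else \<lparr>tail = b, head = t, component = fst e, passage = p\<rparr>)"

definition bend_arc :: "point \<Rightarrow> point \<Rightarrow> nat \<Rightarrow> direction \<Rightarrow> arc" where
  "bend_arc l r c d =
     (if d = LR then \<lparr>tail = l, head = r, component = c, passage = Plain\<rparr>
      else \<lparr>tail = r, head = l, component = c, passage = Plain\<rparr>)"

text \<open>The arcs of a piece in row \<open>r\<close> having \<open>i\<close> points to its left on the line above the row and
  \<open>j\<close> points to its left on the line below the row.\<close>

fun piece_arcs :: "nat \<Rightarrow> nat \<Rightarrow> nat \<Rightarrow> piece \<Rightarrow> arc list" where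
  "piece_arcs r i j (Strand e) = [strand_arc (r, i) (r + 1, j) e Plain]"
| "piece_arcs r i j (XPlus a b) =
     [strand_arc (r, i) (r + 1, j + 1) a (Under (r, i) Pos (snd a)),
      strand_arc (r, i + 1) (r + 1, j) b (Over (r, i) Pos (snd b))]"
| "piece_arcs r i j (XMinus a b) =
     [strand_arc (r, i) (r + 1, j + 1) a (Over (r, i) Neg (snd a)),
      strand_arc (r, i + 1) (r + 1, j) b (Under (r, i) Neg (snd b))]"
| "piece_arcs r i j (Sym a b) =
     [strand_arc (r, i) (r + 1, j + 1) a Plain, strand_arc (r, i + 1) (r + 1, j) b Plain]"
| "piece_arcs r i j (Maximum c d) = [bend_arc (r + 1, j) (r + 1, j + 1) c d]"
| "piece_arcs r i j (Minimum c d) = [bend_arc (r, i) (r, i + 1) c d]"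

fun row_arcs :: "nat \<Rightarrow> nat \<Rightarrow> nat \<Rightarrow> row \<Rightarrow> arc list" where
  "row_arcs r i j [] = []"
| "row_arcs r i j (p # ps) =
     piece_arcs r i j p @ row_arcs r (i + length (piece_top p)) (j + length (piece_bot p)) ps"

definition arcs :: "diagram \<Rightarrow> arc set" where
  "arcs Z = (\<Union>r<length (rows Z). set (row_arcs r 0 0 (rows Z ! r)))"

definition component_arcs :: "diagram \<Rightarrow> nat \<Rightarrow> arc set" where
  "component_arcs Z c = {x \<in> arcs Z. component x = c}"

definition crossings :: "diagram \<Rightarrow> point set" where
  "crossings Z = {q. \<exists>x\<in>arcs Z. \<exists>s u. passage x = Under q s u}"

text \<open>A reading of a component lists all its arcs consecutively, against the orientation.  The arcs
  with index \<open>c\<close> have a reading if and only if they form one strand or one closed curve.\<close>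

definition is_reading :: "diagram \<Rightarrow> nat \<Rightarrow> arc list \<Rightarrow> bool" where
  "is_reading Z c xs \<longleftrightarrow>
     xs \<noteq> [] \<and> distinct xs \<and> set xs = component_arcs Z c \<and>
     successively (\<lambda>x y. tail x = head y) xs"

definition reading :: "diagram \<Rightarrow> nat \<Rightarrow> arc list" where
  "reading Z c = (SOME xs. is_reading Z c xs)"

definition closed_component :: "diagram \<Rightarrow> nat \<Rightarrow> bool" where
  "closed_component Z c \<longleftrightarrow> tail ` component_arcs Z c = head ` component_arcs Z c"

definition colored_diagram :: "diagram \<Rightarrow> bool" where
  "colored_diagram Z \<longleftrightarrow>
     rows Z \<noteq> [] \<and>
     successively (\<lambda>R R'. row_bot R = row_top R') (rows Z) \<and>
     (\<forall>x\<in>arcs Z. component x < length (thick Z)) \<and>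
     (\<forall>c<length (thick Z). \<exists>xs. is_reading Z c xs)"


section \<open>The invariant J'\<close>

context finite_dimensional_hopf_algebra
begin

definition dual_inv_antipode :: "('a \<Rightarrow> 'k) \<Rightarrow> 'a \<Rightarrow> 'k" where
  "dual_inv_antipode f = f \<circ> inv antipode"

text \<open>
  Summand of the label of a crossing corresponding to the basis element \<open>e\<close>, for a strand of the
  given thickness: the innermost maps give \<open>Y = S, S', S'', S~\<close> (the factor of \<open>Y\<close> in \<open>A\<close> depends
  only on the thickness of the under-strand, the factor in \<open>A\<^sup>*\<close> only on that of the over-strand),
  \<open>Y\<inverse>\<close> is \<open>Y\<close> with the antipode applied to the factor in \<open>A\<close>, and the outermost maps account
  for the orientation.
\<close>

definition under_label :: "bool \<Rightarrow> sign \<Rightarrow> orient \<Rightarrow> 'a \<Rightarrow> 'a" where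
  "under_label th s u e =
     (if u = Up then antipode else id)
       ((if s = Neg then antipode else id) ((if th then antipode else id) e))"

definition over_label :: "bool \<Rightarrow> orient \<Rightarrow> 'a \<Rightarrow> 'a \<Rightarrow> 'k" where
  "over_label th u e =
     (if u = Up then dual_inv_antipode else id)
       ((if th then dual_inv_antipode else id) (dual_basis e))"

fun passage_labels :: "bool \<Rightarrow> (point \<Rightarrow> 'a) \<Rightarrow> passage \<Rightarrow> ('a \<Rightarrow> 'a) list" where
  "passage_labels th a Plain = []"
| "passage_labels th a (Under q s u) = [tens counit (under_label th s u (a q))]"
| "passage_labels th a (Over q s u) = [tens (over_label th u (a q)) 1]"

definition component_product :: "diagram \<Rightarrow> (point \<Rightarrow> 'a) \<Rightarrow> nat \<Rightarrow> 'a \<Rightarrow> 'a" where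
  "component_product Z a c =
     foldr (colored_mult (thick Z ! c))
       (concat (map (\<lambda>x. passage_labels (thick Z ! c) a (passage x)) (reading Z c))) heis_one"

definition J' :: "diagram \<Rightarrow> (('a \<Rightarrow> 'a) list \<Rightarrow>\<^sub>0 'k) set" where
  "J' Z =
     tensor_class heis_scale heis_carrier
       (\<lambda>c. if closed_component Z c then commutator_space (thick Z ! c) else {})
       (length (thick Z))
       (\<Sum>a\<in>crossings Z \<rightarrow>\<^sub>E Basis.
          Poly_Mapping.single (map (component_product Z a) [0..<length (thick Z)]) 1)"

end


section \<open>Colored moves\<close>

text \<open>A local move relates two blocks of rows.  Its second argument is replaced by the third; the
  first argument gives the thickness of the components.\<close>

inductive pachner_move :: "bool list \<Rightarrow> row list \<Rightarrow> row list \<Rightarrow> bool" for th where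
  pachner_thin: "snd e2 = Down \<Longrightarrow> \<not> th ! fst e2 \<Longrightarrow> pachner_move th
     [[Strand e1, XPlus e2 e3], [XPlus e1 e3, Strand e2], [Strand e3, XPlus e1 e2]]
     [[XPlus e1 e2, Strand e3], [Strand e2, Sym e1 e3], [XPlus e2 e3, Strand e1]]"
| pachner_thick: "snd e2 = Down \<Longrightarrow> th ! fst e2 \<Longrightarrow> pachner_move th
     [[XPlus e1 e2, Strand e3], [Strand e2, XPlus e1 e3], [XPlus e2 e3, Strand e1]]
     [[Strand e1, XPlus e2 e3], [Sym e1 e3, Strand e2], [Strand e3, XPlus e1 e2]]"

inductive zero_two_move :: "row list \<Rightarrow> row list \<Rightarrow> bool" where
  "zero_two_move [[XPlus a b], [XMinus b a]] [[Strand a, Strand b]]"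
| "zero_two_move [[XMinus a b], [XPlus b a]] [[Strand a, Strand b]]"

text \<open>The two legs of a maximum or minimum, from left to right, as edges.\<close>

definition max_left :: "nat \<Rightarrow> direction \<Rightarrow> edge" where
  "max_left c d = (c, if d = LR then Up else Down)"
definition max_right :: "nat \<Rightarrow> direction \<Rightarrow> edge" where
  "max_right c d = (c, if d = LR then Down else Up)"
definition min_left :: "nat \<Rightarrow> direction \<Rightarrow> edge" where
  "min_left c d = (c, if d = LR then Down else Up)"
definition min_right :: "nat \<Rightarrow> direction \<Rightarrow> edge" where
  "min_right c d = (c, if d = LR then Up else Down)"

inductive symmetry_move :: "row list \<Rightarrow> row list \<Rightarrow> bool" where
  sym_sym: "symmetry_move [[Sym a b], [Sym b a]] [[Strand a, Strand b]]"
| sym_braid: "symmetry_move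
     [[Sym a b, Strand c], [Strand b, Sym a c], [Sym b c, Strand a]]
     [[Strand a, Sym b c], [Sym a c, Strand b], [Strand c, Sym a b]]"
| sym_crossing_right: "X = XPlus \<or> X = XMinus \<Longrightarrow> symmetry_move
     [[X a b, Strand c], [Strand b, Sym a c], [Sym b c, Strand a]]
     [[Strand a, Sym b c], [Sym a c, Strand b], [Strand c, X a b]]"
| sym_crossing_left: "X = XPlus \<or> X = XMinus \<Longrightarrow> symmetry_move
     [[Strand c, X a b], [Sym c b, Strand a], [Strand b, Sym c a]]
     [[Sym c a, Strand b], [Strand a, Sym c b], [X a b, Strand c]]"
| sym_max: "symmetry_move
     [[Strand t, Maximum c d], [Sym t (max_left c d), Strand (max_right c d)]]
     [[Maximum c d, Strand t], [Strand (max_left c d), Sym (max_right c d) t]]"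
| sym_min: "symmetry_move
     [[Sym (min_left c d) t, Strand (min_right c d)], [Strand t, Minimum c d]]
     [[Strand (min_left c d), Sym t (min_right c d)], [Minimum c d, Strand t]]"

text \<open>The height moves with an empty row \<open>Q\<close> insert or delete a row of vertical strands.\<close>

inductive isotopy_move :: "row list \<Rightarrow> row list \<Rightarrow> bool" where
  height_left: "isotopy_move
     [P @ map Strand (row_top Q), map Strand (row_bot P) @ Q] [P @ Q]"
| height_right: "isotopy_move
     [map Strand (row_top P) @ Q, P @ map Strand (row_bot Q)] [P @ Q]"
| zigzag_left: "isotopy_move
     [[Maximum c d, Strand (max_left c d)], [Strand (max_left c d), Minimum c d]]
     [[Strand (max_left c d)]]"
| zigzag_right: "isotopy_move
     [[Strand (max_right c d), Maximum c d], [Minimum c d, Strand (max_right c d)]]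
     [[Strand (max_right c d)]]"

text \<open>A transversal strand \<open>t\<close>, over or under, is moved across a maximum or minimum oriented in the
  direction \<open>d\<close>.\<close>

inductive slide_move :: "direction \<Rightarrow> row list \<Rightarrow> row list \<Rightarrow> bool" for d where
  slide_max_over: "slide_move d
     [[Strand t, Maximum c d], [XMinus t (max_left c d), Strand (max_right c d)]]
     [[Maximum c d, Strand t], [Strand (max_left c d), XPlus (max_right c d) t]]"
| slide_max_under: "slide_move d
     [[Strand t, Maximum c d], [XPlus t (max_left c d), Strand (max_right c d)]]
     [[Maximum c d, Strand t], [Strand (max_left c d), XMinus (max_right c d) t]]"
| slide_min_over: "slide_move d
     [[XPlus (min_left c d) t, Strand (min_right c d)], [Strand t, Minimum c d]]
     [[Strand (min_left c d), XMinus t (min_right c d)], [Minimum c d, Strand t]]"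
| slide_min_under: "slide_move d
     [[XMinus (min_left c d) t, Strand (min_right c d)], [Strand t, Minimum c d]]
     [[Strand (min_left c d), XPlus t (min_right c d)], [Minimum c d, Strand t]]"

text \<open>\<open>D\<close> is the set of directions of the maxima and minima across which real crossings may be
  slid.  The Pachner moves whose second strand is oriented upwards follow from the moves below with
  \<open>D = UNIV\<close>.\<close>

definition local_move :: "direction set \<Rightarrow> bool list \<Rightarrow> row list \<Rightarrow> row list \<Rightarrow> bool" where
  "local_move D th B B' \<longleftrightarrow>
     pachner_move th B B' \<or> zero_two_move B B' \<or> symmetry_move B B' \<or> isotopy_move B B' \<or>
     (\<exists>d\<in>D. slide_move d B B')"

text \<open>A block of rows inside a diagram, with vertical strands \<open>u\<close> to its left and \<open>v\<close> to its right,
  rows \<open>U\<close> above and rows \<open>V\<close> below, is replaced.  Arbitrary pieces to the left and right of the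
  block can be moved away by height moves.\<close>

inductive colored_move :: "direction set \<Rightarrow> diagram \<Rightarrow> diagram \<Rightarrow> bool" for D where
  "colored_move D Z Z'"
  if "local_move D th B B'"
    and "Z = \<lparr>rows = U @ map (\<lambda>R. map Strand u @ R @ map Strand v) B @ V, thick = th\<rparr>"
    and "Z' = \<lparr>rows = U @ map (\<lambda>R. map Strand u @ R @ map Strand v) B' @ V, thick = th\<rparr>"
    and "colored_diagram Z" and "colored_diagram Z'"

definition colored_equiv :: "diagram \<Rightarrow> diagram \<Rightarrow> bool" (infix \<open>\<sim>\<^sub>c\<close> 50) where
  "Z \<sim>\<^sub>c Z' \<longleftrightarrow> colored_diagram Z \<and> colored_diagram Z' \<and> equivclp (colored_move UNIV) Z Z'"

definition restricted_colored_equiv :: "diagram \<Rightarrow> diagram \<Rightarrow> bool" (infix \<open>\<sim>''\<^sub>c\<close> 50) where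
  "Z \<sim>'\<^sub>c Z' \<longleftrightarrow> colored_diagram Z \<and> colored_diagram Z' \<and> equivclp (colored_move {RL}) Z Z'"



section \<open>The Heisenberg double as a space of linear maps\<close>

lemma lookup_free_scale:
  "Poly_Mapping.lookup (free_scale c t) x = c * Poly_Mapping.lookup t x"
  by (simp add: free_scale_def Poly_Mapping.map.rep_eq when_def)

lemma sum_list_sum_swap:
  fixes f :: "'x \<Rightarrow> 'i \<Rightarrow> 'b::comm_monoid_add"
  shows "(\<Sum>x\<leftarrow>xs. \<Sum>i\<in>I. f x i) = (\<Sum>i\<in>I. \<Sum>x\<leftarrow>xs. f x i)"
  by (induction xs) (simp_all add: sum.distrib)

lemma sum_apply: "(\<Sum>i\<in>I. F i) x = (\<Sum>i\<in>I. F i x :: 'b::comm_monoid_add)"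
  by (induction I rule: infinite_finite_induct) simp_all

lemma sum_list_apply: "(\<Sum>i\<leftarrow>I. F i) x = (\<Sum>i\<leftarrow>I. F i x :: 'b::comm_monoid_add)"
  by (induction I) simp_all

context finite_dimensional_hopf_algebra
begin

lemma linear_iff:
  "Vector_Spaces.linear scale scale h \<longleftrightarrow>
     (\<forall>x y. h (x + y) = h x + h y) \<and> (\<forall>c x. h (c *s x) = c *s h x)"
  by (simp add: module_hom_eq_linear[symmetric] module_hom_iff module_axioms)

lemma linear_functional_iff:
  "Vector_Spaces.linear scale (*) h \<longleftrightarrow>
     (\<forall>x y. h (x + y) = h x + h y) \<and> (\<forall>c x. h (c *s x) = c * h x)"
proof -
  have "module ((*) :: 'k \<Rightarrow> 'k \<Rightarrow> 'k)"
    by unfold_locales (simp_all add: algebra_simps)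
  then show ?thesis
    by (simp add: module_hom_eq_linear[symmetric] module_hom_iff module_axioms)
qed

lemma dual_basis_add: "dual_basis b (x + y) = dual_basis b x + dual_basis b y"
  by (simp add: dual_basis_def representation_add independent_Basis span_Basis)

lemma dual_basis_scale: "dual_basis b (c *s x) = c * dual_basis b x"
  by (simp add: dual_basis_def representation_scale independent_Basis span_Basis)

lemma dual_basis_expansion: "(\<Sum>b\<in>Basis. dual_basis b x *s b) = x"
  unfolding dual_basis_def
  by (rule sum_representation_eq) (simp_all add: independent_Basis span_Basis finite_Basis)

lemma linear_expansion:
  assumes "Vector_Spaces.linear scale scale F"
  shows "F x = (\<Sum>b\<in>Basis. dual_basis b x *s F b)"
proof -
  interpret F: Vector_Spaces.linear scale scale F by fact
  have "F x = F (\<Sum>b\<in>Basis. dual_basis b x *s b)" by (simp only: dual_basis_expansion)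
  then show ?thesis by (simp add: F.sum F.scale)
qed

lemma linear_functional_expansion:
  assumes "Vector_Spaces.linear scale (*) f"
  shows "f x = (\<Sum>b\<in>Basis. dual_basis b x * f b)"
proof -
  interpret f: Vector_Spaces.linear scale "(*)" f by fact
  have "f x = f (\<Sum>b\<in>Basis. dual_basis b x *s b)" by (simp only: dual_basis_expansion)
  then show ?thesis by (simp add: f.sum f.scale)
qed

lemma tens_expansion:
  assumes "F \<in> heis_carrier"
  shows "F = (\<Sum>b\<in>Basis. tens (dual_basis b) (F b))"
proof
  fix x
  show "F x = (\<Sum>b\<in>Basis. tens (dual_basis b) (F b)) x"
    using linear_expansion[of F x] assms by (simp add: heis_carrier_def tens_def sum_apply)
qed

text \<open>Bilinear maps factor through \<open>A \<otimes> A\<close>.\<close>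

lemma tensor_sum_bilinear:
  fixes M :: "'a \<Rightarrow> 'a \<Rightarrow> 'a"
  assumes eq: "tensor_sum scale 2 [[x, y]. (x, y) \<leftarrow> ts] = tensor_sum scale 2 [[x, y]. (x, y) \<leftarrow> us]"
    and lin1: "\<And>y. Vector_Spaces.linear scale scale (\<lambda>x. M x y)"
    and lin2: "\<And>x. Vector_Spaces.linear scale scale (M x)"
  shows "(\<Sum>(x, y)\<leftarrow>ts. M x y) = (\<Sum>(x, y)\<leftarrow>us. M x y)"
proof -
  interpret free: vector_space "free_scale :: 'k \<Rightarrow> ('a list \<Rightarrow>\<^sub>0 'k) \<Rightarrow> _"
    by (rule vector_space_free_scale)
  define M' where "M' xs = M (xs ! 0) (xs ! 1)" for xs
  define L where "L t = (\<Sum>xs\<in>Poly_Mapping.keys t. Poly_Mapping.lookup t xs *s M' xs)" for t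
  have L_super: "L t = (\<Sum>xs\<in>K. Poly_Mapping.lookup t xs *s M' xs)"
    if "finite K" "Poly_Mapping.keys t \<subseteq> K" for t K
    unfolding L_def using that
    by (intro sum.mono_neutral_left) (auto simp: in_keys_iff)
  have L_add: "L (t + u) = L t + L u" for t u
  proof -
    let ?K = "Poly_Mapping.keys t \<union> Poly_Mapping.keys u \<union> Poly_Mapping.keys (t + u)"
    have "L t = (\<Sum>xs\<in>?K. Poly_Mapping.lookup t xs *s M' xs)"
      "L u = (\<Sum>xs\<in>?K. Poly_Mapping.lookup u xs *s M' xs)"
      "L (t + u) = (\<Sum>xs\<in>?K. Poly_Mapping.lookup (t + u) xs *s M' xs)"
      by (rule L_super; auto)+
    then show ?thesis
      by (simp only: lookup_add scale_left_distrib sum.distrib)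
  qed
  have L_scale: "L (free_scale c t) = c *s L t" for c t
  proof -
    let ?K = "Poly_Mapping.keys t \<union> Poly_Mapping.keys (free_scale c t)"
    have "L t = (\<Sum>xs\<in>?K. Poly_Mapping.lookup t xs *s M' xs)"
      "L (free_scale c t) = (\<Sum>xs\<in>?K. Poly_Mapping.lookup (free_scale c t) xs *s M' xs)"
      by (rule L_super; auto)+
    then show ?thesis
      by (simp only: lookup_free_scale scale_sum_right scale_scale)
  qed
  interpret L: module_hom free_scale scale L
    by (simp add: module_hom_iff free.module_axioms module_axioms L_add L_scale)
  have L_single: "L (Poly_Mapping.single xs c) = c *s M' xs" for xs c
    by (subst L_super[of "{xs}"]) auto
  have rel: "L t = 0" if "t \<in> tensor_relators scale UNIV (\<lambda>_. {}) 2" for t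
  proof -
    have up: "M' (xs[i := x]) = (if i = 0 then M x (xs ! 1) else M (xs ! 0) x)"
      if "length xs = 2" "i < 2" for xs i x
      using that by (auto simp: M'_def less_2_cases_iff)
    have M_add: "M (x + y) z = M x z + M y z" "M z (x + y) = M z x + M z y"
      and M_scale: "M (c *s x) z = c *s M x z" "M z (c *s x) = c *s M z x" for x y z c
      using lin1[of z] lin2[of z] by (auto simp: linear_iff)
    show ?thesis
      using that by (auto simp: tensor_relators_def L.diff L_single up M_add M_scale)
  qed
  let ?F = "\<lambda>ts. \<Sum>xs\<leftarrow>[[x, y]. (x, y) \<leftarrow> ts]. Poly_Mapping.single xs (1::'k)"
  have "?F ts \<in> tensor_sum scale 2 [[x, y]. (x, y) \<leftarrow> ts]"
    by (simp add: tensor_sum_def tensor_class_def free.span_zero)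
  then have "?F ts - ?F us \<in> free.span (tensor_relators scale UNIV (\<lambda>_. {}) 2)"
    unfolding eq by (simp add: tensor_sum_def tensor_class_def)
  then have "L (?F ts - ?F us) = 0"
    by (intro L.eq_0_on_span[OF rel]) auto
  then have "L (?F ts) = L (?F us)" by (simp add: L.diff)
  moreover have "L (?F ts) = (\<Sum>(x, y)\<leftarrow>ts. M x y)" for ts
    by (induction ts) (auto simp: L.add L.zero L_single M'_def)
  ultimately show ?thesis by simp
qed

lemma dual_mult_linear_arg:
  assumes "Vector_Spaces.linear scale (*) g"
  shows "dual_mult f (\<lambda>x. g (x * (a + b))) y =
      dual_mult f (\<lambda>x. g (x * a)) y + dual_mult f (\<lambda>x. g (x * b)) y"
    and "dual_mult f (\<lambda>x. g (x * (c *s a))) y = c * dual_mult f (\<lambda>x. g (x * a)) y"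
  using assms
  by (auto simp: dual_mult_def linear_functional_iff case_prod_unfold distrib_left
      scale_mult_right sum_list_addf sum_list_const_mult[symmetric] mult.left_commute)

lemma heis_mult_tens:
  assumes f: "Vector_Spaces.linear scale (*) f" and g: "Vector_Spaces.linear scale (*) g"
  shows "heis_mult (tens f a) (tens g b) =
    (\<Sum>(a', a'')\<leftarrow>comul a. tens (dual_mult f (\<lambda>x. g (x * a'))) (a'' * b))"
proof
  fix y
  define M where "M q p x z = dual_mult (dual_basis p) (\<lambda>w. dual_basis q (w * x)) y *s (z * b)"
    for q p x z
  have q: "Vector_Spaces.linear scale (*) (dual_basis q)" for q
    by (simp add: linear_functional_iff dual_basis_add dual_basis_scale)
  have M1: "Vector_Spaces.linear scale scale (\<lambda>x. M q p x z)" for q p z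
    by (simp add: linear_iff M_def dual_mult_linear_arg[OF q] scale_left_distrib)
  have M2: "Vector_Spaces.linear scale scale (M q p x)" for q p x
    by (simp add: linear_iff M_def scale_right_distrib distrib_right scale_mult_left
        scale_left_commute mult.commute)
  have scaled: "(\<Sum>(x, z)\<leftarrow>comul (c *s a). M q p x z) = c *s (\<Sum>(x, z)\<leftarrow>comul a. M q p x z)"
    for c q p
  proof -
    have "(\<Sum>(x, z)\<leftarrow>comul (c *s a). M q p x z) =
        (\<Sum>(x, z)\<leftarrow>map (\<lambda>(x, z). (c *s x, z)) (comul a). M q p x z)"
      by (rule tensor_sum_bilinear[OF _ M1 M2])
        (use comul_scale[of c a] in \<open>simp add: case_prod_unfold comp_def\<close>)
    also have "\<dots> = (\<Sum>(x, z)\<leftarrow>comul a. c *s M q p x z)"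
      using M1 by (simp add: linear_iff case_prod_unfold comp_def)
    also have "\<dots> = c *s (\<Sum>(x, z)\<leftarrow>comul a. M q p x z)"
    proof -
      have "(\<Sum>(x, z)\<leftarrow>l. c *s M q p x z) = c *s (\<Sum>(x, z)\<leftarrow>l. M q p x z)" for l
        by (induction l) (auto simp: scale_right_distrib)
      then show ?thesis .
    qed
    finally show ?thesis .
  qed
  have f_g: "(\<Sum>p\<in>Basis. \<Sum>q\<in>Basis. f p * g q * dual_mult (dual_basis p) (\<lambda>w. dual_basis q (w * x)) y)
      = dual_mult f (\<lambda>w. g (w * x)) y" for x
  proof -
    have "f y' * g (y'' * x) = (\<Sum>p\<in>Basis. \<Sum>q\<in>Basis.
           f p * g q * (dual_basis p y' * dual_basis q (y'' * x)))" for y' y''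
      by (subst linear_functional_expansion[OF f], subst linear_functional_expansion[OF g])
        (simp add: sum_product mult_ac)
    then have "dual_mult f (\<lambda>w. g (w * x)) y =
        (\<Sum>(y', y'')\<leftarrow>comul y. \<Sum>p\<in>Basis. \<Sum>q\<in>Basis.
           f p * g q * (dual_basis p y' * dual_basis q (y'' * x)))"
      by (simp add: dual_mult_def)
    also have "\<dots> = (\<Sum>p\<in>Basis. \<Sum>q\<in>Basis.
        f p * g q * dual_mult (dual_basis p) (\<lambda>w. dual_basis q (w * x)) y)"
      by (simp add: case_prod_unfold sum_list_sum_swap dual_mult_def sum_list_const_mult)
    finally show ?thesis by simp
  qed
  have "heis_mult (tens f a) (tens g b) y =
      (\<Sum>p\<in>Basis. \<Sum>q\<in>Basis. \<Sum>(x, z)\<leftarrow>comul (f p *s a). g q *s M q p x z)"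
    by (simp add: heis_mult_def tens_def M_def sum_apply sum_list_apply case_prod_unfold
        scale_mult_right mult.commute)
  also have "\<dots> = (\<Sum>p\<in>Basis. \<Sum>q\<in>Basis. (f p * g q) *s (\<Sum>(x, z)\<leftarrow>comul a. M q p x z))"
  proof (intro sum.cong refl)
    fix p q
    have "(\<Sum>(x, z)\<leftarrow>l. g q *s M q p x z) = g q *s (\<Sum>(x, z)\<leftarrow>l. M q p x z)" for l
      by (induction l) (auto simp: scale_right_distrib)
    then show "(\<Sum>(x, z)\<leftarrow>comul (f p *s a). g q *s M q p x z) =
        (f p * g q) *s (\<Sum>(x, z)\<leftarrow>comul a. M q p x z)"
      by (simp add: scaled mult.commute)
  qed
  also have "\<dots> = (\<Sum>(x, z)\<leftarrow>comul a. \<Sum>p\<in>Basis. \<Sum>q\<in>Basis. (f p * g q) *s M q p x z)"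
  proof -
    have "c *s (\<Sum>(x, z)\<leftarrow>l. M q p x z) = (\<Sum>(x, z)\<leftarrow>l. c *s M q p x z)" for l c q p
      by (induction l) (auto simp: scale_right_distrib)
    then show ?thesis by (simp add: case_prod_unfold sum_list_sum_swap)
  qed
  also have "\<dots> = (\<Sum>(x, z)\<leftarrow>comul a. dual_mult f (\<lambda>w. g (w * x)) y *s (z * b))"
    by (simp add: f_g[symmetric] M_def scale_sum_left)
  also have "\<dots> = (\<Sum>(a', a'')\<leftarrow>comul a. tens (dual_mult f (\<lambda>x. g (x * a'))) (a'' * b)) y"
    by (simp add: tens_def sum_list_apply case_prod_unfold)
  finally show "heis_mult (tens f a) (tens g b) y =
    (\<Sum>(a', a'')\<leftarrow>comul a. tens (dual_mult f (\<lambda>x. g (x * a'))) (a'' * b)) y" .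
qed

end

end

theory Submission
  imports Defs "HOL-Library.Multiset"
begin

text \<open>
  Equality in a tensor product of quotients of \<open>H(A)\<close> is tested by multilinear forms that vanish on
  the commutators at the closed components, so \<open>J'(Z)\<close> only depends on the words of crossings read
  along the components, up to rotation for the closed ones and up to renaming of the crossings.  A
  local move replaces, in these words, the subwords of the strands of a block.  The components of the
  two diagrams pass the outside of the block and the strands of the block in the same cyclic order,
  hence it suffices to compare, strand by strand, the tensors of the two blocks.  For symmetry moves and
  isotopies the words agree up to renaming.  The \<open>(2,3)\<close> moves are the pentagon equation
  \<open>S\<^sub>2\<^sub>3 S\<^sub>1\<^sub>2 = S\<^sub>1\<^sub>2 S\<^sub>1\<^sub>3 S\<^sub>2\<^sub>3\<close>, for a thick strand 2 with \<open>\<gamma>\<close> and \<open>\<gamma>\<^sup>-\<^sup>1\<close> applied to its two factors;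
  the \<open>(0,2)\<close> moves are the antipode axiom; and a slide compares \<open>\<Sum> \<gamma>(e\<^sub>a) \<otimes> (\<gamma>\<^sup>-\<^sup>1)\<^sup>*(e\<^sup>a)\<close> with
  \<open>\<Sum> e\<^sub>a \<otimes> e\<^sup>a\<close>, or, against the direction allowed in general, \<open>\<gamma>\<^sup>2\<close> with the identity.
\<close>

section \<open>Linear forms on tensor products\<close>

text \<open>Every reversal of a product is met by an antipode. A thick strand is multiplied in the
  opposite algebra, but each label carries \<open>antipode\<close> or the transposed inverse; an
  upward strand is read the other way, but carries such a map once more. These maps reverse
  products, so along a strand that is only under or only over the labels multiply to the image,
  under one linear map, of the product for a thin downward strand. Hence strands 1 and 3 of a (2,3)
  move need no cases. On strand 2 elements of A and of its dual meet, and there thin and thick give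
  two identities.

  The list \<open>comul x\<close> is only a representative of a tensor, so it can be evaluated only
  in bilinear expressions; Hopf algebra identities are therefore proved after applying a linear
  form. Associativity of H(A) is not expanded but carried over from the composition of operators, by
  a representation that is faithful because the antipode is invertible.

  The combinatorial obstacle is that \<open>reading\<close> may start a closed component anywhere,
  even inside a block. Rotating it to start at the end of a path costs a commutator, which is zero
  in the quotient.\<close>

definition free_functional :: "('b \<Rightarrow> 'k::field) \<Rightarrow> ('b \<Rightarrow>\<^sub>0 'k) \<Rightarrow> 'k" where
  "free_functional M t = (\<Sum>x\<in>Poly_Mapping.keys t. Poly_Mapping.lookup t x * M x)"

lemma free_functional_superset:
  assumes "finite K" "Poly_Mapping.keys t \<subseteq> K"
  shows "free_functional M t = (\<Sum>x\<in>K. Poly_Mapping.lookup t x * M x)"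
  unfolding free_functional_def using assms
  by (intro sum.mono_neutral_left) (auto simp: in_keys_iff)

lemma free_functional_add: "free_functional M (t + u) = free_functional M t + free_functional M u"
proof -
  let ?K = "Poly_Mapping.keys t \<union> Poly_Mapping.keys u \<union> Poly_Mapping.keys (t + u)"
  have "free_functional M v = (\<Sum>x\<in>?K. Poly_Mapping.lookup v x * M x)" if "v \<in> {t, u, t + u}" for v
    using that by (intro free_functional_superset) auto
  then show ?thesis
    by (simp add: lookup_add distrib_right sum.distrib)
qed

lemma free_functional_scale: "free_functional M (free_scale c t) = c * free_functional M t"
proof -
  let ?K = "Poly_Mapping.keys t \<union> Poly_Mapping.keys (free_scale c t)"
  have "free_functional M v = (\<Sum>x\<in>?K. Poly_Mapping.lookup v x * M x)" if "v \<in> {t, free_scale c t}"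
      for v
    using that by (intro free_functional_superset) auto
  then show ?thesis
    by (simp add: lookup_free_scale sum_distrib_left mult.assoc)
qed

lemma free_functional_single: "free_functional M (Poly_Mapping.single x c) = c * M x"
  by (subst free_functional_superset[of "{x}"]) auto

lemma vector_space_mult: "vector_space ((*) :: 'k::field \<Rightarrow> 'k \<Rightarrow> 'k)"
  by unfold_locales (simp_all add: algebra_simps)

lemma linear_free_iff:
  "Vector_Spaces.linear (free_scale :: 'k::field \<Rightarrow> ('b \<Rightarrow>\<^sub>0 'k) \<Rightarrow> _) (*) L \<longleftrightarrow>
     (\<forall>x y. L (x + y) = L x + L y) \<and> (\<forall>c x. L (free_scale c x) = c * L x)"
  using vector_space_mult vector_space_free_scale
  by (auto simp: Vector_Spaces.linear_iff)

lemma linear_free_functional: "Vector_Spaces.linear free_scale (*) (free_functional M)"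
  by (simp add: linear_free_iff free_functional_add free_functional_scale)

lemma sum_list_concat: "sum_list (concat xss) = (\<Sum>xs\<leftarrow>xss. sum_list xs)"
  by (induction xss) simp_all

text \<open>Points of a quotient vector space are separated by the linear functionals.\<close>

lemma tensor_class_eqI:
  fixes s :: "'k::field \<Rightarrow> 'v::ab_group_add \<Rightarrow> 'v"
  assumes "\<And>L. Vector_Spaces.linear free_scale (*) L \<Longrightarrow>
      (\<And>r. r \<in> tensor_relators s C N n \<Longrightarrow> L r = 0) \<Longrightarrow> L t = L t'"
  shows "tensor_class s C N n t = tensor_class s C N n t'"
proof -
  interpret free: vector_space "free_scale :: 'k \<Rightarrow> ('v list \<Rightarrow>\<^sub>0 'k) \<Rightarrow> _"
    by (rule vector_space_free_scale)
  interpret p: vector_space_pair "free_scale :: 'k \<Rightarrow> ('v list \<Rightarrow>\<^sub>0 'k) \<Rightarrow> _" "(*) :: 'k \<Rightarrow> 'k \<Rightarrow> 'k"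
    using vector_space_mult vector_space_free_scale by (simp add: vector_space_pair_def)
  let ?R = "tensor_relators s C N n"
  have "t - t' \<in> free.span ?R"
  proof (rule ccontr)
    assume nin: "t - t' \<notin> free.span ?R"
    \<comment> \<open>The relators are thinned out to a basis of their span, so that adjoining
      \<open>t - t'\<close> keeps independence and a functional can be prescribed as 1 there and 0
      on the basis.\<close>
    obtain B where B: "B \<subseteq> ?R" "free.independent B" "?R \<subseteq> free.span B"
      by (rule free.maximal_independent_subset)
    have spB: "free.span B = free.span ?R"
      using free.span_mono[OF B(1)] free.span_minimal[OF B(3) free.subspace_span] by
        (rule subset_antisym)
    have ind: "free.independent (insert (t - t') B)"
      using B(2) nin by (simp add: free.independent_insert spB)
    obtain L where L: "Vector_Spaces.linear free_scale (*) L"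
      and LB: "\<forall>x\<in>insert (t - t') B. L x = (if x = t - t' then 1 else 0)"
      using p.linear_independent_extend[OF ind, of "\<lambda>x. if x = t - t' then 1 else 0"] by blast
    interpret L: Vector_Spaces.linear free_scale "(*)" L by fact
    have "L r = 0" if "r \<in> ?R" for r
    proof (rule L.eq_0_on_span)
      show "r \<in> free.span B" using that B(3) by blast
      show "L b = 0" if "b \<in> B" for b
      proof -
        have "b \<noteq> t - t'" using that nin free.span_base[of b B] unfolding spB by blast
        then show ?thesis using LB that by simp
      qed
    qed
    then have "L t = L t'" by (rule assms[OF L])
    then have "L (t - t') = 0" by (simp add: L.diff)
    then show False using LB by simp
  qed
  then have *: "t - t' \<in> free.span ?R" "t' - t \<in> free.span ?R"
    using free.span_neg[of "t - t'"] by simp_all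
  have "u - t' \<in> free.span ?R" if "u - t \<in> free.span ?R" for u
    using free.span_add[OF that *(1)] by simp
  moreover have "u - t \<in> free.span ?R" if "u - t' \<in> free.span ?R" for u
    using free.span_add[OF that *(2)] by simp
  ultimately show ?thesis
    by (auto simp: tensor_class_def)
qed

text \<open>A multilinear map on lists extends linearly to the free space and vanishes on the
  relators, so it takes equal values on equal tensors. The axioms on \<open>comul\<close> that are
  equations between tensors enter the computations in this way.\<close>

lemma tensor_sum_multilinear:
  fixes s :: "'k::field \<Rightarrow> 'v::ab_group_add \<Rightarrow> 'v"
  assumes eq: "tensor_sum s n ts = tensor_sum s n us"
    and add: "\<And>xs i x y. length xs = n \<Longrightarrow> i < n \<Longrightarrow> M (xs[i := x + y]) = M (xs[i := x]) + M
      (xs[i := y])"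
    and scale: "\<And>xs i c x. length xs = n \<Longrightarrow> i < n \<Longrightarrow> M (xs[i := s c x]) = c * M (xs[i := x])"
  shows "(\<Sum>xs\<leftarrow>ts. M xs) = (\<Sum>xs\<leftarrow>us. M xs)"
proof -
  interpret free: vector_space "free_scale :: 'k \<Rightarrow> ('v list \<Rightarrow>\<^sub>0 'k) \<Rightarrow> _"
    by (rule vector_space_free_scale)
  interpret L: Vector_Spaces.linear free_scale "(*)" "free_functional M"
    by (rule linear_free_functional)
  let ?F = "\<lambda>ts. \<Sum>xs\<leftarrow>ts. Poly_Mapping.single xs (1::'k)"
  let ?R = "tensor_relators s UNIV (\<lambda>_. {}) n"
  have "?F ts \<in> tensor_sum s n ts"
    by (simp add: tensor_sum_def tensor_class_def free.span_zero)
  then have "?F ts - ?F us \<in> free.span ?R"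
    unfolding eq by (simp add: tensor_sum_def tensor_class_def)
  then have "free_functional M (?F ts - ?F us) = 0"
  proof (rule L.eq_0_on_span[rotated])
    show "free_functional M r = 0" if "r \<in> ?R" for r
      using that by (auto simp: tensor_relators_def L.diff free_functional_single add scale)
  qed
  moreover have "free_functional M (?F ts) = (\<Sum>xs\<leftarrow>ts. M xs)" for ts
    by (induction ts) (auto simp: L.add L.zero free_functional_single)
  ultimately show ?thesis by (simp add: L.diff)
qed

section \<open>Forms on a Hopf algebra\<close>

context finite_dimensional_hopf_algebra
begin

definition lin_form :: "('a \<Rightarrow> 'k) \<Rightarrow> bool" where
  "lin_form f \<longleftrightarrow> (\<forall>x y. f (x + y) = f x + f y) \<and> (\<forall>c x. f (c *s x) = c * f x)"

definition bilin_form :: "('a \<Rightarrow> 'a \<Rightarrow> 'k) \<Rightarrow> bool" where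
  "bilin_form M \<longleftrightarrow> (\<forall>y. lin_form (\<lambda>x. M x y)) \<and> (\<forall>x. lin_form (M x))"

definition trilin_form :: "('a \<Rightarrow> 'a \<Rightarrow> 'a \<Rightarrow> 'k) \<Rightarrow> bool" where
  "trilin_form M \<longleftrightarrow> (\<forall>y z. lin_form (\<lambda>x. M x y z)) \<and> (\<forall>x z. lin_form (\<lambda>y. M x y z)) \<and>
    (\<forall>x y. lin_form (M x y))"

text \<open>The value of \<open>M\<close> on \<Delta>(x), that is, a sum in Sweedler notation. Only
  for bilinear \<open>M\<close> does it depend on the tensor alone and not on the list chosen to
  represent it.\<close>

definition comul_sum :: "('a \<Rightarrow> 'a \<Rightarrow> 'k) \<Rightarrow> 'a \<Rightarrow> 'k" where
  "comul_sum M x = (\<Sum>(p, q)\<leftarrow>comul x. M p q)"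

lemma lin_form_iff_linear: "lin_form f \<longleftrightarrow> Vector_Spaces.linear scale (*) f"
  by (simp add: lin_form_def linear_functional_iff)

lemma lin_form_add: "lin_form f \<Longrightarrow> f (x + y) = f x + f y" by (simp add: lin_form_def)
lemma lin_form_scale: "lin_form f \<Longrightarrow> f (c *s x) = c * f x" by (simp add: lin_form_def)
lemma lin_form_zero: "lin_form f \<Longrightarrow> f 0 = 0" using lin_form_scale[of f 0 0] by simp
lemma lin_form_sum: "lin_form f \<Longrightarrow> f (\<Sum>i\<in>I. g i) = (\<Sum>i\<in>I. f (g i))"
  by (induction I rule: infinite_finite_induct) (auto simp: lin_form_add lin_form_zero)
lemma lin_form_sum_list: "lin_form f \<Longrightarrow> f (\<Sum>i\<leftarrow>I. g i) = (\<Sum>i\<leftarrow>I. f (g i))"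
  by (induction I) (auto simp: lin_form_add lin_form_zero)

lemma lin_form_dual_basis: "lin_form (dual_basis b)"
  by (simp add: lin_form_def dual_basis_add dual_basis_scale)

text \<open>The coordinate forms separate points. This turns identities in A into scalar identities,
  where \<open>comul_sum\<close> is available.\<close>

lemma eq_by_lin_form:
  assumes "\<And>f. lin_form f \<Longrightarrow> f x = f y"
  shows "x = y"
proof -
  have "(\<Sum>b\<in>Basis. dual_basis b x *s b) = (\<Sum>b\<in>Basis. dual_basis b y *s b)"
    by (simp add: assms[OF lin_form_dual_basis])
  then show ?thesis by (simp add: dual_basis_expansion)
qed

lemma bilin_formI: "(\<And>y. lin_form (\<lambda>x. M x y)) \<Longrightarrow> (\<And>x. lin_form (\<lambda>y. M x y)) \<Longrightarrow> bilin_form M"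
  by (simp add: bilin_form_def)

lemma tensor_sum_bilin_form:
  assumes "tensor_sum scale 2 [[x, y]. (x, y) \<leftarrow> ts] = tensor_sum scale 2 [[x, y]. (x, y) \<leftarrow> us]"
    and "bilin_form M"
  shows "(\<Sum>(x, y)\<leftarrow>ts. M x y) = (\<Sum>(x, y)\<leftarrow>us. M x y)"
proof -
  have "(\<Sum>xs\<leftarrow>[[x, y]. (x, y) \<leftarrow> ts]. M (xs ! 0) (xs ! 1)) =
      (\<Sum>xs\<leftarrow>[[x, y]. (x, y) \<leftarrow> us]. M (xs ! 0) (xs ! 1))"
    by (rule tensor_sum_multilinear[OF assms(1)])
      (use assms(2) in \<open>auto simp: less_2_cases_iff bilin_form_def lin_form_def\<close>)
  then show ?thesis by (simp add: case_prod_unfold comp_def)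
qed

lemma comul_sum_add: "bilin_form M \<Longrightarrow> comul_sum M (x + y) = comul_sum M x + comul_sum M y"
  unfolding comul_sum_def
  by (subst tensor_sum_bilin_form[of "comul (x + y)" "comul x @ comul y"])
    (use comul_add[of x y] in auto)

lemma comul_sum_scale:
  assumes "bilin_form M" shows "comul_sum M (c *s x) = c * comul_sum M x"
proof -
  have "comul_sum M (c *s x) = (\<Sum>(p, q)\<leftarrow>map (\<lambda>(p, q). (c *s p, q)) (comul x). M p q)"
    unfolding comul_sum_def
    by (rule tensor_sum_bilin_form[OF _ assms]) (use comul_scale[of c x] in
      \<open>simp add: case_prod_unfold comp_def\<close>)
  also have "\<dots> = c * comul_sum M x"
    using assms by (simp add: bilin_form_def lin_form_def comul_sum_def case_prod_unfold comp_def
      sum_list_const_mult)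
  finally show ?thesis .
qed

lemma lin_form_comul_sum: "bilin_form M \<Longrightarrow> lin_form (comul_sum M)"
  by (simp add: lin_form_def comul_sum_add comul_sum_scale)

lemma comul_sum_coassoc:
  assumes "trilin_form M"
  shows "comul_sum (\<lambda>u r. comul_sum (\<lambda>p q. M p q r) u) x = comul_sum
      (\<lambda>p v. comul_sum (\<lambda>q r. M p q r) v) x"
proof -
  let ?M = "\<lambda>xs. M (xs ! 0) (xs ! 1) (xs ! 2)"
  have "(\<Sum>xs\<leftarrow>[[y', y'', x'']. (x', x'') \<leftarrow> comul x, (y', y'') \<leftarrow> comul x']. ?M xs) =
     (\<Sum>xs\<leftarrow>[[x', y', y'']. (x', x'') \<leftarrow> comul x, (y', y'') \<leftarrow> comul x'']. ?M xs)"
  proof (rule tensor_sum_multilinear[OF coassoc])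
    have l: "i < 3 \<longleftrightarrow> i = 0 \<or> i = 1 \<or> i = 2" for i :: nat by auto
    show "?M (xs[i := x + y]) = ?M (xs[i := x]) + ?M (xs[i := y])" if "length xs = 3" "i < 3" for xs
        i x y
      using assms that by (auto simp: l trilin_form_def lin_form_def)
    show "?M (xs[i := c *s x]) = c * ?M (xs[i := x])" if "length xs = 3" "i < 3" for xs i c x
      using assms that by (auto simp: l trilin_form_def lin_form_def)
  qed
  then show ?thesis
    by (simp add: comul_sum_def case_prod_unfold comp_def map_concat sum_list_concat)
qed

lemma comul_sum_swap: "comul_sum (\<lambda>p q. comul_sum (\<lambda>r s. M p q r s) y) x = comul_sum
    (\<lambda>r s. comul_sum (\<lambda>p q. M p q r s) x) y"
proof -
  have "(\<Sum>i\<leftarrow>I. \<Sum>j\<leftarrow>J. F i j) = (\<Sum>j\<leftarrow>J. \<Sum>i\<leftarrow>I. F i j)" for I :: "'i list" and J :: "'j list" and F ::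
      "'i \<Rightarrow> 'j \<Rightarrow> 'k"
    by (induction I) (auto simp: sum_list_addf)
  then show ?thesis by (simp add: comul_sum_def case_prod_unfold)
qed

lemma comul_sum_plus: "comul_sum (\<lambda>p q. M p q + N p q) x = comul_sum M x + comul_sum N x"
  by (simp add: comul_sum_def case_prod_unfold sum_list_addf)
lemma comul_sum_cmult: "comul_sum (\<lambda>p q. c * M p q) x = c * comul_sum M x"
  by (simp add: comul_sum_def case_prod_unfold sum_list_const_mult)
lemma comul_sum_multc: "comul_sum (\<lambda>p q. M p q * c) x = comul_sum M x * c"
  by (simp add: comul_sum_def case_prod_unfold sum_list_mult_const)
lemma comul_sum_sum: "comul_sum (\<lambda>p q. \<Sum>i\<in>I. M i p q) x = (\<Sum>i\<in>I. comul_sum (M i) x)"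
  by (simp add: comul_sum_def case_prod_unfold sum_list_sum_swap)

lemma lin_form_counit: "lin_form counit"
  using counit_linear by (simp add: lin_form_iff_linear)

lemma comul_sum_counit_left: "lin_form f \<Longrightarrow> comul_sum (\<lambda>p q. counit p * f q) x = f x"
  using arg_cong[OF counit_left[of x], of f]
  by (simp add: comul_sum_def lin_form_sum_list case_prod_unfold lin_form_scale)

lemma comul_sum_counit_right: "lin_form f \<Longrightarrow> comul_sum (\<lambda>p q. counit q * f p) x = f x"
  using arg_cong[OF counit_right[of x], of f]
  by (simp add: comul_sum_def lin_form_sum_list case_prod_unfold lin_form_scale)

lemma comul_sum_antipode_left: "lin_form f \<Longrightarrow> comul_sum (\<lambda>p q. f (antipode p * q)) x = counit x * f
    1"
  using arg_cong[OF antipode_left[of x], of f]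
  by (simp add: comul_sum_def lin_form_sum_list case_prod_unfold lin_form_scale)

lemma comul_sum_antipode_right: "lin_form f \<Longrightarrow> comul_sum (\<lambda>p q. f (p * antipode q)) x = counit x * f
    1"
  using arg_cong[OF antipode_right[of x], of f]
  by (simp add: comul_sum_def lin_form_sum_list case_prod_unfold lin_form_scale)

lemma comul_sum_one: "bilin_form M \<Longrightarrow> comul_sum M 1 = M 1 1"
  unfolding comul_sum_def
  by (subst tensor_sum_bilin_form[of "comul 1" "[(1, 1)]"]) (use comul_one in auto)

lemma comul_sum_mult:
  assumes "bilin_form M" shows "comul_sum M (x * y) = comul_sum
    (\<lambda>p q. comul_sum (\<lambda>r s. M (p * r) (q * s)) y) x"
proof -
  have "comul_sum M (x * y) = (\<Sum>(p, q)\<leftarrow>[(p * r, q * s). (p, q) \<leftarrow> comul x, (r, s) \<leftarrow> comul y]. M p q)"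
    unfolding comul_sum_def
    by (rule tensor_sum_bilin_form[OF _ assms])
      (use comul_mult[of x y] in \<open>simp add: case_prod_unfold comp_def map_concat\<close>)
  then show ?thesis
    by (simp add: comul_sum_def case_prod_unfold comp_def map_concat sum_list_concat)
qed

section \<open>The antipode reverses products and coproducts\<close>

lemma antipode_add: "antipode (x + y) = antipode x + antipode y"
  and antipode_scale: "antipode (c *s x) = c *s antipode x"
  using antipode_linear by (simp_all add: linear_iff)

named_theorems lin_simps
lemmas [lin_simps] = lin_form_def bilin_form_def trilin_form_def comul_sum_add comul_sum_scale
    comul_sum_plus comul_sum_cmult antipode_add antipode_scale
  distrib_left distrib_right scale_mult_left scale_mult_right

lemma antipode_one: "antipode 1 = 1"
proof (rule eq_by_lin_form)
  fix f assume f: "lin_form f"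
  have "comul_sum (\<lambda>p q. f (antipode p * q)) 1 = f (antipode 1)"
    by (subst comul_sum_one) (use f in \<open>auto simp: lin_simps\<close>)
  then show "f (antipode 1) = f 1" using comul_sum_antipode_left[OF f, of 1] by
    (simp add: counit_one)
qed

lemma counit_antipode: "counit (antipode x) = counit x"
proof -
  have "comul_sum (\<lambda>p q. counit (antipode p * q)) x = comul_sum
      (\<lambda>p q. counit q * counit (antipode p)) x"
    by (simp add: counit_mult mult.commute)
  also have "\<dots> = counit (antipode x)"
    by (rule comul_sum_counit_right) (use lin_form_counit in \<open>simp add: lin_simps\<close>)
  finally show ?thesis using comul_sum_antipode_left[OF lin_form_counit] by (simp add: counit_one)
qed

text \<open>Uniqueness of convolution inverses: \<gamma>(xy) and \<gamma>(y)\<gamma>(x) are both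
  inverse to the multiplication of A. The terms \<open>F\<close> are those of \<gamma>(x'y') x''y''
  \<gamma>(y''')\<gamma>(x'''), and their sum is evaluated with two bracketings.\<close>

lemma antipode_mult: "antipode (x * y) = antipode y * antipode x"
proof (rule eq_by_lin_form)
  fix f assume f: "lin_form f"
  define F where "F p q1 q2 r s1 s2 = f (antipode (p * r) * (q1 * s1) *
    (antipode s2 * antipode q2))"
    for p q1 q2 r s1 s2
  \<comment> \<open>First bracketing: \<open>s1\<close> cancels against \<open>antipode s2\<close>,
    and then \<open>q1\<close> against \<open>antipode q2\<close>.\<close>
  have 1: "comul_sum (\<lambda>s1 s2. F p q1 q2 r s1 s2) s = counit s * f
      (antipode (p * r) * (q1 * antipode q2))" for p q1 q2 r s
    using comul_sum_antipode_right[of "\<lambda>z. f (antipode (p * r) * (q1 * z * antipode q2))" s] f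
    by (simp add: F_def mult.assoc lin_simps)
  have 2: "comul_sum (\<lambda>q1 q2. comul_sum (\<lambda>s1 s2. F p q1 q2 r s1 s2) s) q = counit q *
      (counit s * f (antipode (p * r)))" for p q r s
    using comul_sum_antipode_right[of "\<lambda>z. f (antipode (p * r) * z)" q] f
    by (simp add: 1 mult.assoc lin_simps mult.left_commute)
  have "comul_sum (\<lambda>p q. comul_sum (\<lambda>q1 q2. comul_sum (\<lambda>r s. comul_sum (\<lambda>s1 s2. F p q1 q2 r s1 s2)
      s) y) q) x
      = comul_sum (\<lambda>p q. comul_sum (\<lambda>r s. comul_sum (\<lambda>q1 q2. comul_sum (\<lambda>s1 s2. F p q1 q2 r s1 s2)
        s) q) y) x"
    by (subst (2) comul_sum_swap) (rule refl)
  also have "\<dots> = comul_sum (\<lambda>p q. counit q * f (antipode (p * y))) x"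
    using comul_sum_counit_right[of "\<lambda>r. f (antipode (p * r))" y for p] f by
      (simp add: 2 comul_sum_cmult lin_simps)
  also have "\<dots> = f (antipode (x * y))"
    by (rule comul_sum_counit_right) (use f in \<open>simp add: lin_simps\<close>)
  finally have A: "comul_sum (\<lambda>p q. comul_sum (\<lambda>q1 q2. comul_sum
    (\<lambda>r s. comul_sum (\<lambda>s1 s2. F p q1 q2 r s1 s2) s) y) q) x = f (antipode (x * y))" .
  \<comment> \<open>Second bracketing: coassociativity collects \<open>p\<close>, \<open>q1\<close>
    into \<Delta>(u) and \<open>r\<close>, \<open>s1\<close> into \<Delta>(v), so that the antipode
    axiom applies to \<open>u * v\<close>.\<close>
  have "comul_sum (\<lambda>p q. comul_sum (\<lambda>q1 q2. comul_sum (\<lambda>r s. comul_sum (\<lambda>s1 s2. F p q1 q2 r s1 s2)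
      s) y) q) x
     = comul_sum (\<lambda>p q. comul_sum (\<lambda>q1 q2. comul_sum (\<lambda>v s2. comul_sum (\<lambda>r s1. F p q1 q2 r s1 s2) v)
       y) q) x"
    by (subst comul_sum_coassoc) (use f in \<open>auto simp: lin_simps F_def\<close>)
  also have "\<dots> = comul_sum (\<lambda>u q2. comul_sum (\<lambda>p q1. comul_sum
      (\<lambda>v s2. comul_sum (\<lambda>r s1. F p q1 q2 r s1 s2) v) y) u) x"
    by (subst comul_sum_coassoc) (use f in \<open>auto simp: lin_simps F_def\<close>)
  also have "\<dots> = comul_sum (\<lambda>u q2. comul_sum (\<lambda>v s2. comul_sum
      (\<lambda>p q1. comul_sum (\<lambda>r s1. F p q1 q2 r s1 s2) v) u) y) x"
    by (subst (2) comul_sum_swap) (rule refl)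
  also have "\<dots> = comul_sum (\<lambda>u q2. comul_sum (\<lambda>v s2. comul_sum
      (\<lambda>P Q. f (antipode P * Q * (antipode s2 * antipode q2))) (u * v)) y) x"
    unfolding F_def by (subst comul_sum_mult) (use f in \<open>auto simp: lin_simps F_def\<close>)
  also have "\<dots> = comul_sum (\<lambda>u q2. comul_sum (\<lambda>v s2. counit (u * v) * f (antipode s2 * antipode q2))
      y) x"
    using comul_sum_antipode_left[of "\<lambda>z. f (z * (antipode s2 * antipode q2))" for s2 q2] f by
      (simp add: lin_simps)
  also have "\<dots> = comul_sum (\<lambda>u q2. counit u * f (antipode y * antipode q2)) x"
    using comul_sum_counit_left[of "\<lambda>s2. f (antipode s2 * antipode q2)" y for q2] f
    by (simp add: counit_mult mult.assoc comul_sum_cmult lin_simps)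
  also have "\<dots> = f (antipode y * antipode x)"
    by (rule comul_sum_counit_left) (use f in \<open>simp add: lin_simps\<close>)
  finally show "f (antipode (x * y)) = f (antipode y * antipode x)"
    using A by simp
qed

text \<open>The same uniqueness argument for maps from A to A \<otimes> A: \<Delta>\<gamma> and the
  flipped (\<gamma> \<otimes> \<gamma>)\<Delta> are both convolution inverse to \<Delta>.
  \<open>F\<close> collects the terms of \<Delta>(\<gamma>(x1)) \<Delta>(x2) (\<gamma>(x4) \<otimes>
  \<gamma>(x3)), with \<open>g\<close> and \<open>h\<close> the factors of
  \<Delta>(\<gamma>(x1)).\<close>

lemma comul_sum_antipode:
  assumes M: "bilin_form M"
  shows "comul_sum M (antipode x) = comul_sum (\<lambda>p q. M (antipode q) (antipode p)) x"
proof -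
  define F where "F x2 z g h = comul_sum (\<lambda>x3 x4. comul_sum
    (\<lambda>p q. M (g * p * antipode x4) (h * q * antipode x3)) x2) z"
    for x2 z g h
  note M' = M[unfolded bilin_form_def lin_form_def, simplified]
  have 2: "comul_sum (\<lambda>x2 z. F x2 z g h) y = counit y * M g h" for g h y
  proof -
    have "comul_sum (\<lambda>x2 z. F x2 z g h) y =
        comul_sum (\<lambda>x2 z. comul_sum (\<lambda>p q. comul_sum (\<lambda>x3 x4. M (g * p * antipode x4)
          (h * q * antipode x3)) z) x2) y"
      unfolding F_def by (subst (2) comul_sum_swap) (rule refl)
    also have "\<dots> = comul_sum (\<lambda>p w. comul_sum (\<lambda>q z. comul_sum
        (\<lambda>x3 x4. M (g * p * antipode x4) (h * q * antipode x3)) z) w) y"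
      by (subst comul_sum_coassoc) (use M' in \<open>auto simp: lin_simps\<close>)
    also have "\<dots> = comul_sum (\<lambda>p w. comul_sum (\<lambda>t x4. comul_sum
        (\<lambda>q x3. M (g * p * antipode x4) (h * q * antipode x3)) t) w) y"
      by (subst comul_sum_coassoc) (use M' in \<open>auto simp: lin_simps\<close>)
    also have "\<dots> = comul_sum (\<lambda>p w. comul_sum (\<lambda>t x4. counit t * M (g * p * antipode x4) h) w) y"
      using comul_sum_antipode_right[of "\<lambda>z. M (g * p * antipode x4) (h * z)" for p x4] M'
      by (simp add: lin_simps mult.assoc)
    also have "\<dots> = comul_sum (\<lambda>p w. M (g * p * antipode w) h) y"
      using comul_sum_counit_left[of "\<lambda>x4. M (g * p * antipode x4) h" for p] M'
      by (simp add: lin_simps)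
    also have "\<dots> = counit y * M g h"
      using comul_sum_antipode_right[of "\<lambda>z. M (g * z) h" y] M'
      by (simp add: lin_simps mult.assoc)
    finally show ?thesis .
  qed
  have "comul_sum (\<lambda>x1 y. comul_sum (\<lambda>x2 z. comul_sum (\<lambda>g h. F x2 z g h) (antipode x1)) y) x =
      comul_sum (\<lambda>x1 y. comul_sum (\<lambda>g h. comul_sum (\<lambda>x2 z. F x2 z g h) y) (antipode x1)) x"
    by (subst (2) comul_sum_swap) (rule refl)
  also have "\<dots> = comul_sum (\<lambda>x1 y. counit y * comul_sum M (antipode x1)) x"
    by (simp add: 2 comul_sum_cmult)
  also have "\<dots> = comul_sum M (antipode x)"
    by (rule comul_sum_counit_right) (use M in \<open>simp add: lin_simps\<close>)
  finally have A: "comul_sum (\<lambda>x1 y. comul_sum (\<lambda>x2 z. comul_sum (\<lambda>g h. F x2 z g h) (antipode x1))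
    y) x = comul_sum M (antipode x)" .
  \<comment> \<open>\<open>N z\<close> is \<open>M\<close> after right multiplication by the flipped
    (\<gamma> \<otimes> \<gamma>)\<Delta>(z). Its linearity in \<open>z\<close> is recorded because
    coassociativity is about to be applied to an expression in which \<open>z\<close> is one of the
    three variables.\<close>
  define N where "N z P Q = comul_sum (\<lambda>x3 x4. M (P * antipode x4) (Q * antipode x3)) z" for z P Q
  have N: "bilin_form (N z)" for z
    using M' by (auto simp: lin_simps N_def)
  have N_lin: "N (y + z) = (\<lambda>P Q. N y P Q + N z P Q)" "N (c *s z) = (\<lambda>P Q. c * N z P Q)" for y z c
  proof -
    have "bilin_form (\<lambda>x3 x4. M (P * antipode x4) (Q * antipode x3))" for P Q
      using M' by (auto simp: lin_simps)
    from lin_form_comul_sum[OF this]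
    show "N (y + z) = (\<lambda>P Q. N y P Q + N z P Q)" "N (c *s z) = (\<lambda>P Q. c * N z P Q)"
      by (simp_all add: N_def lin_form_def fun_eq_iff)
  qed
  have DN: "comul_sum (N z) (x + y) = comul_sum (N z) x + comul_sum (N z) y"
      "comul_sum (N z) (c *s x) = c * comul_sum (N z) x"
      "comul_sum (N (y + z)) x = comul_sum (N y) x + comul_sum (N z) x"
        "comul_sum (N (c *s z)) x = c * comul_sum (N z) x" for x y z c
    by (simp_all only: comul_sum_add[OF N] comul_sum_scale[OF N] N_lin comul_sum_plus
      comul_sum_cmult)
  have "comul_sum (\<lambda>g h. F x2 z g h) v = comul_sum (N z) (v * x2)" for x2 z v
  proof -
    have "comul_sum (\<lambda>g h. F x2 z g h) v = comul_sum (\<lambda>g h. comul_sum (\<lambda>p q. N z (g * p) (h * q))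
        x2) v"
      unfolding F_def N_def by (subst (2) comul_sum_swap) (rule refl)
    then show ?thesis by (simp add: comul_sum_mult[OF N])
  qed
  then have "comul_sum (\<lambda>x1 y. comul_sum (\<lambda>x2 z. comul_sum (\<lambda>g h. F x2 z g h) (antipode x1)) y) x
     = comul_sum (\<lambda>x1 y. comul_sum (\<lambda>x2 z. comul_sum (N z) (antipode x1 * x2)) y) x"
    by simp
  also have "\<dots> = comul_sum (\<lambda>u z. comul_sum (\<lambda>x1 x2. comul_sum (N z) (antipode x1 * x2)) u) x"
    by (subst comul_sum_coassoc) (simp_all add: trilin_form_def lin_form_def DN antipode_add
      antipode_scale distrib_left distrib_right scale_mult_left scale_mult_right)
  also have "\<dots> = comul_sum (\<lambda>u z. counit u * comul_sum (N z) 1) x"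
    using comul_sum_antipode_left[OF lin_form_comul_sum[OF N]] by simp
  also have "\<dots> = comul_sum (\<lambda>u z. counit u * comul_sum (\<lambda>p q. M (antipode q) (antipode p)) z) x"
    by (simp add: comul_sum_one[OF N] N_def)
  also have "\<dots> = comul_sum (\<lambda>p q. M (antipode q) (antipode p)) x"
    by (rule comul_sum_counit_left) (use M' in \<open>auto simp: lin_simps\<close>)
  finally show ?thesis using A by simp
qed

end

text \<open>Inside this locale \<open>'a\<close> is the type of scalars and \<open>'b\<close> that
  of the algebra.\<close>

locale bijective_antipode = finite_dimensional_hopf_algebra +
  assumes bij_antipode: "bij antipode"
begin

abbreviation antipode_inv :: "'b \<Rightarrow> 'b" where "antipode_inv \<equiv> inv antipode"

lemma antipode_inv_antipode: "antipode_inv (antipode x) = x"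
  using bij_antipode by (simp add: bij_is_inj)
lemma antipode_antipode_inv: "antipode (antipode_inv x) = x"
  using bij_antipode by (simp add: bij_is_surj surj_f_inv_f)
lemma antipode_inv_eq: "antipode y = x \<Longrightarrow> antipode_inv x = y"
  using antipode_inv_antipode by auto
lemma antipode_inv_add: "antipode_inv (x + y) = antipode_inv x + antipode_inv y"
  by (rule antipode_inv_eq) (simp add: antipode_add antipode_antipode_inv)
lemma antipode_inv_scale: "antipode_inv (c *s x) = c *s antipode_inv x"
  by (rule antipode_inv_eq) (simp add: antipode_scale antipode_antipode_inv)
lemma antipode_inv_one: "antipode_inv 1 = 1"
  by (rule antipode_inv_eq) (rule antipode_one)
lemma antipode_inv_mult: "antipode_inv (x * y) = antipode_inv y * antipode_inv x"
  by (rule antipode_inv_eq) (simp add: antipode_mult antipode_antipode_inv)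
lemma counit_antipode_inv: "counit (antipode_inv x) = counit x"
  using counit_antipode[of "antipode_inv x"] by (simp add: antipode_antipode_inv)

lemma comul_sum_antipode_inv:
  assumes "bilin_form M"
  shows "comul_sum M (antipode_inv x) = comul_sum (\<lambda>p q. M (antipode_inv q) (antipode_inv p)) x"
proof -
  have "bilin_form (\<lambda>p q. M (antipode_inv q) (antipode_inv p))"
    using assms by (simp add: lin_simps antipode_inv_add antipode_inv_scale)
  from comul_sum_antipode[OF this, of "antipode_inv x"] show ?thesis
    by (simp add: antipode_inv_antipode antipode_antipode_inv)
qed

text \<open>The inverse antipode is an antipode for the flipped coproduct: apply it to the axiom
  \<Sum> \<gamma>(x')x'' = \<epsilon>(x)1.\<close>

lemma comul_sum_antipode_inv_left:
  assumes "lin_form f" shows "comul_sum (\<lambda>p q. f (antipode_inv q * p)) x = counit x * f 1"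
  using comul_sum_antipode_left[of "\<lambda>z. f (antipode_inv z)" x] assms
  by (simp add: lin_simps antipode_inv_add antipode_inv_scale antipode_inv_mult
    antipode_inv_antipode antipode_inv_one)

end

section \<open>The Heisenberg double as an algebra\<close>

context finite_dimensional_hopf_algebra
begin

lemma heis_carrier_iff:
  "F \<in> heis_carrier \<longleftrightarrow> (\<forall>x y. F (x + y) = F x + F y) \<and> (\<forall>c x. F (c *s x) = c *s F x)"
  by (simp add: heis_carrier_def linear_iff)

lemma lin_form_expansion: "lin_form f \<Longrightarrow> f x = (\<Sum>b\<in>Basis. dual_basis b x * f b)"
  using linear_functional_expansion[of f x] by (simp add: lin_form_iff_linear)

lemma bilin_form_heis_mult: 
  assumes "G \<in> heis_carrier" "lin_form f"
  shows "bilin_form (\<lambda>a b. f (b * G (z * a)))"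
  using assms by (simp add: lin_simps heis_carrier_iff)

lemma heis_mult_apply:
  assumes F: "F \<in> heis_carrier" and G: "G \<in> heis_carrier" and f: "lin_form f"
  shows "f (heis_mult F G y) = comul_sum (\<lambda>y1 y2. comul_sum (\<lambda>a b. f (b * G (y2 * a))) (F y1)) y"
proof -
  have 1: "(\<Sum>c\<in>Basis. dual_basis c z * f (w * G c)) = f (w * G z)" for z w
    using lin_form_expansion[of "\<lambda>c. f (w * G c)" z] f G by (simp add: lin_simps heis_carrier_iff)
  have 2: "(\<Sum>b\<in>Basis. dual_basis b v * comul_sum (\<lambda>a w. f (w * G (z * a))) (F b)) =
      comul_sum (\<lambda>a w. f (w * G (z * a))) (F v)" for z v
    using lin_form_expansion[of "\<lambda>b. comul_sum (\<lambda>a w. f (w * G (z * a))) (F b)" v]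
      lin_form_comul_sum[OF bilin_form_heis_mult[OF G f]] F
    by (simp add: lin_form_def heis_carrier_iff)
  have "f (heis_mult F G y) = (\<Sum>b\<in>Basis. \<Sum>c\<in>Basis. comul_sum (\<lambda>a w.
      comul_sum (\<lambda>p q. dual_basis b p * dual_basis c (q * a)) y * f (w * G c)) (F b))"
    by (simp add: heis_mult_def sum_apply sum_list_apply lin_form_sum[OF f] lin_form_sum_list[OF f]
      tens_def
        lin_form_scale[OF f] comul_sum_def dual_mult_def case_prod_unfold)
  also have "\<dots> = (\<Sum>b\<in>Basis. comul_sum (\<lambda>a w. comul_sum (\<lambda>p q. dual_basis b p * 
      (\<Sum>c\<in>Basis. dual_basis c (q * a) * f (w * G c))) y) (F b))"
    by (simp add: comul_sum_sum[symmetric] comul_sum_multc[symmetric] sum_distrib_left mult.assoc)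
  also have "\<dots> = (\<Sum>b\<in>Basis. comul_sum (\<lambda>p q. comul_sum (\<lambda>a w. dual_basis b p * f (w * G (q * a)))
      (F b)) y)"
    unfolding 1 by (subst comul_sum_swap) (rule refl)
  also have "\<dots> = comul_sum (\<lambda>p q. \<Sum>b\<in>Basis. dual_basis b p * comul_sum (\<lambda>a w. f (w * G (q * a)))
      (F b)) y"
    by (simp add: comul_sum_sum comul_sum_cmult)
  finally show ?thesis unfolding 2 .
qed

lemma heis_mult_bilin_form:
  assumes F: "F \<in> heis_carrier" and G: "G \<in> heis_carrier" and f: "lin_form f"
  shows "bilin_form (\<lambda>y1 y2. comul_sum (\<lambda>a b. f (b * G (y2 * a))) (F y1))"
proof (rule bilin_formI)
  show "lin_form (\<lambda>x. comul_sum (\<lambda>a b. f (b * G (y * a))) (F x))" for y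
    using lin_form_comul_sum[OF bilin_form_heis_mult[OF G f]] F by
      (simp add: lin_form_def heis_carrier_iff)
  show "lin_form (\<lambda>y. comul_sum (\<lambda>a b. f (b * G (y * a))) (F x))" for x
    using f G by (simp add: lin_form_def heis_carrier_iff distrib_left distrib_right
        scale_mult_left scale_mult_right comul_sum_plus comul_sum_cmult)
qed

lemma heis_mult_carrier:
  assumes F: "F \<in> heis_carrier" and G: "G \<in> heis_carrier"
  shows "heis_mult F G \<in> heis_carrier"
  unfolding heis_carrier_iff
proof (intro conjI allI; rule eq_by_lin_form)
  fix x y c f assume f: "lin_form f"
  note bilin_form = heis_mult_bilin_form[OF F G f]
  show "f (heis_mult F G (x + y)) = f (heis_mult F G x + heis_mult F G y)"
    by (simp add: lin_form_add[OF f] heis_mult_apply[OF F G f] comul_sum_add[OF bilin_form])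
  show "f (heis_mult F G (c *s x)) = f (c *s heis_mult F G x)"
    by (simp add: lin_form_scale[OF f] heis_mult_apply[OF F G f] comul_sum_scale[OF bilin_form])
qed

lemma heis_carrier_plus: "F \<in> heis_carrier \<Longrightarrow> G \<in> heis_carrier \<Longrightarrow> F + G \<in> heis_carrier"
  by (simp add: heis_carrier_iff scale_right_distrib)

lemma heis_carrier_heis_scale: "F \<in> heis_carrier \<Longrightarrow> heis_scale c F \<in> heis_carrier"
  by (simp add: heis_carrier_iff heis_scale_def scale_right_distrib scale_left_commute)

lemma tens_carrier: "lin_form f \<Longrightarrow> tens f a \<in> heis_carrier"
  by (simp add: heis_carrier_iff lin_form_def tens_def scale_left_distrib)

lemma heis_one_carrier: "heis_one \<in> heis_carrier"
  by (simp add: heis_one_def tens_carrier lin_form_counit)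

lemma heis_mult_add_left:
  assumes "F \<in> heis_carrier" "F' \<in> heis_carrier" "G \<in> heis_carrier"
  shows "heis_mult (F + F') G = heis_mult F G + heis_mult F' G"
  by (rule ext, rule eq_by_lin_form)
    (simp add: assms heis_mult_apply heis_carrier_plus lin_form_add
      comul_sum_add[OF bilin_form_heis_mult] comul_sum_plus)

lemma heis_mult_add_right:
  assumes "F \<in> heis_carrier" "G' \<in> heis_carrier" "G \<in> heis_carrier"
  shows "heis_mult F (G + G') = heis_mult F G + heis_mult F G'"
  by (rule ext, rule eq_by_lin_form)
    (simp add: assms heis_mult_apply heis_carrier_plus lin_form_add distrib_left comul_sum_plus)

lemma heis_mult_scale_left:
  assumes "F \<in> heis_carrier" "G \<in> heis_carrier"
  shows "heis_mult (heis_scale c F) G = heis_scale c (heis_mult F G)"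
  by (rule ext, rule eq_by_lin_form)
    (use heis_carrier_heis_scale[of F c] in \<open>simp add: assms heis_mult_apply heis_scale_def
      lin_form_scale
      comul_sum_scale[OF bilin_form_heis_mult] comul_sum_cmult\<close>)

lemma heis_mult_scale_right:
  assumes "F \<in> heis_carrier" "G \<in> heis_carrier"
  shows "heis_mult F (heis_scale c G) = heis_scale c (heis_mult F G)"
  by (rule ext, rule eq_by_lin_form)
    (use heis_carrier_heis_scale[of G c] in \<open>simp add: assms heis_mult_apply heis_scale_def
      lin_form_scale
      scale_mult_right comul_sum_cmult\<close>)

text \<open>The algebra \<open>H(A)\<close> acts on \<open>A\<^sup>*\<close>, with \<open>f \<otimes> a\<close> sending \<open>h\<close> to \<open>f h(? a)\<close>; below is the
  transposed action on \<open>A\<close>.\<close>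

definition heis_action :: "('a \<Rightarrow> 'a) \<Rightarrow> 'a \<Rightarrow> 'a" where
  "heis_action F x = (\<Sum>(p, q)\<leftarrow>comul x. q * F p)"

lemma heis_action_apply: "lin_form f \<Longrightarrow> f (heis_action F x) = comul_sum (\<lambda>p q. f (q * F p)) x"
  by (simp add: heis_action_def comul_sum_def lin_form_sum_list case_prod_unfold)

text \<open>H(A) acts on the dual from the left, so the transposed action composes in the opposite
  order. Coassociativity and the multiplicativity of \<Delta>, applied to x'' F(x'), give the
  formula.\<close>

lemma heis_action_mult:
  assumes F: "F \<in> heis_carrier" and G: "G \<in> heis_carrier"
  shows "heis_action (heis_mult F G) x = heis_action G (heis_action F x)"
proof (rule eq_by_lin_form)
  fix f assume f: "lin_form f"
  have fw: "lin_form (\<lambda>z. f (w * z))" for w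
    using f by (simp add: lin_simps)
  have g: "lin_form (\<lambda>z. f (heis_action G z))"
    unfolding heis_action_apply[OF f] by (rule lin_form_comul_sum)
      (use f G in \<open>simp add: lin_simps heis_carrier_iff\<close>)
  have "f (heis_action (heis_mult F G) x) =
      comul_sum (\<lambda>u w. comul_sum (\<lambda>y1 y2. comul_sum (\<lambda>a b. f (w * (b * G (y2 * a)))) (F y1)) u) x"
    by (simp add: heis_action_apply[OF f] heis_mult_apply[OF F G fw])
  also have "\<dots> = comul_sum (\<lambda>y1 v. comul_sum (\<lambda>y2 w. comul_sum (\<lambda>a b. f (w * (b * G (y2 * a))))
      (F y1)) v) x"
  proof (rule comul_sum_coassoc)
    have "bilin_form (\<lambda>a b. f (w * (b * G (y2 * a))))" for w y2
      using f G by (simp add: lin_simps heis_carrier_iff)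
    from lin_form_comul_sum[OF this] show "trilin_form (\<lambda>y1 y2 w. comul_sum
      (\<lambda>a b. f (w * (b * G (y2 * a)))) (F y1))"
      using f F G by (simp add: trilin_form_def lin_form_def heis_carrier_iff distrib_left
        distrib_right
        scale_mult_left scale_mult_right comul_sum_plus comul_sum_cmult)
  qed
  also have "\<dots> = comul_sum (\<lambda>y1 v. comul_sum (\<lambda>P Q. f (Q * G P)) (v * F y1)) x"
    by (subst comul_sum_mult) (use f G in \<open>auto simp: lin_simps heis_carrier_iff mult.assoc\<close>)
  also have "\<dots> = f (heis_action G (heis_action F x))"
    unfolding heis_action_apply[OF g, of F] by (simp add: heis_action_apply[OF f])
  finally show "f (heis_action (heis_mult F G) x) = f (heis_action G (heis_action F x))" .
qed

lemma heis_action_tens: "lin_form f \<Longrightarrow> f (heis_action (tens h a) x) = comul_sum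
    (\<lambda>p q. h p * f (q * a)) x"
  by (simp add: heis_action_apply tens_def scale_mult_right lin_form_scale)

lemma heis_action_one: "heis_action heis_one x = x"
  by (rule eq_by_lin_form) (simp add: heis_one_def heis_action_tens comul_sum_counit_left)

end

context bijective_antipode
begin

text \<open>A linear map is recovered from its action as F(x) = \<Sum> \<gamma>^-1(x'') (F.x'),
  since the inverse antipode of x''' cancels against x'' in \<Sum> \<gamma>^-1(x''') x'' F(x').
  Identities in H(A) may thus be checked on operators on A.\<close>

lemma heis_action_inject:
  assumes F: "F \<in> heis_carrier" and G: "G \<in> heis_carrier"
    and eq: "\<And>x. heis_action F x = heis_action G x"
  shows "F = G"
proof (rule ext, rule eq_by_lin_form)
  have inv: "comul_sum (\<lambda>u q. f (antipode_inv q * heis_action F u)) x = f (F x)" if f: "lin_form f"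
      and F: "F \<in> heis_carrier" for f F x
  proof -
    have "comul_sum (\<lambda>u q. f (antipode_inv q * heis_action F u)) x = comul_sum
        (\<lambda>u q. comul_sum (\<lambda>p r. f (antipode_inv q * (r * F p))) u) x"
      using heis_action_apply[of "\<lambda>z. f (antipode_inv q * z)" for q] f by (simp add: lin_simps)
    also have "\<dots> = comul_sum (\<lambda>p w. comul_sum (\<lambda>r q. f (antipode_inv q * (r * F p))) w) x"
      by (rule comul_sum_coassoc) (use f F in \<open>simp add: lin_simps heis_carrier_iff antipode_inv_add
        antipode_inv_scale\<close>)
    also have "\<dots> = comul_sum (\<lambda>p w. counit w * f (F p)) x"
      using comul_sum_antipode_inv_left[of "\<lambda>z. f (z * F p)" for p] f by
        (simp add: lin_simps mult.assoc)
    also have "\<dots> = f (F x)"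
      by (rule comul_sum_counit_right) (use f F in \<open>simp add: lin_simps heis_carrier_iff\<close>)
    finally show ?thesis .
  qed
  fix f x assume f: "lin_form f"
  show "f (F x) = f (G x)"
    using inv[OF f F, of x] inv[OF f G, of x] by (simp add: eq)
qed

lemma heis_mult_assoc:
  assumes "F \<in> heis_carrier" "G \<in> heis_carrier" "K \<in> heis_carrier"
  shows "heis_mult (heis_mult F G) K = heis_mult F (heis_mult G K)"
  by (rule heis_action_inject) (simp_all add: assms heis_mult_carrier heis_action_mult)

lemma heis_mult_one:
  assumes "F \<in> heis_carrier"
  shows "heis_mult heis_one F = F" "heis_mult F heis_one = F"
  by (rule heis_action_inject;
      simp add: assms heis_mult_carrier heis_action_mult heis_one_carrier heis_action_one)+

section \<open>The copies of A and of its dual in the Heisenberg double\<close>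

definition alg_incl :: "'b \<Rightarrow> 'b \<Rightarrow> 'b" where "alg_incl a = tens counit a"
definition dual_incl :: "('b \<Rightarrow> 'a) \<Rightarrow> 'b \<Rightarrow> 'b" where "dual_incl f = tens f 1"

lemma alg_incl_carrier: "alg_incl a \<in> heis_carrier"
  by (simp add: alg_incl_def tens_carrier lin_form_counit)
lemma dual_incl_carrier: "lin_form f \<Longrightarrow> dual_incl f \<in> heis_carrier"
  by (simp add: dual_incl_def tens_carrier)

lemma alg_incl_one: "alg_incl 1 = heis_one" and dual_incl_counit: "dual_incl counit = heis_one"
  by (simp_all add: alg_incl_def dual_incl_def heis_one_def)

lemma heis_action_alg_incl: "heis_action (alg_incl a) x = x * a"
  by (rule eq_by_lin_form) (simp add: alg_incl_def heis_action_tens comul_sum_counit_left lin_simps)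

lemma heis_action_dual_incl: "lin_form f \<Longrightarrow> f (heis_action (dual_incl g) x) = comul_sum
    (\<lambda>p q. g p * f q) x"
  by (simp add: dual_incl_def heis_action_tens)

lemma alg_incl_mult: "heis_mult (alg_incl a) (alg_incl b) = alg_incl (a * b)"
  by (rule heis_action_inject)
    (simp_all add: alg_incl_carrier heis_mult_carrier heis_action_mult heis_action_alg_incl
      mult.assoc)

lemma dual_mult_comul_sum: "dual_mult f g = comul_sum (\<lambda>p q. f p * g q)"
  by (simp add: dual_mult_def comul_sum_def fun_eq_iff)

lemma lin_form_dual_mult: "lin_form f \<Longrightarrow> lin_form g \<Longrightarrow> lin_form (dual_mult f g)"
  unfolding dual_mult_comul_sum by (rule lin_form_comul_sum) (simp add: lin_simps algebra_simps)

lemma dual_incl_mult: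
  assumes "lin_form f" "lin_form g" shows "heis_mult (dual_incl f) (dual_incl g) = dual_incl
    (dual_mult f g)"
proof (rule heis_action_inject)
  fix x
  show "heis_action (heis_mult (dual_incl f) (dual_incl g)) x = heis_action
      (dual_incl (dual_mult f g)) x"
  proof (rule eq_by_lin_form)
    fix h assume h: "lin_form h"
    have "h (heis_action (heis_mult (dual_incl f) (dual_incl g)) x) = comul_sum
        (\<lambda>p v. f p * comul_sum (\<lambda>q r. g q * h r) v) x"
      unfolding heis_action_mult[OF dual_incl_carrier[OF assms(1)] dual_incl_carrier[OF assms(2)]] 
      using heis_action_dual_incl[of "\<lambda>z. h (heis_action (dual_incl g) z)"] h assms
      by (simp add: heis_action_dual_incl lin_simps algebra_simps)
    also have "\<dots> = comul_sum (\<lambda>p v. comul_sum (\<lambda>q r. f p * (g q * h r)) v) x"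
      by (simp add: comul_sum_cmult)
    also have "\<dots> = comul_sum (\<lambda>u r. comul_sum (\<lambda>p q. f p * (g q * h r)) u) x"
      by (subst comul_sum_coassoc) (use h assms in \<open>auto simp: lin_simps algebra_simps\<close>)
    also have "\<dots> = h (heis_action (dual_incl (dual_mult f g)) x)"
      by (simp add: heis_action_dual_incl[OF h] dual_mult_comul_sum mult.assoc[symmetric]
        comul_sum_multc)
    finally show "h (heis_action (heis_mult (dual_incl f) (dual_incl g)) x) = h
      (heis_action (dual_incl (dual_mult f g)) x)" .
  qed
qed (use assms in \<open>simp_all add: dual_incl_carrier heis_mult_carrier lin_form_dual_mult\<close>)

lemma dual_incl_alg_incl: assumes "lin_form f" shows "heis_mult (dual_incl f) (alg_incl a) = tens f
    a"
proof (rule heis_action_inject)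
  fix x
  show "heis_action (heis_mult (dual_incl f) (alg_incl a)) x = heis_action (tens f a) x"
  proof (rule eq_by_lin_form)
    fix h assume h: "lin_form h"
    show "h (heis_action (heis_mult (dual_incl f) (alg_incl a)) x) = h (heis_action (tens f a) x)"
      using heis_action_dual_incl[of "\<lambda>z. h (z * a)" f x] assms h
      by (simp add: heis_action_mult dual_incl_carrier alg_incl_carrier heis_action_alg_incl
        heis_action_tens lin_simps)
  qed
qed (use assms in \<open>simp_all add: dual_incl_carrier alg_incl_carrier heis_mult_carrier tens_carrier\<close>)

lemma dual_mult_counit: "lin_form f \<Longrightarrow> dual_mult counit f = f"
  by (simp add: dual_mult_comul_sum comul_sum_counit_left fun_eq_iff)

text \<open>The commutation rule of H(A), which brings an element of A to the right of a form. It is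
  the only relation between the two subalgebras that the pentagon uses.\<close>

lemma alg_incl_dual_incl:
  assumes "lin_form g"
  shows "heis_mult (alg_incl a) (dual_incl g) = (\<Sum>(p, q)\<leftarrow>comul a. heis_mult
      (dual_incl (\<lambda>x. g (x * p))) (alg_incl q))"
proof -
  have l: "lin_form (\<lambda>x. g (x * p))" for p using assms by (simp add: lin_simps)
  show ?thesis
    using assms lin_form_counit unfolding alg_incl_def[of a] dual_incl_def[of g]
    by (simp add: heis_mult_tens lin_form_iff_linear[symmetric] dual_mult_counit l
      dual_incl_alg_incl)
qed

end

section \<open>The pentagon equation\<close>

lemma sum_PiE_insert:
  assumes "q \<notin> C"
  shows "(\<Sum>a\<in>insert q C \<rightarrow>\<^sub>E B. F a) = (\<Sum>b\<in>B. \<Sum>a\<in>C \<rightarrow>\<^sub>E B. F (a(q := b)))"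
proof -
  have "(\<Sum>a\<in>insert q C \<rightarrow>\<^sub>E B. F a) = (\<Sum>(b, a)\<in>B \<times> (C \<rightarrow>\<^sub>E B). F (a(q := b)))"
    unfolding PiE_insert_eq
    by (subst sum.reindex) (use inj_combinator[OF assms, of "\<lambda>_. B"] in
      \<open>auto simp: case_prod_unfold\<close>)
  then show ?thesis by (simp add: sum.cartesian_product)
qed

text \<open>Readings go against the orientation, so the labels of a strand listed from top to bottom
  are reversed exactly when it is oriented downwards.\<close>

definition rev_if :: "bool \<Rightarrow> 'x list \<Rightarrow> 'x list" where
  "rev_if f xs = (if f then rev xs else xs)"

lemma rev_if_simps [simp]: "rev_if f [] = []" "rev_if f [x] = [x]" "rev_if True xs = rev xs"
    "rev_if False xs = xs"
    "mset (rev_if f xs) = mset xs" "set (rev_if f xs) = set xs"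
  by (simp_all add: rev_if_def)

context finite_dimensional_hopf_algebra
begin

text \<open>Linearity is asked for on \<open>heis_carrier\<close> only: the function type also
  contains non-linear maps, which are not elements of H(A). For the same reason
  \<open>dual_lin_form\<close> tests only linear forms.\<close>

definition heis_lin_form :: "(('a \<Rightarrow> 'a) \<Rightarrow> 'k) \<Rightarrow> bool" where
  "heis_lin_form h \<longleftrightarrow> (\<forall>F\<in>heis_carrier. \<forall>G\<in>heis_carrier. h (F + G) = h F + h G) \<and>
     (\<forall>c. \<forall>F\<in>heis_carrier. h (heis_scale c F) = c * h F)"

definition dual_lin_form :: "(('a \<Rightarrow> 'k) \<Rightarrow> 'k) \<Rightarrow> bool" where
  "dual_lin_form \<beta> \<longleftrightarrow> (\<forall>f g. lin_form f \<longrightarrow> lin_form g \<longrightarrow> \<beta> (\<lambda>x. f x + g x) = \<beta> f + \<beta> g) \<and>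
     (\<forall>c f. lin_form f \<longrightarrow> \<beta> (\<lambda>x. c * f x) = c * \<beta> f)"

definition multilin_form :: "nat \<Rightarrow> (('a \<Rightarrow> 'a) list \<Rightarrow> 'k) \<Rightarrow> bool" where
  "multilin_form n \<phi> \<longleftrightarrow>
     (\<forall>xs i. length xs = n \<longrightarrow> set xs \<subseteq> heis_carrier \<longrightarrow> i < n \<longrightarrow> heis_lin_form (\<lambda>F. \<phi> (xs[i := F])))"

lemma multilin_form_2:
  assumes "multilin_form 2 \<phi>" "X \<in> heis_carrier"
  shows "heis_lin_form (\<lambda>F. \<phi> [F, X])" "heis_lin_form (\<lambda>F. \<phi> [X, F])"
proof -
  have *: "heis_lin_form (\<lambda>F. \<phi> (xs[i := F]))" if "i < 2" "length xs = 2" "set xs \<subseteq> heis_carrier"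
      for i xs
    using assms that by (simp add: multilin_form_def)
  from *[of 0 "[X, X]"] *[of 1 "[X, X]"] assms(2) show "heis_lin_form (\<lambda>F. \<phi> [F, X])"
    "heis_lin_form (\<lambda>F. \<phi> [X, F])" by simp_all
qed

lemma multilin_form_3:
  assumes "multilin_form 3 \<phi>" "X \<in> heis_carrier" "Y \<in> heis_carrier"
  shows "heis_lin_form (\<lambda>F. \<phi> [F, X, Y])" "heis_lin_form (\<lambda>F. \<phi> [X, F, Y])"
      "heis_lin_form (\<lambda>F. \<phi> [X, Y, F])"
proof -
  have *: "heis_lin_form (\<lambda>F. \<phi> (xs[i := F]))" if "i < 3" "length xs = 3" "set xs \<subseteq> heis_carrier"
      for i xs
    using assms that by (simp add: multilin_form_def)
  from *[of 0 "[X, X, Y]"] *[of 1 "[X, X, Y]"] *[of 2 "[X, Y, Y]"] assms(2,3)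
  show "heis_lin_form (\<lambda>F. \<phi> [F, X, Y])" "heis_lin_form (\<lambda>F. \<phi> [X, F, Y])"
      "heis_lin_form (\<lambda>F. \<phi> [X, Y, F])" by simp_all
qed

lemma heis_carrier_zero: "0 \<in> heis_carrier"
  by (simp add: heis_carrier_iff)

lemma heis_lin_form_zero: "heis_lin_form h \<Longrightarrow> h 0 = 0"
proof -
  assume "heis_lin_form h"
  then have "h (heis_scale 0 0) = 0 * h 0" using heis_carrier_zero by (simp add: heis_lin_form_def)
  moreover have "heis_scale 0 0 = 0" by (simp add: heis_scale_def fun_eq_iff)
  ultimately show "h 0 = 0" by simp
qed

lemma heis_lin_form_sum_list:
  assumes "heis_lin_form h" "\<And>i. i \<in> set I \<Longrightarrow> F i \<in> heis_carrier"
  shows "h (\<Sum>i\<leftarrow>I. F i) = (\<Sum>i\<leftarrow>I. h (F i))"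
proof -
  have "(\<Sum>i\<leftarrow>I. F i) \<in> heis_carrier \<and> h (\<Sum>i\<leftarrow>I. F i) = (\<Sum>i\<leftarrow>I. h (F i))"
    using assms(2)
    by (induction I) (use assms(1) in \<open>auto simp: heis_lin_form_zero heis_carrier_zero
      heis_carrier_plus heis_lin_form_def\<close>)
  then show ?thesis by simp
qed

lemma dual_expansion: "lin_form f \<Longrightarrow> f = (\<lambda>x. \<Sum>b\<in>Basis. f b * dual_basis b x)"
  by (rule ext, drule lin_form_expansion) (simp only: mult.commute)

lemma dual_lin_form_sum:
  assumes "dual_lin_form \<beta>" "\<And>i. lin_form (f i)"
  shows "\<beta> (\<lambda>x. \<Sum>i\<in>I. c i * f i x) = (\<Sum>i\<in>I. c i * \<beta> (f i))"
proof -
  have "lin_form (\<lambda>x. \<Sum>i\<in>I. c i * f i x) \<and> \<beta> (\<lambda>x. \<Sum>i\<in>I. c i * f i x) = (\<Sum>i\<in>I. c i * \<beta> (f i))"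
  proof (induction I rule: infinite_finite_induct)
    case (insert i I)
    have "lin_form (\<lambda>x. c i * f i x)" using assms(2)[of i] by (simp add: lin_form_def algebra_simps)
    then show ?case using insert assms by (auto simp: dual_lin_form_def lin_form_def algebra_simps)
  next
    case empty
    \<comment> \<open>The zero form is written as a multiple of a linear form, so that homogeneity
      gives the value 0.\<close>
    have "\<beta> (\<lambda>x. 0 * dual_basis 0 x) = 0 * \<beta> (dual_basis 0)"
      using assms(1) lin_form_dual_basis unfolding dual_lin_form_def by blast
    then show ?case by (simp add: lin_form_def)
  next
    case (infinite I)
    have "\<beta> (\<lambda>x. 0 * dual_basis 0 x) = 0 * \<beta> (dual_basis 0)"
      using assms(1) lin_form_dual_basis unfolding dual_lin_form_def by blast
    then show ?case using infinite by (simp add: lin_form_def)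
  qed
  then show ?thesis by simp
qed

lemma dual_lin_form_expansion: "dual_lin_form \<beta> \<Longrightarrow> lin_form f \<Longrightarrow> \<beta> f =
    (\<Sum>b\<in>Basis. f b * \<beta> (dual_basis b))"
  using arg_cong[OF dual_expansion, of f \<beta>] dual_lin_form_sum[of \<beta> dual_basis f Basis]
    lin_form_dual_basis by metis

text \<open>The canonical element \<Sum> e_b \<otimes> e^b corresponds to the identity map, so a
  linear map acting on one factor may be moved to the other as its transpose.\<close>

lemma dual_bases_transpose:
  assumes lin: "\<And>f. lin_form f \<Longrightarrow> lin_form (\<lambda>x. \<beta> x f)" "\<And>x. dual_lin_form (\<beta> x)" and g:
    "g \<in> heis_carrier"
  shows "(\<Sum>b\<in>Basis. \<beta> b (\<lambda>x. dual_basis b (g x))) = (\<Sum>b\<in>Basis. \<beta> (g b) (dual_basis b))"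
proof -
  have "lin_form (\<lambda>x. dual_basis b (g x))" for b
    using g by (simp add: lin_form_def heis_carrier_iff dual_basis_add dual_basis_scale)
  then have "(\<Sum>b\<in>Basis. \<beta> b (\<lambda>x. dual_basis b (g x))) =
      (\<Sum>b\<in>Basis. \<Sum>c\<in>Basis. dual_basis b (g c) * \<beta> b (dual_basis c))"
    by (simp add: dual_lin_form_expansion[OF lin(2)])
  also have "\<dots> = (\<Sum>c\<in>Basis. \<Sum>b\<in>Basis. dual_basis b (g c) * \<beta> b (dual_basis c))"
    by (rule sum.swap)
  also have "\<dots> = (\<Sum>c\<in>Basis. \<beta> (g c) (dual_basis c))"
    by (simp add: lin_form_expansion[OF lin(1)[OF lin_form_dual_basis], symmetric])
  finally show ?thesis .
qed

text \<open>The product of the dual is the transpose of \<Delta>, so comultiplying the first factor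
  of the canonical element gives \<Sum> e_b \<otimes> e_c \<otimes> e^b e^c.\<close>

lemma dual_bases_comult:
  assumes "\<And>f. lin_form f \<Longrightarrow> bilin_form (\<lambda>p q. \<chi> p q f)" "\<And>p q. dual_lin_form (\<chi> p q)"
  shows "(\<Sum>a\<in>Basis. comul_sum (\<lambda>p q. \<chi> p q (dual_basis a)) a) =
    (\<Sum>b\<in>Basis. \<Sum>c\<in>Basis. \<chi> b c (dual_mult (dual_basis b) (dual_basis c)))"
proof -
  have dm: "dual_mult f g = comul_sum (\<lambda>p q. f p * g q)" for f g
    by (simp add: dual_mult_def comul_sum_def fun_eq_iff)
  have bilin_form: "\<chi> p q f = (\<Sum>b\<in>Basis. \<Sum>c\<in>Basis. dual_basis b p * (dual_basis c q * \<chi> b c f))" if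
      "lin_form f" for p q f
  proof -
    have 1: "\<chi> p q f = (\<Sum>b\<in>Basis. dual_basis b p * \<chi> b q f)"
      using assms(1)[OF that] by (intro lin_form_expansion) (simp add: bilin_form_def)
    have 2: "\<chi> b q f = (\<Sum>c\<in>Basis. dual_basis c q * \<chi> b c f)" for b
      using assms(1)[OF that] by (intro lin_form_expansion) (simp add: bilin_form_def)
    note 1
    also have "(\<Sum>b\<in>Basis. dual_basis b p * \<chi> b q f) =
        (\<Sum>b\<in>Basis. dual_basis b p * (\<Sum>c\<in>Basis. dual_basis c q * \<chi> b c f))"
      by (intro sum.cong refl arg_cong2[of _ _ _ _ "(*)"] 2)
    finally show ?thesis by (simp add: sum_distrib_left)
  qed
  have "(\<Sum>b\<in>Basis. \<Sum>c\<in>Basis. \<chi> b c (dual_mult (dual_basis b) (dual_basis c))) =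
    (\<Sum>b\<in>Basis. \<Sum>c\<in>Basis. \<Sum>a\<in>Basis. comul_sum (\<lambda>p q. dual_basis b p * dual_basis c q) a * \<chi> b c
      (dual_basis a))"
  proof (intro sum.cong refl)
    fix b c
    have "bilin_form (\<lambda>p q. dual_basis b p * dual_basis c q)"
      by (simp add: lin_simps dual_basis_add dual_basis_scale algebra_simps)
    then show "\<chi> b c (dual_mult (dual_basis b) (dual_basis c)) =
        (\<Sum>a\<in>Basis. comul_sum (\<lambda>p q. dual_basis b p * dual_basis c q) a * \<chi> b c (dual_basis a))"
      unfolding dm by (rule dual_lin_form_expansion[OF assms(2) lin_form_comul_sum])
  qed
  also have "\<dots> = (\<Sum>b\<in>Basis. \<Sum>a\<in>Basis. \<Sum>c\<in>Basis. comul_sum (\<lambda>p q. dual_basis b p * dual_basis c q) a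
      * \<chi> b c (dual_basis a))"
    by (intro sum.cong refl sum.swap)
  also have "\<dots> = (\<Sum>a\<in>Basis. \<Sum>b\<in>Basis. \<Sum>c\<in>Basis. comul_sum (\<lambda>p q. dual_basis b p * dual_basis c q) a
      * \<chi> b c (dual_basis a))"
    by (rule sum.swap)
  also have "\<dots> = (\<Sum>a\<in>Basis. comul_sum (\<lambda>p q. \<Sum>b\<in>Basis. \<Sum>c\<in>Basis.
      dual_basis b p * (dual_basis c q * \<chi> b c (dual_basis a))) a)"
    by (simp add: comul_sum_sum comul_sum_multc[symmetric] mult.assoc)
  also have "\<dots> = (\<Sum>a\<in>Basis. comul_sum (\<lambda>p q. \<chi> p q (dual_basis a)) a)"
    by (simp only: bilin_form[OF lin_form_dual_basis, symmetric])
  finally show ?thesis by simp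
qed

text \<open>The part of a label that depends on the strand and not on the crossing. It is separated
  from the sign, and its dual version takes an arbitrary form, so that it can be applied to a whole
  product of labels.\<close>

definition under_factor :: "bool \<Rightarrow> orient \<Rightarrow> 'a \<Rightarrow> 'a" where
  "under_factor th u = under_label th Pos u"
definition over_factor :: "bool \<Rightarrow> orient \<Rightarrow> ('a \<Rightarrow> 'k) \<Rightarrow> 'a \<Rightarrow> 'k" where
  "over_factor th u f = (if u = Up then dual_inv_antipode else id)
    ((if th then dual_inv_antipode else id) f)"

lemma over_label_over_factor: "over_label th u e = over_factor th u (dual_basis e)"
  by (simp add: over_label_def over_factor_def)

definition sign_map :: "sign \<Rightarrow> 'a \<Rightarrow> 'a" where "sign_map s = (if s = Neg then antipode else id)"

lemma under_label_under_factor: "under_label th s u e = under_factor th u (sign_map s e)"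
  by (simp add: under_label_def under_factor_def sign_map_def)

lemma under_factor_carrier: "under_factor th u \<in> heis_carrier"
  by (simp add: under_factor_def under_label_def heis_carrier_iff antipode_add antipode_scale)

lemma under_factor_one: "under_factor th u 1 = 1"
  by (simp add: under_factor_def under_label_def antipode_one)

definition word_product :: "bool \<Rightarrow> (point \<Rightarrow> 'a) \<Rightarrow> passage list \<Rightarrow> 'a \<Rightarrow> 'a" where
  "word_product th a ps = foldr (colored_mult th) (concat (map (passage_labels th a) ps)) heis_one"

end

context bijective_antipode
begin

lemma lin_form_over_factor: "lin_form f \<Longrightarrow> lin_form (over_factor th u f)"
  by (simp add: over_factor_def dual_inv_antipode_def lin_form_def antipode_inv_add
    antipode_inv_scale)

lemma over_factor_add: "over_factor th u (\<lambda>x. f x + g x) =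
    (\<lambda>x. over_factor th u f x + over_factor th u g x)"
  and over_factor_scale: "over_factor th u (\<lambda>x. c * f x) = (\<lambda>x. c * over_factor th u f x)"
  by (simp_all add: over_factor_def dual_inv_antipode_def fun_eq_iff)

lemma over_factor_counit: "over_factor th u counit = counit"
  by (simp add: over_factor_def dual_inv_antipode_def fun_eq_iff counit_antipode_inv)

lemma alg_incl_add: "alg_incl (x + y) = alg_incl x + alg_incl y" and alg_incl_scale:
    "alg_incl (c *s x) = heis_scale c (alg_incl x)"
  by (simp_all add: alg_incl_def tens_def heis_scale_def fun_eq_iff scale_right_distrib
    mult.commute)
lemma dual_incl_add: "dual_incl (\<lambda>x. f x + g x) = dual_incl f + dual_incl g" and dual_incl_scale:
    "dual_incl (\<lambda>x. c * f x) = heis_scale c (dual_incl f)"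
  by (simp_all add: dual_incl_def tens_def heis_scale_def fun_eq_iff scale_left_distrib)

lemma heis_lin_form_alg_incl: "heis_lin_form h \<Longrightarrow> lin_form (\<lambda>x. h (alg_incl x))"
  by (simp add: heis_lin_form_def lin_form_def alg_incl_add alg_incl_scale alg_incl_carrier)
lemma heis_lin_form_dual_incl: "heis_lin_form h \<Longrightarrow> dual_lin_form (\<lambda>f. h (dual_incl f))"
  by (simp add: heis_lin_form_def dual_lin_form_def dual_incl_add dual_incl_scale dual_incl_carrier)
lemma heis_lin_form_alg_incl_under_factor: "heis_lin_form h \<Longrightarrow> lin_form
    (\<lambda>x. h (alg_incl (under_factor th u x)))"
  using heis_lin_form_alg_incl[of h] under_factor_carrier[of th u] by
    (simp add: lin_form_def heis_carrier_iff)
lemma dual_lin_form_over_factor: "dual_lin_form \<beta> \<Longrightarrow> dual_lin_form (\<lambda>f. \<beta> (over_factor th u f))"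
  by (simp add: dual_lin_form_def over_factor_add over_factor_scale lin_form_over_factor)
lemma heis_lin_form_mult_left: "heis_lin_form h \<Longrightarrow> G \<in> heis_carrier \<Longrightarrow> heis_lin_form
    (\<lambda>F. h (heis_mult F G))"
  by (simp add: heis_lin_form_def heis_mult_add_left heis_mult_scale_left heis_mult_carrier)
lemma heis_lin_form_mult_right: "heis_lin_form h \<Longrightarrow> F \<in> heis_carrier \<Longrightarrow> heis_lin_form
    (\<lambda>G. h (heis_mult F G))"
  by (simp add: heis_lin_form_def heis_mult_add_right heis_mult_scale_right heis_mult_carrier)

lemma heis_lin_form_alg_incl_dual_incl:
  assumes "heis_lin_form h" "lin_form g"
  shows "h (heis_mult (alg_incl a) (dual_incl g)) = comul_sum
      (\<lambda>p q. h (heis_mult (dual_incl (\<lambda>x. g (x * p))) (alg_incl q))) a"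
proof -
  have "lin_form (\<lambda>x. g (x * p))" for p using assms by (simp add: lin_simps)
  then show ?thesis unfolding alg_incl_dual_incl[OF assms(2)] comul_sum_def
    by (subst heis_lin_form_sum_list[OF assms(1)]) (auto simp: heis_mult_carrier dual_incl_carrier
      alg_incl_carrier case_prod_unfold)
qed

text \<open>In S23 S12 the product a e^b on strand 2 is reordered to \<Sum> e^b(? a') a''. Right
  multiplication by a' is then transposed onto the factor b of strand 1, and finally \<Delta>(a) is
  traded for a product of forms on strand 3, which yields S12 S13 S23.\<close>

lemma pentagon:
  assumes \<phi>: "multilin_form 3 \<phi>"
  shows "(\<Sum>c\<in>Basis. \<Sum>d\<in>Basis. \<Sum>f\<in>Basis.
      \<phi> [alg_incl (under_factor t1 u1 (c * d)), heis_mult (dual_incl (dual_basis c)) (alg_incl f),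
         dual_incl (over_factor t3 u3 (dual_mult (dual_basis d) (dual_basis f)))]) =
    (\<Sum>a\<in>Basis. \<Sum>b\<in>Basis.
      \<phi> [alg_incl (under_factor t1 u1 b), heis_mult (alg_incl a) (dual_incl (dual_basis b)),
        dual_incl (over_factor t3 u3 (dual_basis a))])"
    (is "?L = ?R")
proof -
  define \<psi> where "\<psi> x f y g = \<phi> [alg_incl (under_factor t1 u1 x), heis_mult (dual_incl f)
    (alg_incl y), dual_incl (over_factor t3 u3 g)]" for x f y g
  note car = alg_incl_carrier dual_incl_carrier heis_mult_carrier lin_form_over_factor
  have \<psi>1: "lin_form (\<lambda>x. \<psi> x f y g)" if "lin_form f" "lin_form g" for f y g
    unfolding \<psi>_def by (intro heis_lin_form_alg_incl_under_factor multilin_form_3[OF \<phi>] car that)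
  have \<psi>2: "dual_lin_form (\<lambda>f. \<psi> x f y g)" if "lin_form g" for x y g
    unfolding \<psi>_def using heis_lin_form_dual_incl[OF heis_lin_form_mult_left[OF
      multilin_form_3(2)[OF \<phi>]]] that by (simp add: car)
  have \<psi>3: "lin_form (\<lambda>y. \<psi> x f y g)" if "lin_form f" "lin_form g" for x f g
    unfolding \<psi>_def using heis_lin_form_alg_incl[OF heis_lin_form_mult_right[OF
      multilin_form_3(2)[OF \<phi>]]] that by (simp add: car)
  have \<psi>4: "dual_lin_form (\<lambda>g. \<psi> x f y g)" if "lin_form f" for x f y
    unfolding \<psi>_def using dual_lin_form_over_factor[OF heis_lin_form_dual_incl[OF
      multilin_form_3(3)[OF \<phi>]]] that by (simp add: car)
  note db = lin_form_dual_basis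
  have "?R = (\<Sum>a\<in>Basis. \<Sum>b\<in>Basis. comul_sum (\<lambda>p q. \<psi> b (\<lambda>x. dual_basis b (x * p)) q (dual_basis a))
      a)"
    unfolding \<psi>_def by (intro sum.cong refl heis_lin_form_alg_incl_dual_incl multilin_form_3[OF \<phi>]
      car db)
  also have "\<dots> = (\<Sum>a\<in>Basis. comul_sum (\<lambda>p q. \<Sum>b\<in>Basis. \<psi> (b * p) (dual_basis b) q (dual_basis a))
      a)"
  proof -
    have "(\<Sum>b\<in>Basis. \<psi> b (\<lambda>x. dual_basis b (x * p)) q (dual_basis a)) =
        (\<Sum>b\<in>Basis. \<psi> (b * p) (dual_basis b) q (dual_basis a))" for p q a
      by (rule dual_bases_transpose)
        (simp_all add: \<psi>1 \<psi>2 db heis_carrier_iff distrib_right scale_mult_left)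
    then show ?thesis by (simp add: comul_sum_sum[symmetric])
  qed
  also have "\<dots> = (\<Sum>c\<in>Basis. \<Sum>a\<in>Basis. comul_sum (\<lambda>p q. \<psi> (c * p) (dual_basis c) q (dual_basis a))
      a)"
    unfolding comul_sum_sum by (rule sum.swap)
  also have "\<dots> = (\<Sum>c\<in>Basis. \<Sum>d\<in>Basis. \<Sum>f\<in>Basis. \<psi> (c * d) (dual_basis c) f
      (dual_mult (dual_basis d) (dual_basis f)))"
  proof (rule sum.cong[OF refl], rule dual_bases_comult)
    fix c f assume f: "lin_form f"
    show "bilin_form (\<lambda>p q. \<psi> (c * p) (dual_basis c) q f)"
      using \<psi>1[OF db[of c] f] \<psi>3[OF db[of c] f] by (simp add: lin_simps)
  qed (rule \<psi>4[OF db])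
  finally show ?thesis by (simp add: \<psi>_def)
qed

text \<open>The same computation with \<gamma>(a) in place of a on strand 2. The antipode flips
  \<Delta>(a), and the inverse antipode in the form turns right multiplication by \<gamma>(a'') into
  left multiplication by a''; hence the products on strands 1 and 3 appear in the opposite
  order.\<close>

lemma pentagon_opposite:
  assumes \<phi>: "multilin_form 3 \<phi>"
  shows "(\<Sum>c\<in>Basis. \<Sum>d\<in>Basis. \<Sum>f\<in>Basis.
      \<phi> [alg_incl (under_factor t1 u1 (d * c)), heis_mult (dual_incl (dual_basis c \<circ> antipode_inv))
        (alg_incl (antipode f)),
         dual_incl (over_factor t3 u3 (dual_mult (dual_basis f) (dual_basis d)))]) =
    (\<Sum>a\<in>Basis. \<Sum>b\<in>Basis.
      \<phi> [alg_incl (under_factor t1 u1 b), heis_mult (alg_incl (antipode a))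
        (dual_incl (dual_basis b \<circ> antipode_inv)), dual_incl (over_factor t3 u3 (dual_basis a))])"
    (is "?L = ?R")
proof -
  define \<psi> where "\<psi> x f y g = \<phi> [alg_incl (under_factor t1 u1 x), heis_mult
    (dual_incl (f \<circ> antipode_inv)) (alg_incl (antipode y)), dual_incl (over_factor t3 u3 g)]" for x
    f y g
  note car = alg_incl_carrier dual_incl_carrier heis_mult_carrier lin_form_over_factor
  have lfi: "lin_form (f \<circ> antipode_inv)" if "lin_form f" for f
    using that by (simp add: lin_form_def antipode_inv_add antipode_inv_scale)
  have \<psi>1: "lin_form (\<lambda>x. \<psi> x f y g)" if "lin_form f" "lin_form g" for f y g
    unfolding \<psi>_def by (intro heis_lin_form_alg_incl_under_factor multilin_form_3[OF \<phi>] car that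
      lfi)
  have \<psi>2: "dual_lin_form (\<lambda>f. \<psi> x f y g)" if "lin_form g" for x y g
  proof -
    have "dual_lin_form (\<lambda>f. \<phi> [alg_incl (under_factor t1 u1 x), heis_mult (dual_incl f)
        (alg_incl (antipode y)), dual_incl (over_factor t3 u3 g)])"
      using heis_lin_form_dual_incl[OF heis_lin_form_mult_left[OF multilin_form_3(2)[OF \<phi>]]] that by
        (simp add: car)
    then show ?thesis by (simp add: dual_lin_form_def \<psi>_def lfi[unfolded comp_def] comp_def)
  qed
  have \<psi>3: "lin_form (\<lambda>y. \<psi> x f y g)" if "lin_form f" "lin_form g" for x f g
  proof -
    have "lin_form (\<lambda>y. \<phi> [alg_incl (under_factor t1 u1 x), heis_mult (dual_incl (f \<circ> antipode_inv))
        (alg_incl y), dual_incl (over_factor t3 u3 g)])"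
      using heis_lin_form_alg_incl[OF heis_lin_form_mult_right[OF multilin_form_3(2)[OF \<phi>]]] that by
        (simp add: car lfi)
    then show ?thesis by (simp add: lin_form_def \<psi>_def antipode_add antipode_scale)
  qed
  have \<psi>4: "dual_lin_form (\<lambda>g. \<psi> x f y g)" if "lin_form f" for x f y
    unfolding \<psi>_def using dual_lin_form_over_factor[OF heis_lin_form_dual_incl[OF
      multilin_form_3(3)[OF \<phi>]]] that by (simp add: car lfi)
  note db = lin_form_dual_basis
  have left: "lin_form (\<lambda>x. dual_basis b (q * x))" for b q
    using db[of b] by (simp add: lin_simps)
  have "?R = (\<Sum>a\<in>Basis. \<Sum>b\<in>Basis. comul_sum (\<lambda>p q. \<psi> b (\<lambda>x. dual_basis b (q * x)) p (dual_basis a))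
      a)"
  proof (intro sum.cong refl)
    fix a b
    let ?h = "\<lambda>F. \<phi> [alg_incl (under_factor t1 u1 b), F, dual_incl
      (over_factor t3 u3 (dual_basis a))]"
    have h: "heis_lin_form ?h" by (intro multilin_form_3[OF \<phi>] car db)
    \<comment> \<open>Needed to rewrite \<Delta>(\<gamma>(a)) by \<open>comul_sum_antipode\<close>.
      Linearity in \<open>p\<close>, which sits inside a form, comes from the linear dependence of
      the whole value on that form.\<close>
    have "bilin_form (\<lambda>p q. ?h (heis_mult (dual_incl (\<lambda>x. dual_basis b (antipode_inv (x * p))))
        (alg_incl q)))"
    proof (rule bilin_formI)
      show "lin_form (\<lambda>q. ?h (heis_mult (dual_incl (\<lambda>x. dual_basis b (antipode_inv (x * p))))
          (alg_incl q)))" for p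
        by (intro heis_lin_form_alg_incl heis_lin_form_mult_right h car)
          (use db[of b] in \<open>simp add: lin_simps antipode_inv_add antipode_inv_scale\<close>)
      have d: "dual_lin_form (\<lambda>f. ?h (heis_mult (dual_incl f) (alg_incl q)))" for q
        by (intro heis_lin_form_dual_incl heis_lin_form_mult_left h car)
      have "lin_form (\<lambda>x. dual_basis b (antipode_inv (x * p)))" for p
        using db[of b] by (simp add: lin_simps antipode_inv_add antipode_inv_scale)
      then show "lin_form (\<lambda>p. ?h (heis_mult (dual_incl (\<lambda>x. dual_basis b (antipode_inv (x * p))))
        (alg_incl q)))" for q
        using d[of q] by (simp add: dual_lin_form_def lin_form_def distrib_left scale_mult_right
          antipode_inv_add antipode_inv_scale
            dual_basis_add dual_basis_scale)
    qed
    note comul_sum_antipode[OF this, of a]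
    moreover have "?h (heis_mult (alg_incl (antipode a)) (dual_incl (dual_basis b \<circ> antipode_inv)))
      =
        comul_sum (\<lambda>p q. ?h (heis_mult (dual_incl (\<lambda>x. (dual_basis b \<circ> antipode_inv) (x * p)))
          (alg_incl q))) (antipode a)"
      by (rule heis_lin_form_alg_incl_dual_incl[OF h lfi[OF db]])
    ultimately show "?h (heis_mult (alg_incl (antipode a))
      (dual_incl (dual_basis b \<circ> antipode_inv))) =
      comul_sum (\<lambda>p q. \<psi> b (\<lambda>x. dual_basis b (q * x)) p (dual_basis a)) a"
      by (simp add: \<psi>_def antipode_inv_mult antipode_inv_antipode comp_def)
  qed
  also have "\<dots> = (\<Sum>a\<in>Basis. comul_sum (\<lambda>p q. \<Sum>b\<in>Basis. \<psi> (q * b) (dual_basis b) p (dual_basis a))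
      a)"
  proof -
    have "(\<Sum>b\<in>Basis. \<psi> b (\<lambda>x. dual_basis b (q * x)) p (dual_basis a)) =
        (\<Sum>b\<in>Basis. \<psi> (q * b) (dual_basis b) p (dual_basis a))" for p q a
      by (rule dual_bases_transpose)
        (simp_all add: \<psi>1 \<psi>2 db heis_carrier_iff distrib_left scale_mult_right)
    then show ?thesis by (simp add: comul_sum_sum[symmetric])
  qed
  also have "\<dots> = (\<Sum>c\<in>Basis. \<Sum>a\<in>Basis. comul_sum (\<lambda>p q. \<psi> (q * c) (dual_basis c) p (dual_basis a))
      a)"
    unfolding comul_sum_sum by (rule sum.swap)
  also have "\<dots> = (\<Sum>c\<in>Basis. \<Sum>f\<in>Basis. \<Sum>d\<in>Basis. \<psi> (d * c) (dual_basis c) f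
      (dual_mult (dual_basis f) (dual_basis d)))"
  proof (rule sum.cong[OF refl], rule dual_bases_comult)
    fix c f assume f: "lin_form f"
    show "bilin_form (\<lambda>p q. \<psi> (q * c) (dual_basis c) p f)"
      using \<psi>1[OF db[of c] f] \<psi>3[OF db[of c] f] by (simp add: lin_simps)
  qed (rule \<psi>4[OF db])
  also have "\<dots> = (\<Sum>c\<in>Basis. \<Sum>d\<in>Basis. \<Sum>f\<in>Basis. \<psi> (d * c) (dual_basis c) f
      (dual_mult (dual_basis f) (dual_basis d)))"
    by (intro sum.cong refl sum.swap)
  finally show ?thesis by (simp add: \<psi>_def)
qed

text \<open>By \<open>dual_bases_comult\<close> the double sums are \<Sum> \<gamma>(a')a'' \<otimes>
  e^a and \<Sum> a'\<gamma>(a'') \<otimes> e^a, and the antipode axioms leave \<Sum> \<epsilon>(a) 1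
  \<otimes> e^a.\<close>

lemma canonical_element_inverse:
  assumes \<phi>: "multilin_form 2 \<phi>" 
  shows "(\<Sum>c\<in>Basis. \<Sum>d\<in>Basis. \<phi> [alg_incl (under_factor t u (antipode c * d)),
      dual_incl (over_factor t' u' (dual_mult (dual_basis c) (dual_basis d)))]) = \<phi>
        [heis_one, heis_one]"
    and "(\<Sum>c\<in>Basis. \<Sum>d\<in>Basis. \<phi> [alg_incl (under_factor t u (c * antipode d)),
      dual_incl (over_factor t' u' (dual_mult (dual_basis c) (dual_basis d)))]) = \<phi>
        [heis_one, heis_one]"
proof -
  define \<beta> where "\<beta> x f = \<phi> [alg_incl (under_factor t u x), dual_incl (over_factor t' u' f)]" for x
    f
  note car = alg_incl_carrier dual_incl_carrier lin_form_over_factor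
  have \<beta>1: "lin_form (\<lambda>x. \<beta> x f)" if "lin_form f" for f
    unfolding \<beta>_def by (intro heis_lin_form_alg_incl_under_factor multilin_form_2[OF \<phi>] car that)
  have \<beta>2: "dual_lin_form (\<beta> x)" for x
    unfolding \<beta>_def by (intro dual_lin_form_over_factor[of "\<lambda>f. \<phi> [_, dual_incl f]"]
      heis_lin_form_dual_incl multilin_form_2[OF \<phi>] car)
  note db = lin_form_dual_basis
  \<comment> \<open>Here \<Sum> \<epsilon>(a) e^a is the expansion of the counit, the unit of the
    dual; all strand factors fix 1 and the counit.\<close>
  have one: "(\<Sum>a\<in>Basis. counit a * \<beta> 1 (dual_basis a)) = \<phi> [heis_one, heis_one]"
    using dual_lin_form_expansion[OF \<beta>2 lin_form_counit, of 1] by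
      (simp add: \<beta>_def under_factor_one over_factor_counit alg_incl_one dual_incl_counit)
  have "(\<Sum>c\<in>Basis. \<Sum>d\<in>Basis. \<beta> (antipode c * d) (dual_mult (dual_basis c) (dual_basis d))) =
      (\<Sum>a\<in>Basis. comul_sum (\<lambda>p q. \<beta> (antipode p * q) (dual_basis a)) a)"
    by (rule dual_bases_comult[symmetric]) (use \<beta>1 \<beta>2 in \<open>simp_all add: lin_simps\<close>)
  then show "(\<Sum>c\<in>Basis. \<Sum>d\<in>Basis. \<phi> [alg_incl (under_factor t u (antipode c * d)),
      dual_incl (over_factor t' u' (dual_mult (dual_basis c) (dual_basis d)))]) = \<phi>
        [heis_one, heis_one]"
    by (simp add: comul_sum_antipode_left[OF \<beta>1[OF db]] one flip: \<beta>_def)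
  have "(\<Sum>c\<in>Basis. \<Sum>d\<in>Basis. \<beta> (c * antipode d) (dual_mult (dual_basis c) (dual_basis d))) =
      (\<Sum>a\<in>Basis. comul_sum (\<lambda>p q. \<beta> (p * antipode q) (dual_basis a)) a)"
    by (rule dual_bases_comult[symmetric]) (use \<beta>1 \<beta>2 in \<open>simp_all add: lin_simps\<close>)
  then show "(\<Sum>c\<in>Basis. \<Sum>d\<in>Basis. \<phi> [alg_incl (under_factor t u (c * antipode d)),
      dual_incl (over_factor t' u' (dual_mult (dual_basis c) (dual_basis d)))]) = \<phi>
        [heis_one, heis_one]"
    by (simp add: comul_sum_antipode_right[OF \<beta>1[OF db]] one flip: \<beta>_def)
qed

text \<open>Used with the antipode for \<open>g\<close>, in the slides whose transversal passes
  under.\<close>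

lemma canonical_element_transpose:
  assumes \<phi>: "multilin_form 2 \<phi>" and g: "g \<in> heis_carrier"
  shows "(\<Sum>b\<in>Basis. \<phi> [alg_incl (under_factor t u b), dual_incl
      (over_factor t' u' (\<lambda>x. dual_basis b (g x)))]) =
    (\<Sum>b\<in>Basis. \<phi> [alg_incl (under_factor t u (g b)), dual_incl (over_factor t' u' (dual_basis b))])"
proof -
  define \<beta> where "\<beta> x f = \<phi> [alg_incl (under_factor t u x), dual_incl (over_factor t' u' f)]" for x
    f
  note car = alg_incl_carrier dual_incl_carrier lin_form_over_factor
  have \<beta>1: "lin_form (\<lambda>x. \<beta> x f)" if "lin_form f" for f
    unfolding \<beta>_def by (intro heis_lin_form_alg_incl_under_factor multilin_form_2[OF \<phi>] car that)
  have \<beta>2: "dual_lin_form (\<beta> x)" for x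
    unfolding \<beta>_def by (intro dual_lin_form_over_factor[of "\<lambda>f. \<phi> [_, dual_incl f]"]
      heis_lin_form_dual_incl multilin_form_2[OF \<phi>] car)
  show ?thesis
    using dual_bases_transpose[OF \<beta>1 \<beta>2 g] by (simp add: \<beta>_def)
qed

section \<open>Products of labels along a strand\<close>

lemma over_label_lin_form: "lin_form (over_label th u e)"
  by (simp add: over_label_over_factor lin_form_over_factor lin_form_dual_basis)

lemma passage_labels_carrier: "set (passage_labels th a p) \<subseteq> heis_carrier"
  by (cases p) (simp_all add: tens_carrier lin_form_counit over_label_lin_form)

lemma colored_mult_carrier:
  "F \<in> heis_carrier \<Longrightarrow> G \<in> heis_carrier \<Longrightarrow> colored_mult th F G \<in> heis_carrier"
  by (simp add: colored_mult_def heis_mult_carrier)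

lemma colored_mult_assoc:
  "F \<in> heis_carrier \<Longrightarrow> G \<in> heis_carrier \<Longrightarrow> K \<in> heis_carrier \<Longrightarrow>
    colored_mult th (colored_mult th F G) K = colored_mult th F (colored_mult th G K)"
  by (simp add: colored_mult_def heis_mult_assoc)

lemma colored_mult_one:
  "F \<in> heis_carrier \<Longrightarrow> colored_mult th heis_one F = F"
  "F \<in> heis_carrier \<Longrightarrow> colored_mult th F heis_one = F"
  by (simp_all add: colored_mult_def heis_mult_one)

lemma word_product_Nil: "word_product th a [] = heis_one"
  by (simp add: word_product_def)

lemma foldr_colored_mult_carrier:
  "set xs \<subseteq> heis_carrier \<Longrightarrow> foldr (colored_mult th) xs heis_one \<in> heis_carrier"
  by (induction xs) (simp_all add: heis_one_carrier colored_mult_carrier)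

lemma foldr_colored_mult_append:
  "set xs \<subseteq> heis_carrier \<Longrightarrow> set ys \<subseteq> heis_carrier \<Longrightarrow>
    foldr (colored_mult th) (xs @ ys) heis_one =
      colored_mult th (foldr (colored_mult th) xs heis_one) (foldr (colored_mult th) ys heis_one)"
  by (induction xs) (simp_all add: colored_mult_one foldr_colored_mult_carrier colored_mult_assoc)

lemma word_labels_carrier: "set (concat (map (passage_labels th a) ps)) \<subseteq> heis_carrier"
  using passage_labels_carrier by fastforce

lemma word_product_carrier: "word_product th a ps \<in> heis_carrier"
  unfolding word_product_def by (rule foldr_colored_mult_carrier[OF word_labels_carrier])

lemma word_product_append:
  "word_product th a (ps @ qs) = colored_mult th (word_product th a ps) (word_product th a qs)"
  by (simp only: word_product_def map_append concat_append foldr_colored_mult_append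
    word_labels_carrier)

lemma word_product_pair: "word_product th a [p, q] = colored_mult th (word_product th a [p])
    (word_product th a [q])"
  using word_product_append[of th a "[p]" "[q]"] by simp

lemma word_product_Plain: "word_product th a (Plain # ps) = word_product th a ps"
  by (simp add: word_product_def)

lemma word_product_Under: "word_product th a [Under q s u] = alg_incl
    (under_factor th u (sign_map s (a q)))"
  by (simp add: word_product_def under_label_under_factor colored_mult_one tens_carrier
    lin_form_counit alg_incl_def)

lemma word_product_Over: "word_product th a [Over q s u] = dual_incl
    (over_factor th u (dual_basis (a q)))"
  by (simp add: word_product_def over_label_over_factor colored_mult_one tens_carrier
    lin_form_over_factor lin_form_dual_basis dual_incl_def)

text \<open>An upward strand reverses the reading and a thick one the multiplication, and each time
  the extra antipode reverses the product back. So for all four kinds of strand the factor of the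
  second crossing stands on the left.\<close>

lemma word_product_Under_Under:
  "word_product th a (rev_if (u = Down) [Under q1 s1 u, Under q2 s2 u]) =
     alg_incl (under_factor th u (sign_map s2 (a q2) * sign_map s1 (a q1)))"
  by (cases u; cases th)
    (simp_all add: word_product_pair word_product_Under alg_incl_carrier
      colored_mult_def alg_incl_mult under_factor_def under_label_def antipode_mult)

text \<open>The inverse antipode reverses coproducts, hence its transpose reverses products of
  forms.\<close>

lemma dual_mult_antipode_inv:
  assumes "lin_form f" "lin_form g"
  shows "dual_mult (\<lambda>x. f (antipode_inv x)) (\<lambda>x. g (antipode_inv x)) =
      (\<lambda>x. dual_mult g f (antipode_inv x))"
proof
  fix x
  have "bilin_form (\<lambda>p q. g p * f q)" using assms by (simp add: lin_simps algebra_simps)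
  from comul_sum_antipode_inv[OF this, of x]
  show "dual_mult (\<lambda>x. f (antipode_inv x)) (\<lambda>x. g (antipode_inv x)) x = dual_mult g f
      (antipode_inv x)"
    by (simp add: dual_mult_comul_sum mult.commute)
qed

lemma word_product_Over_Over:
  "word_product th a (rev_if (u = Down) [Over q1 s1 u, Over q2 s2 u]) =
     dual_incl (over_factor th u (dual_mult (dual_basis (a q2)) (dual_basis (a q1))))"
proof -
  \<comment> \<open>On a thick upward strand the transposed inverse antipode acts twice, so the rule
    is also needed for forms already composed with it.\<close>
  have [simp]: "lin_form (\<lambda>x. dual_basis b (antipode_inv x))"
      "lin_form (\<lambda>x. dual_basis b (antipode_inv (antipode_inv x)))" for b
    by (simp_all add: lin_form_def antipode_inv_add antipode_inv_scale dual_basis_add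
      dual_basis_scale)
  note [simp] = lin_form_dual_basis
  show ?thesis
  by (cases u; cases th)
    (simp_all add: word_product_pair word_product_Over dual_incl_carrier lin_form_over_factor 
      colored_mult_def dual_incl_mult over_factor_def dual_inv_antipode_def comp_def
        dual_mult_antipode_inv
      dual_mult_antipode_inv[of "\<lambda>x. dual_basis b (antipode_inv x)"
        "\<lambda>x. dual_basis c (antipode_inv x)" for b c])
qed

end

section \<open>Readings of components\<close>

abbreviation chain :: "arc list \<Rightarrow> bool" where
  "chain \<equiv> successively (\<lambda>x y. tail x = head y)"

text \<open>Heads are injective on \<open>X\<close>, so in a chain inside \<open>X\<close> each arc
  determines the next; two chains with the same start can differ only in length.\<close>

lemma chain_prefix:
  assumes "inj_on head X" "chain p" "chain q" "set p \<subseteq> X" "set q \<subseteq> X" "p \<noteq> []" "q \<noteq> []"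
    "hd p = hd q"
  shows "(\<exists>t. q = p @ t) \<or> (\<exists>t. t \<noteq> [] \<and> p = q @ t)"
  using assms
proof (induction p arbitrary: q)
  case (Cons x p)
  then obtain q' where q: "q = x # q'" by (cases q) auto
  show ?case
  proof (cases "p = [] \<or> q' = []")
    case False
    then have *: "chain p" "chain q'" "tail x = head (hd p)" "tail x = head (hd q')"
      using Cons.prems by (auto simp: q successively_Cons)
    have "hd p \<in> X" "hd q' \<in> X" using False Cons.prems by (auto simp: q)
    then have "hd p = hd q'" using * Cons.prems(1) by (auto dest: inj_onD)
    then show ?thesis using Cons.IH[of q'] Cons.prems * False by (auto simp: q)
  qed (auto simp: q)
qed simp

lemma chain_next:
  assumes "chain xs" "x \<in> set xs" "x \<noteq> last xs"
  obtains y where "y \<in> set (tl xs)" "tail x = head y"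
proof -
  obtain a b where ab: "xs = a @ x # b" using assms(2) by (auto dest: split_list)
  then have "b \<noteq> []" using assms(3) by auto
  then have "tail x = head (hd b)" "hd b \<in> set (tl xs)"
    using assms(1) ab by (auto simp: successively_append_iff successively_Cons) (cases a; auto)
  then show thesis by (rule that[rotated])
qed

lemma chain_previous:
  assumes "chain xs" "x \<in> set xs" "x \<noteq> hd xs"
  obtains w where "w \<in> set xs" "tail w = head x"
proof -
  obtain a b where ab: "xs = a @ x # b" using assms(2) by (auto dest: split_list)
  then have "a \<noteq> []" using assms(3) by auto
  then have "tail (last a) = head x" "last a \<in> set xs"
    using assms(1) ab by (auto simp: successively_append_iff)
  then show thesis by (rule that[rotated])
qed

text \<open>If \<open>w\<close> were not the last arc, its successor would have the same head as the
  first arc, hence be the first arc, which would then occur twice.\<close>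

lemma chain_closed:
  assumes "inj_on head (set xs)" "chain xs" "distinct xs" "w \<in> set xs" "tail w = head (hd xs)"
  shows "tail (last xs) = head (hd xs)"
proof (cases "w = last xs")
  case False
  obtain y where y: "y \<in> set (tl xs)" "tail w = head y"
    using chain_next[OF assms(2,4) False] by metis
  have "xs \<noteq> []" using assms(4) by auto
  moreover have "y = hd xs"
    using assms(1,5) y \<open>xs \<noteq> []\<close> by (auto dest!: inj_onD intro: list.set_sel)
  ultimately show ?thesis using y(1) assms(3) by (cases xs) auto
qed (use assms in simp)

lemma chain_rotate:
  "chain (a @ b) \<Longrightarrow> tail (last (a @ b)) = head (hd (a @ b)) \<Longrightarrow> b \<noteq> [] \<Longrightarrow> chain (b @ a)"
  by (cases "a = []") (auto simp: successively_append_iff)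

text \<open>Cut \<open>xs\<close> at the first arc of \<open>ys\<close>. If the part before the cut
  is nonempty, the first arc of \<open>xs\<close> has a predecessor in \<open>ys\<close>, so the
  curve closes up and \<open>xs\<close> may be rotated; then both lists start with the same arc and
  have the same length.\<close>

lemma readings_rotated:
  assumes inj: "inj_on head (set xs)" and xs: "chain xs" "distinct xs" and ys: "chain ys"
    "distinct ys" "ys \<noteq> []"
    and set: "set xs = set ys"
  obtains a b where "xs = a @ b" "ys = b @ a" "a = [] \<or> tail (last xs) = head (hd xs)"
proof -
  have ne: "xs \<noteq> []" using set ys(3) by (cases xs) simp_all
  have "hd ys \<in> set xs" unfolding set using ys(3) by simp
  then obtain a b' where ab: "xs = a @ hd ys # b'" by (auto dest: split_list)
  define b where "b = hd ys # b'"
  have xab: "xs = a @ b" and bne: "b \<noteq> []" and hdb: "hd b = hd ys" by (simp_all add: ab b_def)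
  have closed: "tail (last xs) = head (hd xs)" if "a \<noteq> []"
  proof -
    have "hd ys \<notin> set a" using xs(2) unfolding ab by simp
    moreover have "hd xs \<in> set a" using that by (simp add: xab)
    ultimately have "hd xs \<noteq> hd ys" by metis
    moreover have "hd xs \<in> set ys" using hd_in_set[OF ne] by (simp only: set)
    ultimately obtain w where w: "w \<in> set ys" "tail w = head (hd xs)"
      using chain_previous[OF ys(1)] by metis
    show ?thesis by (rule chain_closed[OF inj xs _ w(2)]) (simp only: set w(1))
  qed
  have ch: "chain (b @ a)"
  proof (cases "a = []")
    case True
    then show ?thesis using xs(1) by (simp add: xab)
  next
    case False
    show ?thesis by (rule chain_rotate[OF xs(1)[unfolded xab] closed[OF False, unfolded xab] bne])
  qed
  have s: "set (b @ a) = set ys" unfolding set[symmetric] xab by auto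
  have d: "distinct (b @ a)" using xs(2) unfolding xab by auto
  have len: "length (b @ a) = length ys"
    using distinct_card[OF d] distinct_card[OF ys(2)] s by simp
  have "(\<exists>t. ys = (b @ a) @ t) \<or> (\<exists>t. t \<noteq> [] \<and> b @ a = ys @ t)"
    by (rule chain_prefix[OF inj ch ys(1)]) (simp_all only: s set subset_refl ys(3)
      append_is_Nil_conv
        bne hd_append2 hdb simp_thms)
  then have "ys = b @ a"
  proof (elim disjE exE conjE)
    fix t assume "ys = (b @ a) @ t"
    with len show ?thesis by simp
  next
    fix t assume "t \<noteq> []" "b @ a = ys @ t"
    from arg_cong[OF this(2), of length] this(1) len show ?thesis by simp
  qed
  then show thesis using that[OF xab] closed by blast
qed

text \<open>As readings run against the orientation, \<open>h\<close> is the point where the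
  oriented strand ends and \<open>t\<close> the point where it begins.\<close>

definition is_path :: "arc list \<Rightarrow> point \<Rightarrow> point \<Rightarrow> nat \<Rightarrow> bool" where
  "is_path p h t c \<longleftrightarrow> p \<noteq> [] \<and> chain p \<and> head (hd p) = h \<and> tail (last p) = t \<and>
     (\<forall>x\<in>set p. component x = c)"

lemma is_path_not_Nil: "is_path p h t c \<Longrightarrow> p \<noteq> []"
  and is_path_component: "is_path p h t c \<Longrightarrow> x \<in> set p \<Longrightarrow> component x = c"
  by (simp_all add: is_path_def)

lemma chain_concat:
  "[] \<notin> set ps \<Longrightarrow> chain (concat ps) \<longleftrightarrow>
    (\<forall>p\<in>set ps. chain p) \<and> successively (\<lambda>p q. tail (last p) = head (hd q)) ps"
proof (induction ps)
  case (Cons p ps)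
  show ?case
  proof (cases ps)
    case (Cons q qs)
    then show ?thesis using Cons.IH Cons.prems by (auto simp: successively_append_iff)
  qed simp
qed simp

lemma distinct_concat_eq:
  "distinct (concat ps) \<Longrightarrow> p \<in> set ps \<Longrightarrow> q \<in> set ps \<Longrightarrow> x \<in> set p \<Longrightarrow> x \<in> set q \<Longrightarrow> p = q"
  by (auto simp: distinct_concat_iff)

lemma distinct_concat_distinct: "distinct (concat ps) \<Longrightarrow> [] \<notin> set ps \<Longrightarrow> distinct ps"
  by (simp add: distinct_concat_iff)

text \<open>A reading passes each path as a whole, once it is rotated to start at the start of one.\<close>

lemma reading_decomposition:
  assumes inj: "inj_on head X" "inj_on tail X"
    and ps: "set (concat ps) = X" "distinct (concat ps)" "\<forall>p\<in>set ps. \<exists>h t c. is_path p h t c"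
    and xs: "xs \<noteq> []" "distinct xs" "chain xs" "set xs = {x \<in> X. component x = c}"
  obtains ys where "distinct ys" "ys \<noteq> []" "set ys = {p \<in> set ps. component (hd p) = c}"
    "chain (concat ys)"
proof -
  note disj = distinct_concat_eq[OF ps(2)]
  have ne: "[] \<notin> set ps" using ps(3) by (auto simp: is_path_def)
  have in_X: "x \<in> X" if "x \<in> set p" "p \<in> set ps" for x p using that ps(1) by auto
  have comp: "component x = component y" if "p \<in> set ps" "x \<in> set p" "y \<in> set p" for p x y
    using that ps(3) by (auto simp: is_path_def)
  have ch: "chain p" if "p \<in> set ps" for p using that ps(3) by (auto simp: is_path_def)
  \<comment> \<open>If the reading starts in the interior of a path, the previous arc of this path
    lies on the same component; so the component is closed and the reading can be rotated to the
    start of the path.\<close>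
  obtain zs where zs: "distinct zs" "chain zs" "set zs = set xs" "zs \<noteq> []" "\<exists>p\<in>set ps. hd zs = hd p"
  proof -
    have "hd xs \<in> X" using xs by (metis (no_types, lifting) list.set_sel(1) mem_Collect_eq)
    then obtain p where p: "p \<in> set ps" "hd xs \<in> set p" using ps(1) by auto
    show thesis
    proof (cases "hd xs = hd p")
      case True
      then show thesis using that[of xs] xs p by auto
    next
      case False
      obtain w where w: "w \<in> set p" "tail w = head (hd xs)"
        using chain_previous[OF ch[OF p(1)] p(2) False] by metis
      have c: "component (hd xs) = c" using xs(1,4) hd_in_set[OF xs(1)] by auto
      have hp: "hd p \<in> set p" using p(2) by (cases p) auto
      have w': "w \<in> set xs" "hd p \<in> set xs"
        using comp[OF p(1) _ p(2)] in_X[OF _ p(1)] xs(4) c w hp by auto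
      have cl: "tail (last xs) = head (hd xs)"
        using chain_closed[OF inj_on_subset[OF inj(1)] xs(3,2) w'(1) w(2)] xs(4) by auto
      obtain a b where "xs = a @ hd p # b" using w'(2) by (auto dest: split_list)
      then show thesis
        using that[of "hd p # b @ a"] chain_rotate[of a "hd p # b"] cl xs p by auto
    qed
  qed
  have zsX: "set zs = {x \<in> X. component x = c}" using zs(3) xs(4) by simp
  \<comment> \<open>Whole paths are peeled off the front; the invariant is that what remains begins
    at the start of a path.\<close>
  have "\<exists>ys'. set ys' \<subseteq> set ps \<and> zs = concat ys'"
    if "zs = concat ys @ rest" "set ys \<subseteq> set ps" "rest = [] \<or> (\<exists>p\<in>set ps. hd rest = hd p)" for ys
      rest
    using that
  proof (induction "length rest" arbitrary: ys rest rule: less_induct)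
    case less
    show ?case
    proof (cases "rest = []")
      case True
      then show ?thesis using less.prems by auto
    next
      case False
      then obtain p where p: "p \<in> set ps" "hd rest = hd p" using less.prems by auto
      have pne: "p \<noteq> []" using p ne by auto
      have rest: "chain rest" "set rest \<subseteq> X"
        using zs(2) zsX less.prems(1) by (auto simp: successively_append_iff)
      have cp: "component x = c" if "x \<in> set p" for x
      proof -
        have "hd rest \<in> set zs" using False less.prems(1) by simp
        then have "component (hd p) = c" using zsX p(2) by auto
        then show ?thesis using comp[OF p(1) that, of "hd p"] pne by simp
      qed
      consider t where "rest = p @ t" | t where "t \<noteq> []" "p = rest @ t"
        using chain_prefix[OF inj(1) ch[OF p(1)] rest(1)] rest(2) in_X[OF _ p(1)] pne False p(2) by
          auto
      then show ?thesis
      proof cases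
        case 1
        \<comment> \<open>Were the next arc interior to a path \<open>q\<close>, its predecessor
          there would share its tail with the last arc of \<open>p\<close>, hence equal it. Then
          \<open>q = p\<close>, and the next arc would repeat one of \<open>p\<close>.\<close>
        have "t = [] \<or> (\<exists>p\<in>set ps. hd t = hd p)"
        proof (rule disjCI)
          assume not_hd: "\<not> (\<exists>p\<in>set ps. hd t = hd p)"
          show "t = []"
          proof (rule ccontr)
            assume t: "t \<noteq> []"
            then have tX: "hd t \<in> X" using rest 1 by auto
            then obtain q where q: "q \<in> set ps" "hd t \<in> set q" using ps(1) by auto
            then have "hd t \<noteq> hd q" using not_hd by auto
            then obtain w where w: "w \<in> set q" "tail w = head (hd t)"
              using chain_previous[OF ch[OF q(1)] q(2)] by metis
            have "tail (last p) = head (hd t)" using rest(1) 1 t pne by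
                (auto simp: successively_append_iff)
            then have "w = last p"
              using inj_onD[OF inj(2) _ in_X[OF w(1) q(1)] in_X[OF last_in_set[OF pne] p(1)]] w(2)
                by simp
            then have "p = q" using disj[OF p(1) q(1), of w] w pne by simp
            then have "hd t \<in> set p" using q by simp
            moreover have "distinct (p @ t)" using zs(1) less.prems(1) 1 by auto
            ultimately show False using t by auto
          qed
        qed
        moreover have "length t < length rest" using 1 pne by simp
        ultimately show ?thesis
          using less.hyps[of t "ys @ [p]"] less.prems p 1 by auto
      next
        case 2
        \<comment> \<open>The reading cannot stop inside \<open>p\<close>: the missing arcs of
          \<open>p\<close> would have been read before, as part of a path that must be
          \<open>p\<close> itself, and then its first arc would be read twice.\<close>
        have "distinct p" using ps(2) p(1) by (auto simp: distinct_concat_iff)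
        have tp: "hd t \<in> set p" using 2 by simp
        then have "hd t \<in> set zs" using cp in_X[OF _ p(1)] zsX by auto
        moreover have "hd t \<notin> set rest" using \<open>distinct p\<close> 2 by auto
        ultimately obtain y where y: "y \<in> set ys" "hd t \<in> set y" using less.prems(1) by auto
        then have "y = p" using disj[of y p "hd t"] less.prems(2) p tp by auto
        then have "hd p \<in> set (concat ys)" using y hd_in_set[OF pne] by auto
        moreover have "hd p \<in> set rest" using p(2) False by (metis hd_in_set)
        ultimately show ?thesis using zs(1) less.prems(1) by auto
      qed
    qed
  qed
  from this[of "[]" zs] zs obtain ys where ys: "set ys \<subseteq> set ps" "zs = concat ys" by auto
  show thesis
  proof
    show "distinct ys" using distinct_concat_distinct[of ys] zs(1) ys ne by auto
    show "ys \<noteq> []" using ys zs(4) by auto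
    show "chain (concat ys)" using zs(2) ys by simp
    show "set ys = {p \<in> set ps. component (hd p) = c}"
    proof (intro equalityI subsetI)
      fix p assume p: "p \<in> set ys"
      then have "p \<noteq> []" using ys(1) ne by auto
      then have "hd p \<in> set zs" using p ys(2) by (auto intro!: bexI[of _ p])
      then show "p \<in> {p \<in> set ps. component (hd p) = c}" using zsX ys p by auto
    next
      fix p assume p: "p \<in> {p \<in> set ps. component (hd p) = c}"
      then have hp: "hd p \<in> set p" using ne by (cases p) auto
      then have "hd p \<in> set zs" using zsX p in_X by auto
      then obtain y where "y \<in> set ys" "hd p \<in> set y" using ys by auto
      then show "p \<in> set ys" using disj[of p y "hd p"] p hp ys by auto
    qed
  qed
qed

text \<open>Within a reading each tail is the head of the next arc, so the sets of tails and heads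
  can differ only at the two ends.\<close>

lemma closed_component_iff:
  assumes inj: "inj_on head (arcs Z)" and xs: "is_reading Z c xs"
  shows "closed_component Z c \<longleftrightarrow> tail (last xs) = head (hd xs)"
proof
  have set: "set xs = component_arcs Z c" and ch: "chain xs" and ne: "xs \<noteq> []" and d: "distinct xs"
    using xs by (auto simp: is_reading_def)
  have sub: "set xs \<subseteq> arcs Z" using set by (auto simp: component_arcs_def)
  {
    assume "closed_component Z c"
    then have "head (hd xs) \<in> tail ` set xs" using set ne by (auto simp: closed_component_def)
    then obtain w where "w \<in> set xs" "tail w = head (hd xs)" by auto
    then show "tail (last xs) = head (hd xs)"
      using chain_closed[OF inj_on_subset[OF inj sub] ch d] by auto
  }
  assume cl: "tail (last xs) = head (hd xs)"
  have "tail x \<in> head ` set xs" if x: "x \<in> set xs" for x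
  proof (cases "x = last xs")
    case False
    then obtain y where "y \<in> set (tl xs)" "tail x = head y" using chain_next[OF ch x] by metis
    then show ?thesis using ne by (auto intro: list.set_sel)
  qed (use cl ne in auto)
  moreover have "head x \<in> tail ` set xs" if x: "x \<in> set xs" for x
  proof (cases "x = hd xs")
    case False
    then obtain w where "w \<in> set xs" "tail w = head x" using chain_previous[OF ch x] by metis
    then show ?thesis by (metis image_eqI)
  qed (use cl ne in \<open>auto intro: rev_image_eqI[of "last xs"]\<close>)
  ultimately show "closed_component Z c" by (auto simp: closed_component_def set[symmetric])
qed

text \<open>The point map \<open>g\<close> says which ends of paths correspond. Being a map it
  preserves which path follows which; its injectivity on ends also prevents an open component from
  becoming closed.\<close>

definition matched :: "(arc list \<times> arc list) list \<Rightarrow> diagram \<Rightarrow> diagram \<Rightarrow> bool" where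
  "matched rs Z Z' \<longleftrightarrow>
     set (concat (map fst rs)) = arcs Z \<and> distinct (concat (map fst rs)) \<and>
     set (concat (map snd rs)) = arcs Z' \<and> distinct (concat (map snd rs)) \<and>
     (\<exists>g. inj_on g (\<Union>(p, p')\<in>set rs. {head (hd p), tail (last p)}) \<and>
        (\<forall>(p, p')\<in>set rs. \<exists>h t c. is_path p h t c \<and> is_path p' (g h) (g t) c))"

text \<open>A reading of the first diagram orders the paths of the component. The ends correspond
  under \<open>g\<close>, so the partners in the same order form a reading of the second diagram:
  the pairs \<open>ss\<close> read both diagrams simultaneously.\<close>

lemma matched_reading:
  assumes m: "matched rs Z Z'" and inj: "inj_on head (arcs Z)" "inj_on tail (arcs Z)"
    "inj_on head (arcs Z')"
    and xs: "is_reading Z c xs"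
  obtains ss where "distinct ss" "set ss = {r \<in> set rs. component (hd (fst r)) = c}"
    "is_reading Z c (concat (map fst ss))" "is_reading Z' c (concat (map snd ss))"
    "closed_component Z c = closed_component Z' c"
proof -
  obtain g where g: "inj_on g (\<Union>(p, p')\<in>set rs. {head (hd p), tail (last p)})"
    and path0: "\<forall>(p, p')\<in>set rs. \<exists>h t c. is_path p h t c \<and> is_path p' (g h) (g t) c"
    using m unfolding matched_def by blast
  have path: "\<exists>h t c. is_path p h t c \<and> is_path p' (g h) (g t) c" if "(p, p') \<in> set rs" for p p'
    using bspec[OF path0 that] by (simp only: prod.case)
  have path1: "is_path p (head (hd p)) (tail (last p)) (component (hd p))"
    and path2: "is_path p' (g (head (hd p))) (g (tail (last p))) (component (hd p))" if
      "(p, p') \<in> set rs" for p p'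
    using path[OF that] by (auto simp: is_path_def)
  have Z: "set (concat (map fst rs)) = arcs Z" "distinct (concat (map fst rs))"
    and Z': "set (concat (map snd rs)) = arcs Z'" "distinct (concat (map snd rs))"
    using m by (auto simp: matched_def)
  have ne: "[] \<notin> set (map fst rs)" "[] \<notin> set (map snd rs)"
  proof -
    have "fst r \<noteq> [] \<and> snd r \<noteq> []" if "r \<in> set rs" for r
      using is_path_not_Nil[OF path1] is_path_not_Nil[OF path2] that by (metis prod.collapse)
    then show "[] \<notin> set (map fst rs)" "[] \<notin> set (map snd rs)" by fastforce+
  qed
  obtain ys where ys: "distinct ys" "ys \<noteq> []" "set ys = {p \<in> set (map fst rs). component (hd p) =
    c}"
      "chain (concat ys)"
  proof (rule reading_decomposition[OF inj(1,2) Z])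
    show "\<forall>p\<in>set (map fst rs). \<exists>h t c. is_path p h t c" using path1 by fastforce
    show "xs \<noteq> []" "distinct xs" "chain xs" "set xs = {x \<in> arcs Z. component x = c}"
      using xs by (auto simp: is_reading_def component_arcs_def)
  qed
  have df: "distinct (map fst rs)" by (rule distinct_concat_distinct[OF Z(2) ne(1)])
  have ds: "distinct (map snd rs)" by (rule distinct_concat_distinct[OF Z'(2) ne(2)])
  have injf: "inj_on fst (set rs)" and injs: "inj_on snd (set rs)"
    using df ds by (simp_all add: distinct_map)
  \<comment> \<open>The order found for the first paths is lifted to pairs; first paths are nonempty
    and disjoint, so each determines its pair.\<close>
  define ss where "ss = map (\<lambda>p. THE r. r \<in> set rs \<and> fst r = p) ys"
  have the: "(THE r. r \<in> set rs \<and> fst r = fst s) = s" if "s \<in> set rs" for s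
    using that injf by (auto intro!: the_equality dest: inj_onD)
  have the': "(THE r. r \<in> set rs \<and> fst r = p) \<in> set rs \<and> fst (THE r. r \<in> set rs \<and> fst r = p) = p"
    if "p \<in> set ys" for p
  proof -
    have "p \<in> fst ` set rs" using that ys(3) by simp
    then obtain s where "p = fst s" "s \<in> set rs" by (rule imageE)
    then show ?thesis using the[of s] by simp
  qed
  have fst_is: "map fst ss = ys" using the' by (simp add: ss_def map_idI)
  have is_rs: "set ss \<subseteq> set rs" using the' by (auto simp: ss_def)
  have set_is: "set ss = {r \<in> set rs. component (hd (fst r)) = c}"
  proof (intro equalityI subsetI)
    fix r assume r: "r \<in> set ss"
    then have "fst r \<in> set ys" using fst_is by (metis image_eqI list.set_map)
    then show "r \<in> {r \<in> set rs. component (hd (fst r)) = c}" using ys(3) r is_rs by auto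
  next
    fix r assume r: "r \<in> {r \<in> set rs. component (hd (fst r)) = c}"
    then have "fst r \<in> set ys" using ys(3) by auto
    then show "r \<in> set ss" using the[of r] r by (auto simp: ss_def image_iff intro!:
      bexI[of _ "fst r"])
  qed
  have d_is: "distinct ss" using ys(1) fst_is by (metis distinct_map)
  have ne_is: "ss \<noteq> []" using fst_is ys(2) by auto
  have p1: "is_path (fst r) (head (hd (fst r))) (tail (last (fst r))) c"
    and p2: "is_path (snd r) (g (head (hd (fst r)))) (g (tail (last (fst r)))) c" if "r \<in> set ss"
      for r
    using that path1[of "fst r" "snd r"] path2[of "fst r" "snd r"] set_is by auto
  have ne_is12: "[] \<notin> set (map fst ss)" "[] \<notin> set (map snd ss)"
  proof -
    have "fst r \<noteq> [] \<and> snd r \<noteq> []" if "r \<in> set ss" for r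
      using is_path_not_Nil[OF p1[OF that]] is_path_not_Nil[OF p2[OF that]] by simp
    then show "[] \<notin> set (map fst ss)" "[] \<notin> set (map snd ss)" by fastforce+
  qed
  have succ: "successively (\<lambda>r s. tail (last (fst r)) = head (hd (fst s))) ss"
    using ys(4) ne_is12(1) by (simp add: fst_is[symmetric] chain_concat successively_map)
  have "successively (\<lambda>r s. tail (last (snd r)) = head (hd (snd s))) ss"
  proof (rule successively_mono[OF succ])
    fix r s assume "r \<in> set ss" "s \<in> set ss" "tail (last (fst r)) = head (hd (fst s))"
    then show "tail (last (snd r)) = head (hd (snd s))"
      using p2[of r] p2[of s] by (simp add: is_path_def)
  qed
  then have ch2: "chain (concat (map snd ss))"
    unfolding chain_concat[OF ne_is12(2)] using p2 unfolding is_path_def by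
      (simp add: successively_map)
  have arcs: "set (concat (map f ss)) = component_arcs Y c"
    if Y: "set (concat (map f rs)) = arcs Y"
      and comp: "\<And>r x. r \<in> set rs \<Longrightarrow> x \<in> set (f r) \<Longrightarrow> component x = component (hd (fst r))"
    for f :: "arc list \<times> arc list \<Rightarrow> arc list" and Y
  proof -
    have "component (hd (fst r)) = c \<longleftrightarrow> component x = c" if "r \<in> set rs" "x \<in> set (f r)" for r x
      by (simp only: comp[OF that])
    then show ?thesis
      unfolding component_arcs_def Y[symmetric] set_concat set_map set_is by blast
  qed
  have arcs1: "set (concat (map fst ss)) = component_arcs Z c"
  proof (rule arcs[OF Z(1)])
    show "component x = component (hd (fst r))" if "r \<in> set rs" "x \<in> set (fst r)" for r x
      using is_path_component[OF path1[of "fst r" "snd r"] that(2)] that(1) by simp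
  qed
  have arcs2: "set (concat (map snd ss)) = component_arcs Z' c"
  proof (rule arcs[OF Z'(1)])
    show "component x = component (hd (fst r))" if "r \<in> set rs" "x \<in> set (snd r)" for r x
      using is_path_component[OF path2[of "fst r" "snd r"] that(2)] that(1) by simp
  qed
  have sub: "distinct (concat (map f ss))" if "distinct (concat (map f rs))" "[] \<notin> f ` set ss"
      "inj_on f (set rs)"
    for f :: "arc list \<times> arc list \<Rightarrow> arc list"
  proof -
    have "distinct (map f ss)" using d_is that(3) is_rs by
        (auto simp: distinct_map intro: inj_on_subset)
    then have "distinct (removeAll [] (map f ss))" by (rule distinct_removeAll)
    moreover have "f ` set ss \<subseteq> f ` set rs" using is_rs by (rule image_mono)
    ultimately show ?thesis
      using that(1) unfolding distinct_concat_iff set_map by (meson subsetD)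
  qed
  have ne_concat: "concat (map f ss) \<noteq> []" if "[] \<notin> set (map f ss)" for f ::
      "arc list \<times> arc list \<Rightarrow> arc list"
    using that ne_is by (cases ss) auto
  have ne_im: "[] \<notin> fst ` set ss" "[] \<notin> snd ` set ss" using ne_is12 by simp_all
  have r1: "is_reading Z c (concat (map fst ss))"
    unfolding is_reading_def
    using ne_concat[OF ne_is12(1)] sub[OF Z(2) ne_im(1) injf] arcs1 ys(4)[folded fst_is] by blast
  have r2: "is_reading Z' c (concat (map snd ss))"
    unfolding is_reading_def
    using ne_concat[OF ne_is12(2)] sub[OF Z'(2) ne_im(2) injs] arcs2 ch2 by blast
  have "hd ss \<in> set ss" "last ss \<in> set ss" using ne_is by simp_all
  then have e: "hd (concat (map f ss)) = hd (f (hd ss))"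
    "last (concat (map f ss)) = last (f (last ss))"
    if "[] \<notin> f ` set ss" for f :: "arc list \<times> arc list \<Rightarrow> arc list"
  proof -
    show "hd (concat (map f ss)) = hd (f (hd ss))" using that ne_is by (cases ss) auto
    show "last (concat (map f ss)) = last (f (last ss))" using that ne_is by
        (cases ss rule: rev_cases) auto
  qed
  have "closed_component Z c \<longleftrightarrow> tail (last (fst (last ss))) = head (hd (fst (hd ss)))"
    unfolding closed_component_iff[OF inj(1) r1] e[of fst, OF ne_im(1)] ..
  \<comment> \<open>The place where injectivity of \<open>g\<close> is used: closing up is also
    reflected by \<open>g\<close>.\<close>
  also have "\<dots> \<longleftrightarrow> g (tail (last (fst (last ss)))) = g (head (hd (fst (hd ss))))"
  proof -
    let ?U = "\<Union>(p, p')\<in>set rs. {head (hd p), tail (last p)}"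
    have "{head (hd (fst r)), tail (last (fst r))} \<subseteq> ?U" if "r \<in> set ss" for r
      using UN_upper[OF subsetD[OF is_rs that], of "\<lambda>(p, p'). {head (hd p), tail (last p)}"]
      by (simp only: case_prod_unfold)
    then have "tail (last (fst (last ss))) \<in> ?U" "head (hd (fst (hd ss))) \<in> ?U"
      using \<open>hd ss \<in> set ss\<close> \<open>last ss \<in> set ss\<close> by (simp_all only: insert_subset)
    then show ?thesis by (simp only: inj_on_eq_iff[OF g])
  qed
  also have "\<dots> \<longleftrightarrow> tail (last (snd (last ss))) = head (hd (snd (hd ss)))"
    using p2[OF \<open>hd ss \<in> set ss\<close>] p2[OF \<open>last ss \<in> set ss\<close>] unfolding is_path_def by simp
  also have "\<dots> \<longleftrightarrow> closed_component Z' c"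
    unfolding closed_component_iff[OF inj(3) r2] e[of snd, OF ne_im(2)] ..
  finally show thesis by (rule that[OF d_is set_is r1 r2])
qed

section \<open>Replacing words\<close>

definition crossing_points :: "passage list \<Rightarrow> point set" where
  "crossing_points ps = {q. \<exists>s u. Under q s u \<in> set ps \<or> Over q s u \<in> set ps}"

fun rename_passage :: "(point \<Rightarrow> point) \<Rightarrow> passage \<Rightarrow> passage" where
  "rename_passage g Plain = Plain"
| "rename_passage g (Under q s u) = Under (g q) s u"
| "rename_passage g (Over q s u) = Over (g q) s u"

text \<open>Plain passages carry no label. Without them the word of a strand does not depend on the
  number of rows, symmetries and bends it runs through.\<close>

definition word :: "arc list \<Rightarrow> passage list" where
  "word p = filter (\<lambda>x. x \<noteq> Plain) (map passage p)"

lemma crossing_points_Nil: "crossing_points [] = {}"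
  by (simp add: crossing_points_def)

lemma crossing_points_mono: "set xs \<subseteq> set ys \<Longrightarrow> crossing_points xs \<subseteq> crossing_points ys"
  by (auto simp: crossing_points_def)

lemma crossing_points_rename: "crossing_points (map (rename_passage \<rho>) ps) = \<rho> ` crossing_points ps"
proof -
  have "Under q s u = rename_passage \<rho> p \<longleftrightarrow> (\<exists>q'. p = Under q' s u \<and> q = \<rho> q')"
    "Over q s u = rename_passage \<rho> p \<longleftrightarrow> (\<exists>q'. p = Over q' s u \<and> q = \<rho> q')" for q s u p
    by (cases p; auto)+
  then show ?thesis by (auto simp: crossing_points_def image_iff) blast+
qed

lemma sum_PiE_Un:
  assumes "A \<inter> B = {}"
  shows "(\<Sum>a\<in>A \<union> B \<rightarrow>\<^sub>E C. F a) = (\<Sum>\<alpha>\<in>A \<rightarrow>\<^sub>E C. \<Sum>\<beta>\<in>B \<rightarrow>\<^sub>E C. F (\<lambda>q. if q \<in> A then \<alpha> q else \<beta> q))"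
  unfolding sum.cartesian_product
  by (rule sum.reindex_bij_witness[where j = "\<lambda>a. (restrict a A, restrict a B)"
        and i = "\<lambda>(\<alpha>, \<beta>) q. if q \<in> A then \<alpha> q else \<beta> q"])
    (use assms in \<open>auto simp: fun_eq_iff PiE_iff extensional_def intro!: arg_cong[of _ _ F]\<close>)

lemma sum_PiE_rename:
  assumes "inj_on \<rho> A" "\<And>\<alpha>. \<alpha> \<in> \<rho> ` A \<rightarrow>\<^sub>E C \<Longrightarrow> F \<alpha> = G (restrict (\<alpha> \<circ> \<rho>) A)"
  shows "(\<Sum>\<alpha>\<in>\<rho> ` A \<rightarrow>\<^sub>E C. F \<alpha>) = (\<Sum>\<alpha>\<in>A \<rightarrow>\<^sub>E C. G \<alpha>)"
  by (rule sum.reindex_bij_witness[where j = "\<lambda>\<alpha>. restrict (\<alpha> \<circ> \<rho>) A"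
        and i = "\<lambda>\<alpha>. restrict (\<alpha> \<circ> inv_into A \<rho>) (\<rho> ` A)"])
    (use assms in \<open>auto simp: fun_eq_iff PiE_iff extensional_def inv_into_f_f restrict_def\<close>)

context bijective_antipode
begin

lemma word_product_cong:
  assumes "\<And>q. q \<in> crossing_points ps \<Longrightarrow> a q = b q"
  shows "word_product th a ps = word_product th b ps"
proof -
  have "passage_labels th a p = passage_labels th b p" if "p \<in> set ps" for p
  proof (cases p)
    case (Under q s u)
    then have "q \<in> crossing_points ps" using that by (auto simp: crossing_points_def)
    then show ?thesis using Under assms by simp
  next
    case (Over q s u)
    then have "q \<in> crossing_points ps" using that by (auto simp: crossing_points_def)
    then show ?thesis using Over assms by simp
  qed simp
  then show ?thesis by (simp add: word_product_def cong: map_cong)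
qed

lemma word_product_rename: "word_product th a (map (rename_passage \<rho>) ps) = word_product th (a \<circ> \<rho>)
    ps"
proof -
  have "passage_labels th a (rename_passage \<rho> p) = passage_labels th (a \<circ> \<rho>) p" for p
    by (cases p) auto
  then show ?thesis by (simp add: word_product_def comp_def)
qed

lemma word_product_word: "word_product th a (word p) = word_product th a (map passage p)"
proof (induction p)
  case (Cons x p)
  show ?case
  proof (cases "passage x = Plain")
    case True
    then show ?thesis using Cons by (simp add: word_def word_product_Plain)
  next
    case False
    then have "word (x # p) = [passage x] @ word p" "map passage (x # p) = [passage x] @ map passage
      p"
      by (simp_all add: word_def)
    then show ?thesis by (simp only: word_product_append Cons)
  qed
qed (simp add: word_def)

lemma word_product_concat:
  "word_product th a (concat pss) = foldr (colored_mult th) (map (word_product th a) pss) heis_one"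
  by (induction pss) (simp_all add: word_product_Nil word_product_append)

lemma module_heis_scale: "module heis_scale"
  by unfold_locales (simp_all add: heis_scale_def fun_eq_iff scale_right_distrib scale_left_distrib)

lemma commutator_in_space:
  assumes "F \<in> heis_carrier" "G \<in> heis_carrier"
  shows "colored_mult th F G - colored_mult th G F \<in> commutator_space th"
  unfolding commutator_space_def
  by (rule module.span_base[OF module_heis_scale]) (use assms in blast)

lemma multilin_form_of_relators:
  assumes L: "Vector_Spaces.linear free_scale (*) L"
    and rel: "\<And>r. r \<in> tensor_relators heis_scale heis_carrier N n \<Longrightarrow> L r = 0"
  shows "multilin_form n (\<lambda>xs. L (Poly_Mapping.single xs 1))"
    and "length xs = n \<Longrightarrow> set xs \<subseteq> heis_carrier \<Longrightarrow> i < n \<Longrightarrow> X \<in> N i \<Longrightarrow> L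
      (Poly_Mapping.single (xs[i := X]) 1) = 0"
proof -
  interpret L: Vector_Spaces.linear free_scale "(*)" L by fact
  have fs: "Poly_Mapping.single xs c = free_scale c (Poly_Mapping.single xs (1 :: 'a))" for xs ::
      "('b \<Rightarrow> 'b) list" and c
    by (rule poly_mapping_eqI) (simp add: lookup_free_scale lookup_single when_def)
  show "multilin_form n (\<lambda>xs. L (Poly_Mapping.single xs 1))"
    unfolding multilin_form_def heis_lin_form_def
  proof (intro allI impI conjI ballI)
    fix xs i F G c assume *: "length xs = n" "set xs \<subseteq> heis_carrier" "i < n" "F \<in> heis_carrier"
    { assume G: "G \<in> heis_carrier"
      have "Poly_Mapping.single (xs[i := F + G]) 1 - Poly_Mapping.single (xs[i := F]) 1 -
          Poly_Mapping.single (xs[i := G]) 1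
        \<in> tensor_relators heis_scale heis_carrier N n"
        using * G unfolding tensor_relators_def by blast
      from rel[OF this] have "L (Poly_Mapping.single (xs[i := F + G]) 1) -
          L (Poly_Mapping.single (xs[i := F]) 1) - L (Poly_Mapping.single (xs[i := G]) 1) = 0"
        by (simp only: L.diff)
      then show "L (Poly_Mapping.single (xs[i := F + G]) 1) =
          L (Poly_Mapping.single (xs[i := F]) 1) + L (Poly_Mapping.single (xs[i := G]) 1)"
        by (simp add: diff_diff_eq) }
    have "Poly_Mapping.single (xs[i := heis_scale c F]) 1 - Poly_Mapping.single (xs[i := F]) c
        \<in> tensor_relators heis_scale heis_carrier N n"
      using * unfolding tensor_relators_def by blast
    from rel[OF this] show "L (Poly_Mapping.single (xs[i := heis_scale c F]) 1) = c * L
      (Poly_Mapping.single (xs[i := F]) 1)"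
      by (simp add: L.diff fs[of _ c] L.scale)
  qed
  show "L (Poly_Mapping.single (xs[i := X]) 1) = 0"
    if "length xs = n" "set xs \<subseteq> heis_carrier" "i < n" "X \<in> N i"
    by (rule rel) (use that in \<open>unfold tensor_relators_def, blast\<close>)
qed

text \<open>Multilinearity permits changing one entry at a time, and for a rotated closed component
  the change is a commutator, on which the form vanishes.\<close>

lemma multilin_form_rotate:
  assumes \<Lambda>: "multilin_form n \<Lambda>"
    and zero: "\<And>xs i X. length xs = n \<Longrightarrow> set xs \<subseteq> heis_carrier \<Longrightarrow> i < n \<Longrightarrow> cl i \<Longrightarrow>
      X \<in> commutator_space (th ! i) \<Longrightarrow> \<Lambda> (xs[i := X]) = 0"
    and xs: "length xs = n" "set xs \<subseteq> heis_carrier" and ys: "length ys = n" "set ys \<subseteq> heis_carrier"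
    and rot: "\<And>i. i < n \<Longrightarrow> xs ! i = ys ! i \<or> (cl i \<and> (\<exists>F\<in>heis_carrier. \<exists>G\<in>heis_carrier.
      xs ! i = colored_mult (th ! i) F G \<and> ys ! i = colored_mult (th ! i) G F))"
  shows "\<Lambda> xs = \<Lambda> ys"
proof -
  \<comment> \<open>The hybrid list has its first \<open>k\<close> entries already taken from
    \<open>ys\<close>.\<close>
  have "\<Lambda> xs = \<Lambda> (take k ys @ drop k xs)" if "k \<le> n" for k
    using that
  proof (induction k)
    case (Suc k)
    let ?zs = "take k ys @ drop k xs"
    have len: "length ?zs = n" using xs ys Suc by simp
    have car: "set ?zs \<subseteq> heis_carrier"
      using xs ys set_take_subset[of k ys] set_drop_subset[of k xs] by auto
    have k: "k < n" using Suc by simp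
    have 1: "?zs[k := xs ! k] = ?zs"
      using k xs ys by (intro nth_equalityI) (auto simp: nth_list_update nth_append)
    have 2: "?zs[k := ys ! k] = take (Suc k) ys @ drop (Suc k) xs"
      using k xs ys by (intro nth_equalityI) (auto simp: nth_list_update nth_append less_Suc_eq)
    have "\<Lambda> (?zs[k := xs ! k]) = \<Lambda> (?zs[k := ys ! k])"
      using rot[OF k]
    proof
      assume "cl k \<and> (\<exists>F\<in>heis_carrier. \<exists>G\<in>heis_carrier.
        xs ! k = colored_mult (th ! k) F G \<and> ys ! k = colored_mult (th ! k) G F)"
      then obtain F G where clk: "cl k" and F: "F \<in> heis_carrier" and G: "G \<in> heis_carrier" and
        e: "xs ! k = colored_mult (th ! k) F G" "ys ! k = colored_mult (th ! k) G F" by blast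
      let ?X = "colored_mult (th ! k) F G - colored_mult (th ! k) G F"
      have z: "\<Lambda> (?zs[k := ?X]) = 0" by (rule zero[OF len car k clk commutator_in_space[OF F G]])
      have c: "colored_mult (th ! k) F G \<in> heis_carrier" "colored_mult (th ! k) G F \<in> heis_carrier"
        using F G by (simp_all add: colored_mult_carrier)
      have X: "?X \<in> heis_carrier"
        using c by (simp add: heis_carrier_iff scale_right_diff_distrib algebra_simps)
      have "heis_lin_form (\<lambda>F. \<Lambda> (?zs[k := F]))" using \<Lambda> len car k by (simp add: multilin_form_def)
      then have "\<Lambda> (?zs[k := ?X + colored_mult (th ! k) G F]) = \<Lambda> (?zs[k := ?X]) + \<Lambda>
        (?zs[k := colored_mult (th ! k) G F])"
        using X c(2) by (simp only: heis_lin_form_def)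
      then show ?thesis using z e by simp
    qed simp
    then show ?case using Suc 1 2 by simp
  qed simp
  from this[of n] show ?thesis using xs ys by simp
qed

text \<open>The thickness is looked up through the first path of a pair for both diagrams; matched
  paths lie on the same component.\<close>

abbreviation path_products ::
  "bool list \<Rightarrow> (arc list \<times> arc list \<Rightarrow> arc list) \<Rightarrow> (point \<Rightarrow> 'b) \<Rightarrow> (arc list \<times> arc list) list \<Rightarrow>
    ('b \<Rightarrow> 'b) list"
  where "path_products th f a \<equiv> map (\<lambda>r. word_product (th ! component (hd (fst r))) a (word (f r)))"

text \<open>The passage from diagrams to algebra. With the labelling outside the block fixed, a test
  form evaluated on J' becomes a multilinear form in the products along the paths \<open>bs\<close>,
  each of which occurs once in the diagram. The hypothesis \<open>block\<close> compares exactly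
  such forms, and the outside sum is then reindexed by \<open>\<rho>\<close>.\<close>

lemma J'_transfer:
  fixes Z Z' :: diagram and outs bs :: "(arc list \<times> arc list) list"
  defines "A f \<equiv> crossing_points (concat (map (\<lambda>r. word (f r)) outs))"
    and "B f \<equiv> crossing_points (concat (map (\<lambda>r. word (f r)) bs))"
  assumes th: "thick Z = th" "thick Z' = th"
    and Z: "inj_on head (arcs Z)" "inj_on tail (arcs Z)" "\<forall>x\<in>arcs Z. component x < length th"
      "\<forall>c<length th. \<exists>xs. is_reading Z c xs" "crossings Z = A fst \<union> B fst"
    and Z': "inj_on head (arcs Z')" "\<forall>x\<in>arcs Z'. component x < length th" 
      "\<forall>c<length th. \<exists>xs. is_reading Z' c xs" "crossings Z' = A snd \<union> B snd"
    and m: "matched (outs @ bs) Z Z'"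
    and ren: "\<And>p p'. (p, p') \<in> set outs \<Longrightarrow> word p' = map (rename_passage \<rho>) (word p)"
    and \<rho>: "inj_on \<rho> (A fst)"
    and disj: "A fst \<inter> B fst = {}" "A snd \<inter> B snd = {}"
    and block: "\<And>\<phi>. multilin_form (length bs) \<phi> \<Longrightarrow>
      (\<Sum>a\<in>B fst \<rightarrow>\<^sub>E Basis. \<phi> (path_products th fst a bs)) =
      (\<Sum>a\<in>B snd \<rightarrow>\<^sub>E Basis. \<phi> (path_products th snd a bs))"
  shows "J' Z = J' Z'"
proof -
  define n where "n = length th"
  have "\<exists>ss. distinct ss \<and> set ss = {r \<in> set (outs @ bs). component (hd (fst r)) = c} \<and>
    is_reading Z c (concat (map fst ss)) \<and> is_reading Z' c (concat (map snd ss)) \<and>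
    closed_component Z c = closed_component Z' c" if c: "c < n" for c
  proof -
    obtain xs where xs: "is_reading Z c xs" using Z(4) c n_def by blast
    show ?thesis
      by (rule matched_reading[OF m Z(1,2) Z'(1) xs]) (intro exI conjI)
  qed
  then have "\<exists>ss. \<forall>c<n. distinct (ss c) \<and> set (ss c) = {r \<in> set (outs @ bs). component (hd (fst r))
    = c} \<and>
      is_reading Z c (concat (map fst (ss c))) \<and> is_reading Z' c (concat (map snd (ss c))) \<and>
      closed_component Z c = closed_component Z' c"
    by (intro choice) blast
  then obtain ss where *: "\<forall>c<n. distinct (ss c) \<and> set (ss c) = {r \<in> set (outs @ bs). component
    (hd (fst r)) = c} \<and>
      is_reading Z c (concat (map fst (ss c))) \<and> is_reading Z' c (concat (map snd (ss c))) \<and>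
      closed_component Z c = closed_component Z' c" ..
  have ss: "distinct (ss c)" "set (ss c) = {r \<in> set (outs @ bs). component (hd (fst r)) = c}"
      "is_reading Z c (concat (map fst (ss c)))" "is_reading Z' c (concat (map snd (ss c)))"
      "closed_component Z c = closed_component Z' c" if c: "c < n" for c
    using *[rule_format, OF c] by blast+
  \<comment> \<open>Also asserted beyond the last component, where both sides hold trivially, so
    that the families of subspaces in the two tensor classes coincide as functions.\<close>
  have closed: "closed_component Z c = closed_component Z' c" for c
  proof (cases "c < n")
    case False
    then have "component_arcs Z c = {}" "component_arcs Z' c = {}"
      using Z(3) Z'(2) by (auto simp: component_arcs_def n_def)
    then show ?thesis by (simp add: closed_component_def)
  qed (rule ss(5))
  let ?N = "\<lambda>c. if closed_component Z c then commutator_space (th ! c) else {}"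
  let ?S = "\<lambda>Z. \<Sum>a\<in>crossings Z \<rightarrow>\<^sub>E Basis. Poly_Mapping.single (map (component_product Z a) [0..<n])
    (1 :: 'a)"
  have "tensor_class heis_scale heis_carrier ?N n (?S Z) = tensor_class heis_scale heis_carrier ?N n
      (?S Z')"
  proof (rule tensor_class_eqI)
    fix L assume L: "Vector_Spaces.linear free_scale (*) L"
      and rel: "\<And>r. r \<in> tensor_relators heis_scale heis_carrier ?N n \<Longrightarrow> L r = (0 :: 'a)"
    interpret L: Vector_Spaces.linear free_scale "(*)" L by fact
    define \<Lambda> where "\<Lambda> xs = L (Poly_Mapping.single xs 1)" for xs
    have \<Lambda>: "multilin_form n \<Lambda>" unfolding \<Lambda>_def by (rule multilin_form_of_relators[OF L rel])
    have zero: "\<Lambda> (xs[i := X]) = 0" if "length xs = n" "set xs \<subseteq> heis_carrier" "i < n"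
        "closed_component Z i"
      "X \<in> commutator_space (th ! i)" for xs i X
      unfolding \<Lambda>_def by (rule multilin_form_of_relators(2)[where N = ?N, OF L rel])
        (use that in simp_all)
    define P where "P f a c = word_product (th ! c) a (concat (map (\<lambda>r. word (f r)) (ss c)))"
      for f :: "arc list \<times> arc list \<Rightarrow> arc list" and a c
    \<comment> \<open>The reading chosen in the definition of J' is replaced by the one running
      through \<open>ss\<close>; where they differ by a proper rotation the component is closed and
      the difference is a commutator.\<close>
    have rotate: "\<Lambda> (map (component_product Y a) [0..<n]) = \<Lambda> (map (P f a) [0..<n])"
      if Y: "thick Y = th" "inj_on head (arcs Y)" "\<And>c. c < n \<Longrightarrow> is_reading Y c
        (concat (map f (ss c)))"
        "\<And>c. closed_component Z c = closed_component Y c" for Y f a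
    proof (rule multilin_form_rotate[OF \<Lambda>, where cl = "closed_component Z" and th = th])
      have cp: "component_product Y a c = word_product (th ! c) a (map passage (reading Y c))" for c
        by (simp add: component_product_def word_product_def Y(1) comp_def)
      have P: "P f a c = word_product (th ! c) a (map passage (concat (map f (ss c))))" for c
      proof -
        have "concat (map (\<lambda>r. word (f r)) (ss c)) = word (concat (map f (ss c)))"
          by (simp add: word_def filter_concat map_concat comp_def)
        then show ?thesis by (simp only: P_def word_product_word)
      qed
      show "set (map (component_product Y a) [0..<n]) \<subseteq> heis_carrier"
        by (auto simp: cp word_product_carrier)
      show "set (map (P f a) [0..<n]) \<subseteq> heis_carrier"
        by (auto simp: P_def word_product_carrier)
      fix c assume c: "c < n"
      let ?xs = "reading Y c" and ?ys = "concat (map f (ss c))"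
      have ys: "is_reading Y c ?ys" by (rule Y(3)[OF c])
      have xs: "is_reading Y c ?xs"
        unfolding reading_def by (rule someI[of "is_reading Y c"]) (rule ys)
      have sub: "set ?xs \<subseteq> arcs Y" using xs by (auto simp: is_reading_def component_arcs_def)
      obtain u v where uv: "?xs = u @ v" "?ys = v @ u" "u = [] \<or> tail (last ?xs) = head (hd ?xs)"
        by (rule readings_rotated[OF inj_on_subset[OF Y(2) sub], of ?ys])
          (use xs ys in \<open>auto simp: is_reading_def\<close>)
      have cl: "closed_component Z c" if "u \<noteq> []"
        using closed_component_iff[OF Y(2) xs] uv(3) that Y(4) by simp
      show "map (component_product Y a) [0..<n] ! c = map (P f a) [0..<n] ! c \<or>
        (closed_component Z c \<and> (\<exists>F\<in>heis_carrier. \<exists>G\<in>heis_carrier.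
          map (component_product Y a) [0..<n] ! c = colored_mult (th ! c) F G \<and>
          map (P f a) [0..<n] ! c = colored_mult (th ! c) G F))"
      proof (cases "u = []")
        case True
        then show ?thesis using c uv by (simp add: cp P)
      next
        case False
        have "component_product Y a c = colored_mult (th ! c)
            (word_product (th ! c) a (map passage u)) (word_product (th ! c) a (map passage v))"
          "P f a c = colored_mult (th ! c) (word_product (th ! c) a (map passage v))
            (word_product (th ! c) a (map passage u))"
          unfolding cp P uv by (simp_all add: word_product_append)
        then have "\<exists>F\<in>heis_carrier. \<exists>G\<in>heis_carrier.
            component_product Y a c = colored_mult (th ! c) F G \<and> P f a c = colored_mult (th ! c) G
              F"
          by (intro bexI conjI) (assumption | rule word_product_carrier)+
        then show ?thesis using c cl[OF False] by simp
      qed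
    qed (use zero in auto)
    \<comment> \<open>A variable is put in the place of each path of the block, while the other
      paths keep their products. \<open>H\<close> multiplies along a component and
      \<open>\<Phi>\<close> evaluates the test form on the results.\<close>
    define val where "val f \<alpha> X r = (case map_of (zip bs X) r of Some F \<Rightarrow> F
        | None \<Rightarrow> word_product (th ! component (hd (fst r))) \<alpha> (word (f r)))"
      for f :: "arc list \<times> arc list \<Rightarrow> arc list" and \<alpha> X r
    define H where "H f \<alpha> X c = foldr (colored_mult (th ! c)) (map (val f \<alpha> X) (ss c)) heis_one" for
      f \<alpha> X c
    define \<Phi> where "\<Phi> f \<alpha> X = \<Lambda> (map (H f \<alpha> X) [0..<n])" for f \<alpha> X
    define W where "W f \<beta> = path_products th f \<beta> bs"
      for f :: "arc list \<times> arc list \<Rightarrow> arc list" and \<beta>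
    have ne: "[] \<notin> set (map fst (outs @ bs))" and dist: "distinct (concat (map fst (outs @ bs)))"
      and arcsZ: "set (concat (map fst (outs @ bs))) = arcs Z"
    proof -
      have "\<forall>(p, p')\<in>set (outs @ bs). p \<noteq> []"
        using m unfolding matched_def is_path_def by blast
      then show "[] \<notin> set (map fst (outs @ bs))" by fastforce
    qed (use m in \<open>simp_all only: matched_def\<close>)
    have dist_rs: "distinct (outs @ bs)"
      using distinct_concat_distinct[OF dist ne] unfolding distinct_map by (rule conjunct1)
    have dist_bs: "distinct bs" and outs_bs: "set outs \<inter> set bs = {}" using dist_rs by auto
    have val_Some: "val f \<alpha> X (bs ! i) = X ! i" if "i < length bs" "length X = length bs" for f \<alpha> X
        i
      using that dist_bs by (simp add: val_def map_of_zip_nth)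
    have val_None: "val f \<alpha> X r = word_product (th ! component (hd (fst r))) \<alpha> (word (f r))"
      if "r \<notin> set bs" "length X = length bs" for f \<alpha> X r
    proof -
      have "map_of (zip bs X) r = None" using that by (simp add: map_of_zip_is_None)
      then show ?thesis by (simp add: val_def)
    qed
    have PH: "P f (\<lambda>q. if q \<in> A f then \<alpha> q else \<beta> q) c = H f \<alpha> (W f \<beta>) c"
      if c: "c < n" and dj: "A f \<inter> B f = {}" for f \<alpha> \<beta> c
    proof -
      let ?a = "\<lambda>q. if q \<in> A f then \<alpha> q else \<beta> q"
      have "word_product (th ! c) ?a (word (f r)) = val f \<alpha> (W f \<beta>) r" if r: "r \<in> set (ss c)" for r
      proof (cases "r \<in> set bs")
        case True
        then obtain i where i: "i < length bs" "bs ! i = r" by (auto simp: in_set_conv_nth)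
        have "crossing_points (word (f r)) \<subseteq> B f"
          unfolding B_def by (rule crossing_points_mono) (use True in auto)
        then have "word_product (th ! c) ?a (word (f r)) = word_product (th ! c) \<beta> (word (f r))"
          by (intro word_product_cong) (use dj in auto)
        also have "\<dots> = W f \<beta> ! i" using ss(2)[OF c] r i by (simp add: W_def)
        also have "\<dots> = val f \<alpha> (W f \<beta>) r" using val_Some[of i "W f \<beta>" f \<alpha>] i by (simp add: W_def)
        finally show ?thesis .
      next
        case False
        then have "r \<in> set outs" using ss(2)[OF c] r by auto
        then have "crossing_points (word (f r)) \<subseteq> A f"
          unfolding A_def by (intro crossing_points_mono) auto
        then have "word_product (th ! c) ?a (word (f r)) = word_product (th ! c) \<alpha> (word (f r))"
          by (intro word_product_cong) auto
        then show ?thesis using val_None[OF False, of "W f \<beta>" f \<alpha>] ss(2)[OF c] r by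
          (simp add: W_def)
      qed
      then show ?thesis by (simp add: P_def word_product_concat H_def comp_def cong: map_cong)
    qed
    have LS: "L (?S Y) = (\<Sum>\<alpha>\<in>A f \<rightarrow>\<^sub>E Basis. \<Sum>\<beta>\<in>B f \<rightarrow>\<^sub>E Basis. \<Phi> f \<alpha> (W f \<beta>))"
      if Y: "thick Y = th" "inj_on head (arcs Y)" "\<And>c. c < n \<Longrightarrow> is_reading Y c
        (concat (map f (ss c)))"
        "\<And>c. closed_component Z c = closed_component Y c" "crossings Y = A f \<union> B f" "A f \<inter> B f = {}"
          for Y f
    proof -
      have "L (?S Y) = (\<Sum>a\<in>crossings Y \<rightarrow>\<^sub>E Basis. \<Lambda> (map (P f a) [0..<n]))"
        using rotate[OF Y(1-4)] by (simp add: L.sum \<Lambda>_def)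
      also have "\<dots> = (\<Sum>\<alpha>\<in>A f \<rightarrow>\<^sub>E Basis. \<Sum>\<beta>\<in>B f \<rightarrow>\<^sub>E Basis. \<Lambda>
          (map (P f (\<lambda>q. if q \<in> A f then \<alpha> q else \<beta> q)) [0..<n]))"
        unfolding Y(5) by (rule sum_PiE_Un[OF Y(6)])
      also have "\<dots> = (\<Sum>\<alpha>\<in>A f \<rightarrow>\<^sub>E Basis. \<Sum>\<beta>\<in>B f \<rightarrow>\<^sub>E Basis. \<Phi> f \<alpha> (W f \<beta>))"
      proof -
        have "map (P f (\<lambda>q. if q \<in> A f then \<alpha> q else \<beta> q)) [0..<n] = map (H f \<alpha> (W f \<beta>)) [0..<n]"
            for \<alpha> \<beta>
          by (rule map_cong[OF refl]) (rule PH[OF _ Y(6)], simp)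
        then show ?thesis by (simp only: \<Phi>_def)
      qed
      finally show ?thesis .
    qed
    have carrier_val: "val f \<alpha> X r \<in> heis_carrier" if "set X \<subseteq> heis_carrier" for f \<alpha> X r
      using that map_of_SomeD[of "zip bs X" r] word_product_carrier
      by (auto simp: val_def split: option.splits dest!: set_zip_rightD)
    have \<Phi>_multilin_form: "multilin_form (length bs) (\<Phi> f \<alpha>)" for f \<alpha>
      unfolding multilin_form_def
    proof (intro allI impI)
      fix X i assume X: "length X = length bs" "set X \<subseteq> heis_carrier" and i: "i < length bs"
      define c where "c = component (hd (fst (bs ! i)))"
      have bi: "bs ! i \<in> set bs" using i by simp
      have "hd (fst (bs ! i)) \<in> arcs Z"
      proof -
        have "fst (bs ! i) \<noteq> []" using ne bi by (metis UnCI image_eqI set_append set_map)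
        then show ?thesis unfolding arcsZ[symmetric] using bi by (auto intro!: bexI[of _ "bs ! i"])
      qed
      then have c: "c < n" using Z(3) by (auto simp: c_def n_def)
      then have "bs ! i \<in> set (ss c)" using bi by (simp add: ss(2) c_def)
      \<comment> \<open>The chosen path occurs once, and in the component \<open>c\<close> only, so
        its variable enters linearly between the fixed factors \<open>F1\<close> and
        \<open>F2\<close>.\<close>
      then obtain l1 l2 where l: "ss c = l1 @ bs ! i # l2" by (auto dest: split_list)
      then have l12: "bs ! i \<notin> set l1" "bs ! i \<notin> set l2" using ss(1)[OF c] by auto
      have other: "val f \<alpha> (X[i := F]) r = val f \<alpha> X r" if "r \<noteq> bs ! i" for F r
      proof (cases "r \<in> set bs")
        case True
        then obtain j where j: "j < length bs" "bs ! j = r" by (auto simp: in_set_conv_nth)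
        then have "j \<noteq> i" using that by auto
        then show ?thesis using val_Some[of j "X[i := F]" f \<alpha>] val_Some[of j X f \<alpha>] j X by simp
      next
        case False
        then show ?thesis using X by (simp add: val_None)
      qed
      define F1 where "F1 = foldr (colored_mult (th ! c)) (map (val f \<alpha> X) l1) heis_one"
      define F2 where "F2 = foldr (colored_mult (th ! c)) (map (val f \<alpha> X) l2) heis_one"
      have F12: "F1 \<in> heis_carrier" "F2 \<in> heis_carrier"
        unfolding F1_def F2_def by (rule foldr_colored_mult_carrier; use carrier_val[OF X(2)] in
          auto)+
      have Hc: "H f \<alpha> (X[i := F]) c = colored_mult (th ! c) F1 (colored_mult (th ! c) F F2)" if F:
          "F \<in> heis_carrier" for F
      proof -
        have "map (val f \<alpha> (X[i := F])) (ss c) = map (val f \<alpha> X) l1 @ F # map (val f \<alpha> X) l2"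
        proof -
          have "map (val f \<alpha> (X[i := F])) l1 = map (val f \<alpha> X) l1"
              "map (val f \<alpha> (X[i := F])) l2 = map (val f \<alpha> X) l2"
            using l12 by (metis other map_cong)+
          then show ?thesis using l val_Some[of i "X[i := F]" f \<alpha>] X i by simp
        qed
        moreover have "foldr (colored_mult (th ! c)) (map (val f \<alpha> X) l1 @ (F # map (val f \<alpha> X) l2))
          heis_one
          = colored_mult (th ! c) F1 (colored_mult (th ! c) F F2)"
          by (subst foldr_colored_mult_append) (use carrier_val[OF X(2)] F in
            \<open>auto simp: F1_def F2_def\<close>)
        ultimately show ?thesis by (simp add: H_def)
      qed
      have Ho: "H f \<alpha> (X[i := F]) c' = H f \<alpha> X c'" if "c' < n" "c' \<noteq> c" for c' F
      proof -
        have "bs ! i \<notin> set (ss c')" using that by (simp add: ss(2) c_def)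
        then have "map (val f \<alpha> (X[i := F])) (ss c') = map (val f \<alpha> X) (ss c')"
          by (metis other map_cong)
        then show ?thesis by (simp only: H_def)
      qed
      have list: "map (H f \<alpha> (X[i := F])) [0..<n] = (map (H f \<alpha> X) [0..<n])[c := colored_mult
          (th ! c) F1 (colored_mult (th ! c) F F2)]"
        if "F \<in> heis_carrier" for F
        using c Hc[OF that] Ho by (intro nth_equalityI) (auto simp: nth_list_update)
      have "heis_lin_form (\<lambda>Y. \<Lambda> ((map (H f \<alpha> X) [0..<n])[c := Y]))"
      proof -
        have "H f \<alpha> X c' \<in> heis_carrier" for c'
          unfolding H_def by (rule foldr_colored_mult_carrier) (use carrier_val[OF X(2)] in auto)
        then have "set (map (H f \<alpha> X) [0..<n]) \<subseteq> heis_carrier" by auto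
        moreover have "length (map (H f \<alpha> X) [0..<n]) = n" by simp
        ultimately show ?thesis using \<Lambda> c unfolding multilin_form_def by blast
      qed
      then have "heis_lin_form (\<lambda>F. \<Lambda> ((map (H f \<alpha> X) [0..<n])[c := colored_mult (th ! c) F1
        (colored_mult (th ! c) F F2)]))"
        using heis_lin_form_mult_left[OF heis_lin_form_mult_right[of _ F1], of _ F2]
          heis_lin_form_mult_right[OF heis_lin_form_mult_left[of _ F1], of _ F2] F12
        by (cases "th ! c") (simp_all add: colored_mult_def)
      then show "heis_lin_form (\<lambda>F. \<Phi> f \<alpha> (X[i := F]))"
        unfolding heis_lin_form_def \<Phi>_def by (simp add: list heis_carrier_plus
          heis_carrier_heis_scale)
    qed
    have A': "A snd = \<rho> ` A fst"
    proof -
      have "concat (map (\<lambda>r. word (snd r)) outs) = map (rename_passage \<rho>)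
          (concat (map (\<lambda>r. word (fst r)) outs))"
        using ren by (auto simp: map_concat comp_def intro!: arg_cong[of _ _ concat] map_cong)
      then show ?thesis by (simp add: A_def crossing_points_rename)
    qed
    \<comment> \<open>Outside the block the second diagram has the words of the first up to
      \<open>\<rho>\<close>, so its outside labellings are pulled back along
      \<open>\<rho>\<close>.\<close>
    have \<Phi>_rename: "\<Phi> snd \<alpha> X = \<Phi> fst (restrict (\<alpha> \<circ> \<rho>) (A fst)) X" if X: "length X = length bs" for
        \<alpha> X
    proof -
      have "val snd \<alpha> X r = val fst (restrict (\<alpha> \<circ> \<rho>) (A fst)) X r" if r: "r \<in> set (outs @ bs)" for
          r
      proof (cases "r \<in> set bs")
        case True
        then obtain j where j: "j < length bs" "bs ! j = r" by (auto simp: in_set_conv_nth)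
        then show ?thesis using val_Some[OF j(1) X] by simp
      next
        case False
        then have r': "r \<in> set outs" using r by simp
        then have "crossing_points (word (fst r)) \<subseteq> A fst"
          unfolding A_def by (intro crossing_points_mono) auto
        then have "word_product t (restrict (\<alpha> \<circ> \<rho>) (A fst)) (word (fst r)) = word_product t (\<alpha> \<circ> \<rho>)
          (word (fst r))" for t
          by (intro word_product_cong) auto
        moreover have "word (snd r) = map (rename_passage \<rho>) (word (fst r))" using
          ren[of "fst r" "snd r"] r' by simp
        ultimately show ?thesis using False X by (simp add: val_None word_product_rename)
      qed
      then have "H snd \<alpha> X c = H fst (restrict (\<alpha> \<circ> \<rho>) (A fst)) X c" if "c < n" for c
        unfolding H_def using ss(2)[OF that] by (intro arg_cong[of _ _ "\<lambda>l. foldr _ l _"] map_cong)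
          auto
      then show ?thesis unfolding \<Phi>_def by (intro arg_cong[of _ _ \<Lambda>] map_cong) auto
    qed
    have lenW: "length (W f \<beta>) = length bs" for f \<beta> by (simp add: W_def)
    have "L (?S Z) = (\<Sum>\<alpha>\<in>A fst \<rightarrow>\<^sub>E Basis. \<Sum>\<beta>\<in>B fst \<rightarrow>\<^sub>E Basis. \<Phi> fst \<alpha> (W fst \<beta>))"
      using LS[OF th(1) Z(1) ss(3) refl Z(5) disj(1)] by simp
    also have "\<dots> = (\<Sum>\<alpha>\<in>A fst \<rightarrow>\<^sub>E Basis. \<Sum>\<beta>\<in>B snd \<rightarrow>\<^sub>E Basis. \<Phi> fst \<alpha> (W snd \<beta>))"
      unfolding W_def by (intro sum.cong refl block \<Phi>_multilin_form)
    also have "\<dots> = (\<Sum>\<alpha>\<in>A snd \<rightarrow>\<^sub>E Basis. \<Sum>\<beta>\<in>B snd \<rightarrow>\<^sub>E Basis. \<Phi> snd \<alpha> (W snd \<beta>))"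
      unfolding A' by (rule sum_PiE_rename[OF \<rho>, symmetric]) (simp add: \<Phi>_rename[OF lenW])
    also have "\<dots> = L (?S Z')"
      using LS[OF th(2) Z'(1) ss(4) closed Z'(4) disj(2)] by simp
    finally show "L (?S Z) = L (?S Z')" .
  qed
  then show ?thesis
    unfolding J'_def th n_def using closed by simp
qed

end

section \<open>Arcs of a diagram\<close>

text \<open>A list instead of a set, so that equality of multisets also transfers distinctness of
  the arcs. The offset \<open>i\<close> is the number of vertical strands to the left of a
  block.\<close>

fun rows_arcs :: "nat \<Rightarrow> nat \<Rightarrow> row list \<Rightarrow> arc list" where
  "rows_arcs r i [] = []"
| "rows_arcs r i (R # Rs) = row_arcs r i i R @ rows_arcs (Suc r) i Rs"

lemma set_rows_arcs: "set (rows_arcs r i Rs) = (\<Union>k<length Rs. set (row_arcs (r + k) i i (Rs ! k)))"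
proof (induction Rs arbitrary: r)
  case (Cons R Rs)
  then show ?case by (simp add: lessThan_Suc_eq_insert_0)
qed simp

lemma arcs_eq: "arcs Z = set (rows_arcs 0 0 (rows Z))"
  by (simp add: arcs_def set_rows_arcs)

lemma rows_arcs_append: "rows_arcs r i (A @ B) = rows_arcs r i A @ rows_arcs (r + length A) i B"
  by (induction A arbitrary: r) simp_all

lemma row_top_simps [simp]:
  "row_top [] = []" "row_top (p # R) = piece_top p @ row_top R"
    "row_top (R @ R') = row_top R @ row_top R'"
  "row_bot [] = []" "row_bot (p # R) = piece_bot p @ row_bot R"
    "row_bot (R @ R') = row_bot R @ row_bot R'"
  by (simp_all add: row_top_def row_bot_def)

lemma row_Strands [simp]: "row_top (map Strand es) = es" "row_bot (map Strand es) = es"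
  by (induction es) simp_all

lemma row_arcs_append:
  "row_arcs r i j (A @ B) = row_arcs r i j A @ row_arcs r (i + length (row_top A))
    (j + length (row_bot A)) B"
  by (induction A arbitrary: i j) (simp_all add: add.assoc)

section \<open>Heads and tails of the arcs of a diagram are distinct\<close>

fun oriented_points :: "nat \<Rightarrow> nat \<Rightarrow> edge list \<Rightarrow> orient \<Rightarrow> point list" where
  "oriented_points r i [] d = []"
| "oriented_points r i (e # es) d = (if snd e = d then [(r, i)] else []) @ oriented_points r (Suc i)
  es d"

lemma oriented_points_append:
  "oriented_points r i (xs @ ys) d = oriented_points r i xs d @ oriented_points r (i + length xs) ys
    d"
  by (induction xs arbitrary: i) simp_all

lemma oriented_points_bounds: "q \<in> set (oriented_points r i es d) \<Longrightarrow> fst q = r \<and> i \<le> snd q"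
  by (induction es arbitrary: i) (auto split: if_splits dest: Suc_leD)

lemma oriented_points_disjoint:
  "set (oriented_points r i es Up) \<inter> set (oriented_points r i es Down) = {}"
proof (induction es arbitrary: i)
  case (Cons e es)
  then show ?case using oriented_points_bounds[of "(r, i)" r "Suc i" es] by (auto split: if_splits)
qed simp

lemma distinct_oriented_points: "distinct (oriented_points r i es d)"
proof (induction es arbitrary: i)
  case (Cons e es)
  then show ?case using oriented_points_bounds[of "(r, i)" r "Suc i" es d] by auto
qed simp

lemma not_Up: "u \<noteq> Up \<longleftrightarrow> u = Down"
  by (cases u) simp_all

text \<open>A downward edge leaves the line above a row and arrives at the line below, an upward
  edge the reverse; the legs of a bend follow the same rule on a single line.\<close>

lemma mset_row_ends:
  "mset (map tail (row_arcs r i j R)) =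
     mset (oriented_points r i (row_top R) Down) + mset (oriented_points (Suc r) j (row_bot R) Up)"
  "mset (map head (row_arcs r i j R)) =
     mset (oriented_points r i (row_top R) Up) + mset (oriented_points (Suc r) j (row_bot R) Down)"
proof (induction R arbitrary: i j)
  case (Cons p R)
  {
    case 1
    then show ?case using Cons(1)
      by (cases p) (auto simp: strand_arc_def bend_arc_def oriented_points_append not_Up split:
        orient.splits direction.splits)
  next
    case 2
    then show ?case using Cons(2)
      by (cases p) (auto simp: strand_arc_def bend_arc_def oriented_points_append not_Up split:
        orient.splits direction.splits)
  }
qed simp_all

text \<open>Adjacent rows have the same oriented edges on their common line, so a point there is a
  tail for only one of the two rows, and a head for only the other. For the induction the statement
  also records which points of the first line occur.\<close>

lemma distinct_rows_ends:
  assumes "successively (\<lambda>R R'. row_bot R = row_top R') Rs" "Rs \<noteq> []"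
  shows "distinct (map tail (rows_arcs r i Rs)) \<and>
      (\<forall>q\<in>tail ` set (rows_arcs r i Rs). r \<le> fst q \<and> (fst q = r \<longrightarrow> q \<in> set
        (oriented_points r i (row_top (hd Rs)) Down)))"
    (is "?T r Rs")
    and "distinct (map head (rows_arcs r i Rs)) \<and>
      (\<forall>q\<in>head ` set (rows_arcs r i Rs). r \<le> fst q \<and> (fst q = r \<longrightarrow> q \<in> set
        (oriented_points r i (row_top (hd Rs)) Up)))"
    (is "?H r Rs")
proof -
  have step: "distinct (map f (rows_arcs r i Rs)) \<and>
      (\<forall>q\<in>f ` set (rows_arcs r i Rs). r \<le> fst q \<and> (fst q = r \<longrightarrow> q \<in> set
        (oriented_points r i (row_top (hd Rs)) d)))"
    if f: "\<And>r i j R. mset (map f (row_arcs r i j R)) =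
     mset (oriented_points r i (row_top R) d) + mset (oriented_points (Suc r) j (row_bot R) d')"
     and d: "\<And>r i es. set (oriented_points r i es d) \<inter> set (oriented_points r i es d') = {}"
    for f :: "arc \<Rightarrow> point" and d d'
    using assms
  proof (induction Rs arbitrary: r)
    case (Cons R Rs)
    have m: "mset (map f (row_arcs r i i R)) = mset (oriented_points r i (row_top R) d @
        oriented_points (Suc r) i (row_bot R) d')"
      by (simp only: f mset_append)
    have "distinct (oriented_points r i (row_top R) d @ oriented_points (Suc r) i (row_bot R) d')"
    proof -
      have False if "q \<in> set (oriented_points r i (row_top R) d)"
          "q \<in> set (oriented_points (Suc r) i (row_bot R) d')" for q
        using oriented_points_bounds[OF that(1)] oriented_points_bounds[OF that(2)] by simp
      then show ?thesis by (auto simp: distinct_oriented_points)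
    qed
    then have dR: "distinct (map f (row_arcs r i i R))"
      using m mset_eq_imp_distinct_iff by blast
    have sR: "f ` set (row_arcs r i i R) = set (oriented_points r i (row_top R) d) \<union> set
        (oriented_points (Suc r) i (row_bot R) d')"
      using mset_eq_setD[OF m] by simp
    show ?case
    proof (cases "Rs = []")
      case True
      have "r \<le> fst q \<and> (fst q = r \<longrightarrow> q \<in> set (oriented_points r i (row_top R) d))"
        if "q \<in> f ` set (row_arcs r i i R)" for q
        using that oriented_points_bounds[of q r i _ d] oriented_points_bounds[of q "Suc r" i _ d']
          unfolding sR by fastforce
      then show ?thesis using True dR by simp
    next
      case False
      then have s: "successively (\<lambda>R R'. row_bot R = row_top R') Rs" "row_bot R = row_top (hd Rs)"
        using Cons.prems by (auto simp: successively_Cons)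
      note IH = Cons.IH[OF s(1) False, of "Suc r"]
      have "f ` set (row_arcs r i i R) \<inter> f ` set (rows_arcs (Suc r) i Rs) = {}"
      proof (rule equals0I)
        fix q assume q: "q \<in> f ` set (row_arcs r i i R) \<inter> f ` set (rows_arcs (Suc r) i Rs)"
        then have 1: "Suc r \<le> fst q" "fst q = Suc r \<longrightarrow> q \<in> set
          (oriented_points (Suc r) i (row_top (hd Rs)) d)"
          using IH by blast+
        then have "q \<in> set (oriented_points (Suc r) i (row_bot R) d')"
          using q oriented_points_bounds[of q r i "row_top R" d] unfolding sR by auto
        then show False
          using 1 oriented_points_bounds[of q "Suc r"] d[of "Suc r" i "row_bot R"] s(2) by auto
      qed
      then have D: "distinct (map f (rows_arcs r i (R # Rs)))" using dR IH by simp
      have "r \<le> fst q \<and> (fst q = r \<longrightarrow> q \<in> set (oriented_points r i (row_top R) d))"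
        if "q \<in> f ` set (row_arcs r i i R) \<union> f ` set (rows_arcs (Suc r) i Rs)" for q
        using that
      proof
        assume "q \<in> f ` set (row_arcs r i i R)"
        then show ?thesis
          using oriented_points_bounds[of q r i _ d] oriented_points_bounds[of q "Suc r" i _ d']
            unfolding sR by fastforce
      next
        assume "q \<in> f ` set (rows_arcs (Suc r) i Rs)"
        then show ?thesis using IH by fastforce
      qed
      then show ?thesis using D by (auto simp del: map_append simp: image_Un)
    qed
  qed simp
  show "?T r Rs"
    by (rule step[OF mset_row_ends(1)]) (use oriented_points_disjoint in blast)
  show "?H r Rs"
    by (rule step[OF mset_row_ends(2)]) (use oriented_points_disjoint in blast)
qed

lemma
  assumes "colored_diagram Z"
  shows distinct_heads: "distinct (map head (rows_arcs 0 0 (rows Z)))"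
    and distinct_tails: "distinct (map tail (rows_arcs 0 0 (rows Z)))"
  using assms distinct_rows_ends[of "rows Z"] by (auto simp: colored_diagram_def)

lemma inj_heads: "colored_diagram Z \<Longrightarrow> inj_on head (arcs Z)"
  and inj_tails: "colored_diagram Z \<Longrightarrow> inj_on tail (arcs Z)"
  using distinct_heads distinct_tails by (simp_all add: arcs_eq distinct_map)

lemma distinct_rows_arcs: "colored_diagram Z \<Longrightarrow> distinct (rows_arcs 0 0 (rows Z))"
  using distinct_heads by (simp add: distinct_map)

definition rename_arc :: "(point \<Rightarrow> point) \<Rightarrow> arc \<Rightarrow> arc" where
  "rename_arc g x = \<lparr>tail = g (tail x), head = g (head x), component = component x,
     passage = rename_passage g (passage x)\<rparr>"

lemma row_arcs_rename:
  assumes "\<And>l. g (r, l) = (r', l)" "\<And>l. g (Suc r, l) = (Suc r', l)"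
  shows "row_arcs r' i j R = map (rename_arc g) (row_arcs r i j R)"
proof (induction R arbitrary: i j)
  case (Cons p R)
  then show ?case
    by (cases p) (simp_all add: rename_arc_def strand_arc_def bend_arc_def assms)
qed simp

lemma rows_arcs_rename:
  assumes "\<And>k l. k \<le> length Rs \<Longrightarrow> g (r + k, l) = (r' + k, l)"
  shows "rows_arcs r' i Rs = map (rename_arc g) (rows_arcs r i Rs)"
  using assms
proof (induction Rs arbitrary: r r')
  case (Cons R Rs)
  have "row_arcs r' i i R = map (rename_arc g) (row_arcs r i i R)"
    by (rule row_arcs_rename) (use Cons.prems[of 0] Cons.prems[of 1] in auto)
  moreover have "rows_arcs (Suc r') i Rs = map (rename_arc g) (rows_arcs (Suc r) i Rs)"
    by (rule Cons.IH) (use Cons.prems[of "Suc _"] in auto)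
  ultimately show ?case by simp
qed simp

lemma row_arcs_bounds:
  assumes "x \<in> set (row_arcs r i j R)"
  shows "fst (tail x) \<in> {r, Suc r}" "fst (head x) \<in> {r, Suc r}"
    and "passage x = Under q s u \<or> passage x = Over q s u \<Longrightarrow> fst q = r"
proof -
  have piece: "(fst (tail x) = r \<or> fst (tail x) = Suc r) \<and> (fst (head x) = r \<or> fst (head x) = Suc r)
      \<and>
    (passage x = Under q s u \<or> passage x = Over q s u \<longrightarrow> fst q = r)"
    if "x \<in> set (piece_arcs r i j p)" for i j p
    using that by (cases p) (auto simp: strand_arc_def bend_arc_def split: if_splits)
  have "(fst (tail x) = r \<or> fst (tail x) = Suc r) \<and> (fst (head x) = r \<or> fst (head x) = Suc r) \<and>
    (passage x = Under q s u \<or> passage x = Over q s u \<longrightarrow> fst q = r)"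
    using assms
  proof (induction R arbitrary: i j)
    case (Cons p R)
    show ?case
    proof (cases "x \<in> set (piece_arcs r i j p)")
      case False
      then show ?thesis using Cons.prems by (intro Cons.IH) auto
    qed (rule piece)
  qed simp
  then show "fst (tail x) \<in> {r, Suc r}" "fst (head x) \<in> {r, Suc r}"
    "passage x = Under q s u \<or> passage x = Over q s u \<Longrightarrow> fst q = r" by simp_all
qed

lemma rows_arcs_bounds:
  assumes "x \<in> set (rows_arcs r i Rs)"
  shows "fst (tail x) \<in> {r..r + length Rs}" "fst (head x) \<in> {r..r + length Rs}"
    and "passage x = Under q s u \<or> passage x = Over q s u \<Longrightarrow> fst q \<in> {r..<r + length Rs}"
proof -
  obtain k where k: "k < length Rs" "x \<in> set (row_arcs (r + k) i i (Rs ! k))"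
    using assms by (auto simp: set_rows_arcs)
  show "fst (tail x) \<in> {r..r + length Rs}" "fst (head x) \<in> {r..r + length Rs}"
    "passage x = Under q s u \<or> passage x = Over q s u \<Longrightarrow> fst q \<in> {r..<r + length Rs}"
    using row_arcs_bounds[OF k(2)] k(1) by fastforce+
qed

definition arc_crossings :: "arc set \<Rightarrow> point set" where
  "arc_crossings X = {q. \<exists>x\<in>X. \<exists>s u. passage x = Under q s u \<or> passage x = Over q s u}"

text \<open>Every crossing has an under-passage and an over-passage of the same name, so looking at
  under-passages alone loses nothing.\<close>

lemma crossings_eq: "crossings Z = arc_crossings (arcs Z)"
proof -
  have "(\<exists>x\<in>set (row_arcs r i j R). \<exists>s u. passage x = Under q s u) \<longleftrightarrow>
      (\<exists>x\<in>set (row_arcs r i j R). \<exists>s u. passage x = Over q s u)" for r i j R q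
  proof (induction R arbitrary: i j)
    case (Cons p R)
    have "(\<exists>x\<in>set (piece_arcs r i j p). \<exists>s u. passage x = Under q s u) \<longleftrightarrow>
      (\<exists>x\<in>set (piece_arcs r i j p). \<exists>s u. passage x = Over q s u)"
      by (cases p) (auto simp: strand_arc_def bend_arc_def)
    with Cons show ?case by (simp add: bex_Un)
  qed simp
  then have *: "(\<exists>x\<in>arcs Z. \<exists>s u. passage x = Under q s u) \<longleftrightarrow>
    (\<exists>x\<in>arcs Z. \<exists>s u. passage x = Over q s u)" for q
    unfolding arcs_def bex_UN by (simp only:)
  show ?thesis
    unfolding crossings_def arc_crossings_def by (simp only: ex_disj_distrib bex_disj_distrib *
      disj_absorb)
qed

text \<open>A vertical strand beside a block; \<open>ws\<close> lists its columns line by line,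
  because strands to the right of the block shift with its width.\<close>

fun vertical_arcs :: "nat \<Rightarrow> nat list \<Rightarrow> edge \<Rightarrow> arc list" where
  "vertical_arcs r (w # w' # ws) e =
     strand_arc (r, w) (Suc r, w') e Plain # vertical_arcs (Suc r) (w' # ws) e"
| "vertical_arcs r _ e = []"

fun columns :: "nat \<Rightarrow> nat list \<Rightarrow> edge list \<Rightarrow> arc list list" where
  "columns r ws [] = []"
| "columns r ws (e # es) = rev_if (snd e = Down) (vertical_arcs r ws e) # columns r (map Suc ws) es"

lemma length_columns [simp]: "length (columns r ws es) = length es"
  by (induction es arbitrary: ws) simp_all

lemma word_vertical: "word (rev_if f (vertical_arcs r ws e)) = []"
proof -
  have "\<forall>x\<in>set (vertical_arcs r ws e). passage x = Plain"
    by (induction r ws e rule: vertical_arcs.induct) (auto simp: strand_arc_def)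
  then show ?thesis by (auto simp: word_def filter_empty_conv)
qed

lemma is_path_vertical:
  assumes "length ws \<ge> 2"
  shows "is_path (rev_if (snd e = Down) (vertical_arcs r ws e))
    (if snd e = Down then (r + length ws - 1, last ws) else (r, hd ws))
    (if snd e = Down then (r, hd ws) else (r + length ws - 1, last ws)) (fst e)"
  using assms
proof (induction r ws e rule: vertical_arcs.induct)
  case (1 r w w' ws e)
  show ?case
  proof (cases "ws = []")
    case True
    then show ?thesis by (auto simp: is_path_def rev_if_def strand_arc_def)
  next
    case False
    then have IH: "is_path (rev_if (snd e = Down) (vertical_arcs (Suc r) (w' # ws) e))
    (if snd e = Down then (Suc r + length ws, last ws) else (Suc r, w'))
    (if snd e = Down then (Suc r, w') else (Suc r + length ws, last ws)) (fst e)"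
      using 1 by (cases ws) auto
    have ne: "vertical_arcs (Suc r) (w' # ws) e \<noteq> []" using False by (cases ws) auto
    show ?thesis using IH ne False
      by (auto simp: is_path_def rev_if_def strand_arc_def successively_append_iff hd_rev last_rev
          successively_Cons split: if_splits)
  qed
qed auto

lemma mset_columns_step:
  "mset (concat (columns r (w # w' # ws) es)) =
     mset (row_arcs r w w' (map Strand es)) + mset (concat (columns (Suc r) (w' # ws) es))"
  by (induction es arbitrary: w w' ws) simp_all

lemma columns_singleton [simp]: "concat (columns r [w] es) = []"
  by (induction es arbitrary: w) (simp_all add: rev_if_def)

text \<open>The columns, line by line, of the first strand to the right of a block whose left edge
  is at column \<open>w\<close>.\<close>

fun widths :: "nat \<Rightarrow> row list \<Rightarrow> nat list" where
  "widths w [] = []"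
| "widths w [R] = [w + length (row_top R), w + length (row_bot R)]"
| "widths w (R # R' # Rs) = (w + length (row_top R)) # widths w (R' # Rs)"

lemma length_widths: "Rs \<noteq> [] \<Longrightarrow> length (widths w Rs) = Suc (length Rs)"
  by (induction w Rs rule: widths.induct) simp_all

lemma hd_widths: "Rs \<noteq> [] \<Longrightarrow> hd (widths w Rs) = w + length (row_top (hd Rs))"
  by (induction w Rs rule: widths.induct) simp_all

lemma last_widths: "Rs \<noteq> [] \<Longrightarrow> last (widths w Rs) = w + length (row_bot (last Rs))"
proof (induction w Rs rule: widths.induct)
  case (3 w R R' Rs)
  have "widths w (R' # Rs) \<noteq> []" using length_widths[of "R' # Rs" w] by auto
  then show ?case using 3 by simp
qed simp_all

text \<open>The arcs beside the block are regrouped from rows into strands. This changes their order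
  in the list, hence multisets.\<close>

lemma mset_rows_arcs_between:
  assumes "successively (\<lambda>R R'. row_bot R = row_top R') B" "B \<noteq> []"
  shows "mset (rows_arcs r 0 (map (\<lambda>R. map Strand u @ R @ map Strand v) B)) =
    mset (concat (columns r (replicate (Suc (length B)) 0) u)) + mset (rows_arcs r (length u) B) +
    mset (concat (columns r (widths (length u) B) v))"
  using assms
proof (induction B arbitrary: r)
  case (Cons R B)
  have row: "mset (row_arcs r 0 0 (map Strand u @ R @ map Strand v)) =
      mset (row_arcs r 0 0 (map Strand u)) + mset (row_arcs r (length u) (length u) R) +
      mset (row_arcs r (length u + length (row_top R)) (length u + length (row_bot R))
        (map Strand v))"
    by (simp add: row_arcs_append)
  show ?case
  proof (cases B)
    case Nil
    then show ?thesis using row by (simp add: mset_columns_step)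
  next
    case (Cons R' B')
    have m: "row_bot R = row_top R'" "successively (\<lambda>R R'. row_bot R = row_top R') B"
      using Cons.prems Cons by auto
    obtain ws where ws: "widths (length u) (R' # B') = (length u + length (row_bot R)) # ws"
      using hd_widths[of "R' # B'" "length u"] length_widths[of "R' # B'" "length u"] m(1)
      by (cases "widths (length u) (R' # B')") auto
    show ?thesis
      using Cons.IH[OF m(2), of "Suc r"] row Cons
      by (simp add: ws mset_columns_step)
  qed
qed simp

lemma arc_crossings_Un: "arc_crossings (X \<union> Y) = arc_crossings X \<union> arc_crossings Y"
  by (auto simp: arc_crossings_def)

lemma crossing_points_passages: "crossing_points (map passage xs) = arc_crossings (set xs)"
proof (rule set_eqI)
  fix q
  have "q \<in> crossing_points (map passage xs) \<longleftrightarrow> (\<exists>s u. (\<exists>x\<in>set xs. Under q s u = passage x) \<or>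
      (\<exists>x\<in>set xs. Over q s u = passage x))"
    by (simp only: crossing_points_def mem_Collect_eq set_map image_iff)
  also have "\<dots> \<longleftrightarrow> q \<in> arc_crossings (set xs)"
    unfolding arc_crossings_def mem_Collect_eq
    by (intro iffI; elim exE disjE bexE) (blast dest: sym)+
  finally show "q \<in> crossing_points (map passage xs) \<longleftrightarrow> q \<in> arc_crossings (set xs)" .
qed

abbreviation path_crossings :: "(arc list \<times> arc list \<Rightarrow> arc list) \<Rightarrow> (arc list \<times> arc list) list \<Rightarrow>
  point set" where
  "path_crossings f rs \<equiv> arc_crossings (set (concat (map f rs)))"

lemma crossing_points_words:
  "crossing_points (concat (map (\<lambda>r. word (f r)) l)) = path_crossings f l"
proof -
  have "concat (map (\<lambda>r. word (f r)) l) = filter (\<lambda>x. x \<noteq> Plain) (map passage (concat (map f l)))"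
    by (simp add: word_def filter_concat map_concat comp_def)
  moreover have "crossing_points (filter (\<lambda>x. x \<noteq> Plain) ps) = crossing_points ps" for ps
    by (auto simp: crossing_points_def)
  ultimately show ?thesis by (simp only: crossing_points_passages)
qed

lemma arc_crossings_rows: "q \<in> arc_crossings (set (rows_arcs r i Rs)) \<Longrightarrow> fst q \<in> {r..<r + length Rs}"
  using rows_arcs_bounds(3) unfolding arc_crossings_def by blast

section \<open>Replacing a block\<close>

text \<open>Point \<open>q\<close> on the upper or lower boundary line of a block with \<open>m\<close> rows below line \<open>r\<close>
  corresponds to \<open>q'\<close> on that of a block with \<open>m'\<close> rows.\<close>

definition boundary_match :: "nat \<Rightarrow> nat \<Rightarrow> nat \<Rightarrow> point \<Rightarrow> point \<Rightarrow> bool" where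
  "boundary_match r m m' q q' \<longleftrightarrow>
     snd q = snd q' \<and> (fst q = r \<and> fst q' = r \<or> fst q = r + m \<and> fst q' = r + m')"

definition path_match :: "nat \<Rightarrow> nat \<Rightarrow> nat \<Rightarrow> arc list \<Rightarrow> arc list \<Rightarrow> bool" where
  "path_match r m m' p p' \<longleftrightarrow> p \<noteq> [] \<and> p' \<noteq> [] \<and> chain p \<and> chain p' \<and>
     (\<forall>x\<in>set p \<union> set p'. component x = component (hd p)) \<and>
     boundary_match r m m' (head (hd p)) (head (hd p')) \<and> boundary_match r m m' (tail (last p))
       (tail (last p'))"

text \<open>Identifies the points on and outside the boundary lines when \<open>m\<close> rows below
  line \<open>r\<close> are replaced by \<open>m'\<close> rows. From line \<open>r + m\<close> on
  the subtraction is exact; strictly inside the block the value has no meaning.\<close>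

definition shift_point :: "nat \<Rightarrow> nat \<Rightarrow> nat \<Rightarrow> point \<Rightarrow> point" where
  "shift_point r m m' q = (if fst q \<le> r then q else (fst q - m + m', snd q))"

lemma boundary_match_shift:
  assumes "boundary_match r m m' q q'" "m > 0"
  shows "q' = shift_point r m m' q" "fst q \<le> r \<or> r + m \<le> fst q"
  using assms by (auto simp: boundary_match_def shift_point_def prod_eq_iff)

lemma path_match_is_path:
  assumes "path_match r m m' p p'" "m > 0"
  shows "\<exists>h t c. is_path p h t c \<and> is_path p' (shift_point r m m' h) (shift_point r m m' t) c \<and>
    (fst h \<le> r \<or> r + m \<le> fst h) \<and> (fst t \<le> r \<or> r + m \<le> fst t)"
proof -
  have b: "boundary_match r m m' (head (hd p)) (head (hd p'))"
      "boundary_match r m m' (tail (last p)) (tail (last p'))"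
    using assms by (auto simp: path_match_def)
  have "is_path p (head (hd p)) (tail (last p)) (component (hd p))"
    "is_path p' (head (hd p')) (tail (last p')) (component (hd p))"
    using assms(1) unfolding path_match_def is_path_def by blast+
  then show ?thesis
    using boundary_match_shift[OF b(1) assms(2)] boundary_match_shift[OF b(2) assms(2)] by metis
qed

lemma columns_pairs:
  assumes "(p, p') \<in> set (zip (columns r ws es) (columns r ws' es))"
  obtains e k where "p = rev_if (snd e = Down) (vertical_arcs r (map ((+) k) ws) e)"
    "p' = rev_if (snd e = Down) (vertical_arcs r (map ((+) k) ws') e)"
proof -
  have "\<exists>e k. p = rev_if (snd e = Down) (vertical_arcs r (map ((+) k) ws) e) \<and>
    p' = rev_if (snd e = Down) (vertical_arcs r (map ((+) k) ws') e)"
    using assms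
  proof (induction es arbitrary: ws ws')
    case (Cons e es)
    show ?case
    proof (cases "p = rev_if (snd e = Down) (vertical_arcs r ws e) \<and> p' = rev_if (snd e = Down)
      (vertical_arcs r ws' e)")
      case True
      then show ?thesis by (intro exI[of _ e] exI[of _ 0]) simp
    next
      case False
      then have "(p, p') \<in> set (zip (columns r (map Suc ws) es) (columns r (map Suc ws') es))"
        using Cons.prems by auto
      from Cons.IH[OF this] obtain e' k where
        "p = rev_if (snd e' = Down) (vertical_arcs r (map ((+) k) (map Suc ws)) e')"
        "p' = rev_if (snd e' = Down) (vertical_arcs r (map ((+) k) (map Suc ws')) e')" by blast
      moreover have "map ((+) k) (map Suc xs) = map ((+) (Suc k)) xs" for xs by simp
      ultimately show ?thesis by metis
    qed
  qed simp
  then show thesis using that by blast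
qed

lemma columns_path_match:
  assumes "(p, p') \<in> set (zip (columns r ws es) (columns r ws' es))"
    and ws: "length ws = Suc m" "length ws' = Suc m'" "m > 0" "m' > 0" "hd ws = hd ws'"
      "last ws = last ws'"
  shows "path_match r m m' p p'" "word p = []" "word p' = []"
proof -
  obtain e k where p: "p = rev_if (snd e = Down) (vertical_arcs r (map ((+) k) ws) e)"
    "p' = rev_if (snd e = Down) (vertical_arcs r (map ((+) k) ws') e)"
    by (rule columns_pairs[OF assms(1)])
  have ne: "ws \<noteq> []" "ws' \<noteq> []" using ws by auto
  have "is_path p (if snd e = Down then (r + m, k + last ws) else (r, k + hd ws))
      (if snd e = Down then (r, k + hd ws) else (r + m, k + last ws)) (fst e)"
    using is_path_vertical[of "map ((+) k) ws" e r] ws(1-4) ne by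
      (simp add: p last_map hd_map cong: if_cong split del: if_split)
  moreover have "is_path p' (if snd e = Down then (r + m', k + last ws') else (r, k + hd ws'))
      (if snd e = Down then (r, k + hd ws') else (r + m', k + last ws')) (fst e)"
    using is_path_vertical[of "map ((+) k) ws'" e r] ws(1-4) ne by
      (simp add: p last_map hd_map cong: if_cong split del: if_split)
  ultimately show "path_match r m m' p p'"
    using ws unfolding path_match_def is_path_def boundary_match_def
    by (cases "snd e = Down") auto
  show "word p = []" "word p' = []" by (simp_all add: p word_vertical)
qed

context bijective_antipode
begin

text \<open>The words of the paths \<open>outs\<close> agree up to the renaming \<open>\<beta>\<close> of their crossings, the
  paths \<open>bs\<close> carry equal tensors.\<close>

definition block_match ::
  "bool list \<Rightarrow> nat \<Rightarrow> nat \<Rightarrow> row list \<Rightarrow> row list \<Rightarrow> (arc list \<times> arc list) list \<Rightarrow>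
    (arc list \<times> arc list) list \<Rightarrow> (point \<Rightarrow> point) \<Rightarrow> bool" where
  "block_match th r i B B' outs bs \<beta> \<longleftrightarrow>
     mset (concat (map fst (outs @ bs))) = mset (rows_arcs r i B) \<and>
     mset (concat (map snd (outs @ bs))) = mset (rows_arcs r i B') \<and>
     (\<forall>(p, p')\<in>set (outs @ bs). path_match r (length B) (length B') p p') \<and>
     (\<forall>(p, p')\<in>set outs. word p' = map (rename_passage \<beta>) (word p)) \<and>
     inj_on \<beta> (path_crossings fst outs) \<and>
     path_crossings fst outs \<inter> path_crossings fst bs = {} \<and>
     path_crossings snd outs \<inter> path_crossings snd bs = {} \<and>
     (\<forall>\<phi>. multilin_form (length bs) \<phi> \<longrightarrow>
      (\<Sum>a\<in>path_crossings fst bs \<rightarrow>\<^sub>E Basis.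
         \<phi> (path_products th fst a bs)) =
      (\<Sum>a\<in>path_crossings snd bs \<rightarrow>\<^sub>E Basis.
         \<phi> (path_products th snd a bs)))"

text \<open>Both diagrams are cut into single arcs above and below the block, whole vertical strands
  beside it, and the strands of the block. The first two kinds match by shifting rows, so everything
  but the block is supplied here once for all moves.\<close>

lemma block_replacement:
  assumes Z: "Z = \<lparr>rows = U @ map (\<lambda>R. map Strand u @ R @ map Strand v) B @ V, thick = th\<rparr>"
    and Z': "Z' = \<lparr>rows = U @ map (\<lambda>R. map Strand u @ R @ map Strand v) B' @ V, thick = th\<rparr>"
    and colored: "colored_diagram Z" "colored_diagram Z'"
    and B: "B \<noteq> []" "B' \<noteq> []" "row_top (hd B) = row_top (hd B')"
      "row_bot (last B) = row_bot (last B')"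
    and match: "block_match th (length U) (length u) B B' outs bs \<beta>"
  shows "J' Z = J' Z'"
proof -
  define r m m' where "r = length U" and "m = length B" and "m' = length B'"
  define g where "g = shift_point r m m'"
  have m: "m > 0" "m' > 0" using B by (auto simp: m_def m'_def)
  have gU: "g (0 + k, l) = (0 + k, l)" if "k \<le> r" for k l
    using that by (simp add: g_def shift_point_def)
  have gV: "g (r + m + k, l) = (r + m' + k, l)" for k l
    using m by (simp add: g_def shift_point_def)
  have succ: "successively (\<lambda>R R'. row_bot R = row_top R') B"
      "successively (\<lambda>R R'. row_bot R = row_top R') B'"
    using colored unfolding colored_diagram_def Z Z'
    by (auto simp: successively_append_iff successively_map elim!: successively_mono)
  define side where "side = zip (columns r (replicate (Suc m) 0) u)
    (columns r (replicate (Suc m') 0) u) @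
    zip (columns r (widths (length u) B) v) (columns r (widths (length u) B') v)"
  \<comment> \<open>Above and below the block each arc is a path of its own and is carried along by
    the shift of rows.\<close>
  define outer where "outer = map (\<lambda>x. ([x], [rename_arc g x]))
    (rows_arcs 0 0 U @ rows_arcs (r + m) 0 V)"
  let ?OUTS = "outer @ side @ outs"
  note bm = match[unfolded block_match_def, folded r_def m_def m'_def]
  have bm1: "mset (concat (map fst (outs @ bs))) = mset (rows_arcs r (length u) B)"
    and bm2: "mset (concat (map snd (outs @ bs))) = mset (rows_arcs r (length u) B')"
    and bm3: "\<forall>(p, p')\<in>set (outs @ bs). path_match r m m' p p'"
    and bm4: "\<forall>(p, p')\<in>set outs. word p' = map (rename_passage \<beta>) (word p)"
    using bm by blast+
  have bm3': "path_match r m m' p p'" if "(p, p') \<in> set (outs @ bs)" for p p'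
    using bspec[OF bm3 that] by simp
  have bm4': "word p' = map (rename_passage \<beta>) (word p)" if "(p, p') \<in> set outs" for p p'
    using bspec[OF bm4 that] by simp
  have concat1: "concat (map (\<lambda>x. [f x]) xs) = map f xs" for f :: "arc \<Rightarrow> arc" and xs
    by (induction xs) simp_all
  have outer1: "concat (map fst outer) = rows_arcs 0 0 U @ rows_arcs (r + m) 0 V"
    using concat1[of "\<lambda>x. x"] by (simp add: outer_def comp_def)
  have outer2: "concat (map snd outer) = rows_arcs 0 0 U @ rows_arcs (r + m') 0 V"
  proof -
    have "map (rename_arc g) (rows_arcs 0 0 U) = rows_arcs 0 0 U"
      by (rule rows_arcs_rename[symmetric]) (rule gU, simp add: r_def)
    moreover have "map (rename_arc g) (rows_arcs (r + m) 0 V) = rows_arcs (r + m') 0 V"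
      by (rule rows_arcs_rename[symmetric]) (rule gV)
    ultimately show ?thesis by (simp add: outer_def comp_def concat1)
  qed
  have lw: "length (widths (length u) B) = Suc m" "length (widths (length u) B') = Suc m'"
    using B by (simp_all add: length_widths m_def m'_def)
  have side1: "map fst side = columns r (replicate (Suc m) 0) u @ columns r (widths (length u) B) v"
    and side2: "map snd side = columns r (replicate (Suc m') 0) u @ columns r (widths (length u) B')
      v"
    by (simp_all add: side_def)
  have mset1: "mset (concat (map fst (?OUTS @ bs))) = mset (rows_arcs 0 0 (rows Z))"
  proof -
    have "mset (concat (map fst (?OUTS @ bs))) = mset (concat (map fst outer)) + mset
        (concat (map fst side)) + mset (concat (map fst (outs @ bs)))"
      by (simp add: add.assoc)
    also have "\<dots> = mset (rows_arcs 0 0 (rows Z))"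
      unfolding outer1 side1 bm1 Z using mset_rows_arcs_between[OF succ(1) B(1), of r u v]
      by (simp add: rows_arcs_append r_def[symmetric] m_def[symmetric])
    finally show ?thesis .
  qed
  have mset2: "mset (concat (map snd (?OUTS @ bs))) = mset (rows_arcs 0 0 (rows Z'))"
  proof -
    have "mset (concat (map snd (?OUTS @ bs))) = mset (concat (map snd outer)) + mset
        (concat (map snd side)) + mset (concat (map snd (outs @ bs)))"
      by (simp add: add.assoc)
    also have "\<dots> = mset (rows_arcs 0 0 (rows Z'))"
      unfolding outer2 side2 bm2 Z' using mset_rows_arcs_between[OF succ(2) B(2), of r u v]
      by (simp add: rows_arcs_append r_def[symmetric] m'_def[symmetric])
    finally show ?thesis .
  qed
  have side_match: "path_match r m m' p p' \<and> word p = [] \<and> word p' = []" if "(p, p') \<in> set side" for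
      p p'
    using that unfolding side_def set_append
  proof
    assume *: "(p, p') \<in> set (zip (columns r (replicate (Suc m) 0) u)
      (columns r (replicate (Suc m') 0) u))"
    show ?thesis using columns_path_match[OF *] m by simp
  next
    assume *: "(p, p') \<in> set (zip (columns r (widths (length u) B) v)
      (columns r (widths (length u) B') v))"
    show ?thesis using columns_path_match[OF * lw m] B by (simp add: hd_widths last_widths)
  qed
  have outer_rows: "fst (head x) \<le> r \<or> r + m \<le> fst (head x)"
      "fst (tail x) \<le> r \<or> r + m \<le> fst (tail x)"
    "passage x = Under q s e \<or> passage x = Over q s e \<Longrightarrow> fst q < r \<or> r + m \<le> fst q"
    if "x \<in> set (rows_arcs 0 0 U @ rows_arcs (r + m) 0 V)" for x q s e
    using that rows_arcs_bounds(1,2)[of x 0 0 U] rows_arcs_bounds(3)[of x 0 0 U q s e]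
      rows_arcs_bounds(1,2)[of x "r + m" 0 V] rows_arcs_bounds(3)[of x "r + m" 0 V q s e] by
        (auto simp: r_def)
  have paths: "\<exists>h t c. is_path p h t c \<and> is_path p' (g h) (g t) c \<and>
    (fst h \<le> r \<or> r + m \<le> fst h) \<and> (fst t \<le> r \<or> r + m \<le> fst t)" if "(p, p') \<in> set
      (?OUTS @ bs)" for p p'
  proof (cases "(p, p') \<in> set outer")
    case True
    then obtain x where x: "x \<in> set (rows_arcs 0 0 U @ rows_arcs (r + m) 0 V)" "p = [x]"
      "p' = [rename_arc g x]"
      by (auto simp: outer_def)
    then have "is_path p (head x) (tail x) (component x)"
      "is_path p' (g (head x)) (g (tail x)) (component x)"
      by (simp_all add: is_path_def rename_arc_def)
    then show ?thesis using outer_rows(1,2)[OF x(1)] by blast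
  next
    case False
    then have "path_match r m m' p p'" using that side_match[of p p'] bm3'[of p p'] by auto
    then show ?thesis unfolding g_def by (rule path_match_is_path) (rule m)
  qed
  \<comment> \<open>Crossings outside the block move with their row; those of its paths
    \<open>outs\<close> are renamed by the move.\<close>
  define \<rho> where "\<rho> q = (if q \<in> path_crossings fst outs then \<beta> q else g q)" for q
  have cr_block1: "fst q \<in> {r..<r + m}" if "q \<in> path_crossings fst (outs @ bs)" for q
    using arc_crossings_rows[of q r "length u" B] that mset_eq_setD[OF bm1] by (simp add: m_def)
  have cr_block2: "fst q \<in> {r..<r + m'}" if "q \<in> path_crossings snd (outs @ bs)" for q
    using arc_crossings_rows[of q r "length u" B'] that mset_eq_setD[OF bm2] by (simp add: m'_def)
  have cr_outer1: "fst q < r \<or> r + m \<le> fst q" if "q \<in> path_crossings fst outer" for q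
    using that outer_rows(3) unfolding outer1 arc_crossings_def by blast
  have cr_outer2: "fst q < r \<or> r + m' \<le> fst q" if "q \<in> path_crossings snd outer" for q
    using that arc_crossings_rows[of q 0 0 U] arc_crossings_rows[of q "r + m'" 0 V]
    unfolding outer2 set_append arc_crossings_Un by (auto simp: r_def)
  have cr_side: "path_crossings fst side = {}" "path_crossings snd side = {}"
  proof -
    have *: "concat (map (\<lambda>r. word (fst r)) side) = []" "concat (map (\<lambda>r. word (snd r)) side) = []"
      using side_match by auto
    show "path_crossings fst side = {}" "path_crossings snd side = {}"
      unfolding crossing_points_words[symmetric] * by (rule crossing_points_Nil)+
  qed
  have cr_OUTS: "path_crossings f ?OUTS =
      path_crossings f outer \<union> path_crossings f outs"
    if "f = fst \<or> f = snd" for f :: "arc list \<times> arc list \<Rightarrow> arc list"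
    using that cr_side by (auto simp only: map_append concat_append set_append arc_crossings_Un)
  have cr_block_Un: "path_crossings f (outs @ bs) =
    path_crossings f outs \<union> path_crossings f bs"
    for f :: "arc list \<times> arc list \<Rightarrow> arc list"
    by (simp only: map_append concat_append set_append arc_crossings_Un)
  have \<beta>_rows: "\<beta> q \<in> path_crossings snd outs" if "q \<in> path_crossings fst outs" for q
  proof -
    have "concat (map (\<lambda>r. word (snd r)) outs) = map (rename_passage \<beta>)
        (concat (map (\<lambda>r. word (fst r)) outs))"
      using bm4 by (auto simp: map_concat comp_def intro!: arg_cong[of _ _ concat] map_cong)
    then have "path_crossings snd outs = \<beta> ` path_crossings fst outs"
      by (metis crossing_points_words crossing_points_rename)
    then show ?thesis using that by simp
  qed
  \<comment> \<open>The paths use each arc exactly once because their arcs agree, with multiplicity,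
    with the distinct arcs of the rows.\<close>
  have dist: "distinct (concat (map fst (?OUTS @ bs)))" "distinct (concat (map snd (?OUTS @ bs)))"
    using distinct_rows_arcs[OF colored(1)] distinct_rows_arcs[OF colored(2)]
      mset_eq_imp_distinct_iff[OF mset1] mset_eq_imp_distinct_iff[OF mset2] by blast+
  have arcs: "set (concat (map fst (?OUTS @ bs))) = arcs Z"
      "set (concat (map snd (?OUTS @ bs))) = arcs Z'"
    unfolding arcs_eq using mset_eq_setD[OF mset1] mset_eq_setD[OF mset2] by blast+
  show ?thesis
  proof (rule J'_transfer[where th = th and outs = ?OUTS and bs = bs and \<rho> = \<rho>, unfolded
    crossing_points_words])
    show "thick Z = th" "thick Z' = th" by (simp_all add: Z Z')
    show "inj_on head (arcs Z)" "inj_on tail (arcs Z)" "inj_on head (arcs Z')"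
      using colored by (simp_all add: inj_heads inj_tails)
    show "\<forall>x\<in>arcs Z. component x < length th" "\<forall>c<length th. \<exists>xs. is_reading Z c xs"
      "\<forall>x\<in>arcs Z'. component x < length th" "\<forall>c<length th. \<exists>xs. is_reading Z' c xs"
      using colored by (simp_all add: colored_diagram_def Z Z')
    show "crossings Z = path_crossings fst ?OUTS \<union> path_crossings fst bs"
      unfolding crossings_eq arcs(1)[symmetric] by (simp only: map_append concat_append set_append
        arc_crossings_Un)
    show "crossings Z' = path_crossings snd ?OUTS \<union> path_crossings snd bs"
      unfolding crossings_eq arcs(2)[symmetric] by (simp only: map_append concat_append set_append
        arc_crossings_Un)
    show "matched (?OUTS @ bs) Z Z'"
      unfolding matched_def
    proof (intro conjI exI[of _ g])
      show "\<forall>(p, p')\<in>set (?OUTS @ bs). \<exists>h t c. is_path p h t c \<and> is_path p' (g h) (g t) c"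
      proof (rule ballI)
        fix s assume "s \<in> set (?OUTS @ bs)"
        then obtain h t c where "is_path (fst s) h t c" "is_path (snd s) (g h) (g t) c"
          using paths[of "fst s" "snd s"] unfolding prod.collapse by blast
        then show "case s of (p, p') \<Rightarrow> \<exists>h t c. is_path p h t c \<and> is_path p' (g h) (g t) c"
          unfolding case_prod_unfold by blast
      qed
      have "inj_on g {q. fst q \<le> r \<or> r + m \<le> fst q}"
        using m by (auto simp: inj_on_def g_def shift_point_def prod_eq_iff)
      moreover have "(\<Union>(p, p')\<in>set (?OUTS @ bs). {head (hd p), tail (last p)}) \<subseteq> {q. fst q \<le> r \<or> r +
        m \<le> fst q}"
      proof (rule UN_least)
        fix s assume s: "s \<in> set (?OUTS @ bs)"
        then obtain h t c where htc: "is_path (fst s) h t c" "fst h \<le> r \<or> r + m \<le> fst h"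
          "fst t \<le> r \<or> r + m \<le> fst t"
          using paths[of "fst s" "snd s"] unfolding prod.collapse by blast
        from htc(1) have "head (hd (fst s)) = h" "tail (last (fst s)) = t" by
          (simp_all add: is_path_def)
        then have "{head (hd (fst s)), tail (last (fst s))} \<subseteq> {q. fst q \<le> r \<or> r + m \<le> fst q}"
          using htc(2,3) by simp
        then show "(case s of (p, p') \<Rightarrow> {head (hd p), tail (last p)}) \<subseteq> {q. fst q \<le> r \<or> r + m \<le> fst
          q}"
          by (simp only: case_prod_unfold)
      qed
      ultimately show "inj_on g (\<Union>(p, p')\<in>set (?OUTS @ bs). {head (hd p), tail (last p)})"
        by (rule inj_on_subset)
    qed (fact dist arcs)+
    show "word p' = map (rename_passage \<rho>) (word p)" if mem: "(p, p') \<in> set ?OUTS" for p p'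
    proof -
      have cong: "map (rename_passage \<rho>) (word p) = map (rename_passage f) (word p)"
        if "\<And>q. q \<in> arc_crossings (set p) \<Longrightarrow> \<rho> q = f q" for f
      proof (rule map_cong[OF refl])
        fix w assume "w \<in> set (word p)"
        then obtain x where x: "x \<in> set p" "w = passage x" by (auto simp: word_def)
        show "rename_passage \<rho> w = rename_passage f w"
        proof (cases w)
          case (Under q s e)
          then have "q \<in> arc_crossings (set p)" using x unfolding arc_crossings_def by auto
          then show ?thesis using that Under by simp
        next
          case (Over q s e)
          then have "q \<in> arc_crossings (set p)" using x unfolding arc_crossings_def by auto
          then show ?thesis using that Over by simp
        qed simp
      qed
      consider "(p, p') \<in> set outer" | "(p, p') \<in> set side" | "(p, p') \<in> set outs" using mem by auto
      then show ?thesis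
      proof cases
        case 1
        then obtain x where x: "x \<in> set (rows_arcs 0 0 U @ rows_arcs (r + m) 0 V)" "p = [x]"
          "p' = [rename_arc g x]"
          by (auto simp: outer_def)
        have "\<rho> q = g q" if "q \<in> arc_crossings (set p)" for q
        proof -
          have "fst q < r \<or> r + m \<le> fst q"
          proof -
            from that obtain s e where "passage x = Under q s e \<or> passage x = Over q s e"
              unfolding arc_crossings_def x(2) by auto
            then show ?thesis by (rule outer_rows(3)[OF x(1)])
          qed
          then have "q \<notin> path_crossings fst outs"
            using cr_block1[of q] cr_block_Un[of fst] by auto
          then show ?thesis by (simp add: \<rho>_def)
        qed
        then have "map (rename_passage \<rho>) (word p) = map (rename_passage g) (word p)" by (rule cong)
        then show ?thesis using x by (cases "passage x") (simp_all add: word_def rename_arc_def)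
      next
        case 2
        then show ?thesis using side_match[OF 2] by simp
      next
        case 3
        have "\<rho> q = \<beta> q" if "q \<in> arc_crossings (set p)" for q
        proof -
          have "q \<in> path_crossings fst outs"
          proof -
            have "p \<in> set (map fst outs)" using 3 by (metis fst_conv image_eqI list.set_map)
            then have "set p \<subseteq> set (concat (map fst outs))" by auto
            then show ?thesis using that unfolding arc_crossings_def by blast
          qed
          then show ?thesis by (simp add: \<rho>_def)
        qed
        then have "map (rename_passage \<rho>) (word p) = map (rename_passage \<beta>) (word p)" by (rule cong)
        then show ?thesis using bm4'[OF 3] by simp
      qed
    qed
    show "inj_on \<rho> (path_crossings fst ?OUTS)"
    proof -
      let ?X = "{q. fst q < r \<or> r + m \<le> fst q}"
      have inj_b: "inj_on \<beta> (path_crossings fst outs)" using bm by blast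
      have inj_g: "inj_on g ?X"
        using m by (auto simp: inj_on_def g_def shift_point_def prod_eq_iff)
      \<comment> \<open>The two renamings cannot collide: \<open>\<beta>\<close> ends in the rows of
        the new block and \<open>g\<close> avoids them.\<close>
      have \<beta>_g: "\<beta> q \<noteq> g q'" if q: "q \<in> path_crossings fst outs" and q': "q' \<in> ?X" for q q'
      proof
        assume eq: "\<beta> q = g q'"
        have "r \<le> fst (\<beta> q) \<and> fst (\<beta> q) < r + m'"
          using cr_block2[of "\<beta> q"] \<beta>_rows[OF q] cr_block_Un[of snd] by auto
        moreover have "fst (g q') < r \<or> r + m' \<le> fst (g q')"
          using q' m by (auto simp: g_def shift_point_def)
        ultimately show False unfolding eq by linarith
      qed
      have \<rho>: "\<rho> q = \<beta> q" if "q \<in> path_crossings fst outs" for q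
        using that by (simp only: \<rho>_def if_True)
      have g: "\<rho> q = g q" if q: "q \<in> ?X" for q
      proof -
        have "q \<notin> path_crossings fst outs" using cr_block1[of q] cr_block_Un[of fst] q by auto
        then show ?thesis by (simp only: \<rho>_def if_False)
      qed
      have "\<rho> ` path_crossings fst outs \<inter> \<rho> ` ?X = {}"
      proof (rule equals0I, elim IntE imageE)
        fix y q q' assume y: "y = \<rho> q" "y = \<rho> q'" and q: "q \<in> path_crossings fst outs" and q':
          "q' \<in> ?X"
        show False using \<beta>_g[OF q q'] y unfolding \<rho>[OF q] g[OF q'] by metis
      qed
      moreover have "inj_on \<rho> ?X" "inj_on \<rho> (path_crossings fst outs)"
        by (simp_all only: inj_on_cong[OF g] inj_on_cong[OF \<rho>] inj_g inj_b)
      ultimately have "inj_on \<rho> (?X \<union> path_crossings fst outs)"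
        unfolding inj_on_Un by blast
      moreover have "path_crossings fst ?OUTS \<subseteq> ?X \<union> path_crossings fst outs"
        using cr_outer1 unfolding cr_OUTS[OF disjI1[OF refl]] by blast
      ultimately show ?thesis by (rule inj_on_subset)
    qed
    show "path_crossings fst ?OUTS \<inter> path_crossings fst bs = {}"
      "path_crossings snd ?OUTS \<inter> path_crossings snd bs = {}"
    proof -
      have d: "path_crossings fst outs \<inter> path_crossings fst bs = {}"
        "path_crossings snd outs \<inter> path_crossings snd bs = {}"
        using bm by blast+
      have "q \<notin> path_crossings fst bs" if "q \<in> path_crossings fst outer" for q
        using cr_outer1[OF that] cr_block1[of q] cr_block_Un[of fst] by auto
      then show "path_crossings fst ?OUTS \<inter> path_crossings fst bs = {}"
        unfolding cr_OUTS[OF disjI1[OF refl]] using d(1) by blast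
      have "q \<notin> path_crossings snd bs" if "q \<in> path_crossings snd outer" for q
        using cr_outer2[OF that] cr_block2[of q] cr_block_Un[of snd] by auto
      then show "path_crossings snd ?OUTS \<inter> path_crossings snd bs = {}"
        unfolding cr_OUTS[OF disjI2[OF refl]] using d(2) by blast
    qed
  qed (use bm in blast)
qed

end

section \<open>Local moves\<close>

text \<open>A common form for arcs of strands and of bends, so that a strand passing through both is
  described by one list of points and one orientation.\<close>

definition link :: "bool \<Rightarrow> point \<Rightarrow> point \<Rightarrow> nat \<Rightarrow> passage \<Rightarrow> arc" where
  "link f q q' c p = (if f then \<lparr>tail = q, head = q', component = c, passage = p\<rparr>
     else \<lparr>tail = q', head = q, component = c, passage = p\<rparr>)"

fun trail :: "bool \<Rightarrow> nat \<Rightarrow> point list \<Rightarrow> passage list \<Rightarrow> arc list" where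
  "trail f c (q # q' # qs) (p # ps) = link f q q' c p # trail f c (q' # qs) ps"
| "trail f c _ _ = []"

text \<open>The reading of the strand of component \<open>c\<close> through the points \<open>qs\<close>, oriented along \<open>qs\<close> if
  \<open>f\<close> holds and against \<open>qs\<close> otherwise.\<close>

definition path :: "bool \<Rightarrow> nat \<Rightarrow> point list \<Rightarrow> passage list \<Rightarrow> arc list" where
  "path f c qs ps = rev_if f (trail f c qs ps)"

lemma strand_arc_link: "strand_arc q q' e p = link (snd e = Down) q q' (fst e) p"
  by (simp add: strand_arc_def link_def)

lemma bend_arc_link: "bend_arc q q' c d = link (d = LR) q q' c Plain"
  by (simp add: bend_arc_def link_def)

abbreviation strand :: "edge \<Rightarrow> point list \<Rightarrow> passage list \<Rightarrow> arc list" where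
  "strand e \<equiv> path (snd e = Down) (fst e)"

abbreviation bend :: "nat \<Rightarrow> direction \<Rightarrow> point list \<Rightarrow> passage list \<Rightarrow> arc list" where
  "bend c d \<equiv> path (d = LR) c"

lemma mset_path: "mset (path f c qs ps) = mset (trail f c qs ps)"
  by (simp add: path_def)

lemma map_passage_trail: "length qs = Suc (length ps) \<Longrightarrow> map passage (trail f c qs ps) = ps"
proof (induction f c qs ps rule: trail.induct)
  case (1 f c q q' qs p ps)
  then show ?case by (simp add: link_def)
qed (auto simp: length_Suc_conv Suc_length_conv)

lemma word_path: "length qs = Suc (length ps) \<Longrightarrow>
    word (path f c qs ps) = rev_if f (filter (\<lambda>p. p \<noteq> Plain) ps)"
  using map_passage_trail[of qs ps f c] by (cases f) (simp_all add: word_def path_def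
    rev_map[symmetric] rev_filter)

lemma arc_crossings_path: "length qs = Suc (length ps) \<Longrightarrow> arc_crossings (set (path f c qs ps)) =
    crossing_points ps"
  using crossing_points_passages[of "trail f c qs ps"] map_passage_trail[of qs ps f c] by
    (simp add: path_def)

lemma is_path_trail:
  "length qs = Suc (length ps) \<Longrightarrow> ps \<noteq> [] \<Longrightarrow> is_path (path f c qs ps)
    (if f then last qs else hd qs) (if f then hd qs else last qs) c"
proof (induction f c qs ps rule: trail.induct)
  case (1 f c q q' qs p ps)
  show ?case
  proof (cases ps)
    case Nil
    then show ?thesis using 1 by (auto simp: is_path_def path_def link_def)
  next
    case (Cons p' ps')
    then have IH: "is_path (path f c (q' # qs) ps) (if f then last (q' # qs) else hd (q' # qs)) 
        (if f then hd (q' # qs) else last (q' # qs)) c"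
      using 1 by simp
    have ne: "trail f c (q' # qs) ps \<noteq> []" using Cons 1 by (cases qs) auto
    show ?thesis using IH ne 1
      by (cases f) (auto simp: is_path_def path_def link_def successively_append_iff
        successively_Cons hd_rev last_rev)
  qed
qed (auto simp: length_Suc_conv Suc_length_conv)

lemma path_match_path:
  assumes "length qs = Suc (length ps)" "length qs' = Suc (length ps')" "ps \<noteq> []" "ps' \<noteq> []"
    "boundary_match r m m' (hd qs) (hd qs')" "boundary_match r m m' (last qs) (last qs')"
  shows "path_match r m m' (path f c qs ps) (path f c qs' ps')"
  using is_path_trail[OF assms(1,3), of f c] is_path_trail[OF assms(2,4), of f c] assms(5,6)
  unfolding is_path_def path_match_def by (cases f) auto

lemma component_path: "length qs = Suc (length ps) \<Longrightarrow> ps \<noteq> [] \<Longrightarrow> component (hd (path f c qs ps)) = c"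
  using is_path_trail[of qs ps f c] by (auto simp: is_path_def)

lemma crossing_points_simps [simp]:
  "crossing_points (Plain # ps) = crossing_points ps"
  "crossing_points (Under q s u # ps) = insert q (crossing_points ps)"
  "crossing_points (Over q s u # ps) = insert q (crossing_points ps)"
  by (auto simp: crossing_points_def)

lemmas block_simps = mset_path word_path component_path arc_crossings_Un arc_crossings_path
  crossing_points_Nil strand_arc_link bend_arc_link path_match_path boundary_match_def
    add_mset_commute

lemmas numeral_2_3 = numeral_2_eq_2 numeral_3_eq_3

lemmas leg_defs = max_left_def max_right_def min_left_def min_right_def

context bijective_antipode
begin

text \<open>Without algebraic paths both sums reduce to the same single term.\<close>

lemma block_match_rename:
  assumes "mset (concat (map fst outs)) = mset (rows_arcs r i B)"
    "mset (concat (map snd outs)) = mset (rows_arcs r i B')"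
    "\<forall>(p, p')\<in>set outs. path_match r (length B) (length B') p p'"
    "\<forall>(p, p')\<in>set outs. word p' = map (rename_passage \<beta>) (word p)"
    "inj_on \<beta> (path_crossings fst outs)"
  shows "block_match th r i B B' outs [] \<beta>"
  using assms by (simp add: block_match_def arc_crossings_def)

lemma block_match_algebra:
  assumes "mset (concat (map fst bs)) = mset (rows_arcs r i B)"
    "mset (concat (map snd bs)) = mset (rows_arcs r i B')"
    "\<forall>(p, p')\<in>set bs. path_match r (length B) (length B') p p'"
    "path_crossings fst bs = C" "path_crossings snd bs = C'"
    "\<And>\<phi>. multilin_form (length bs) \<phi> \<Longrightarrow>
      (\<Sum>a\<in>C \<rightarrow>\<^sub>E Basis. \<phi> (path_products th fst a bs)) =
      (\<Sum>a\<in>C' \<rightarrow>\<^sub>E Basis. \<phi> (path_products th snd a bs))"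
  shows "block_match th r i B B' [] bs id"
proof -
  have "arc_crossings {} = {}" by (simp add: arc_crossings_def)
  then show ?thesis unfolding block_match_def using assms by simp
qed

lemmas product_simps = word_product_Under_Under word_product_Over_Over word_product_Under
  word_product_Over word_product_Nil sign_map_def sum_PiE_insert

text \<open>Here and below each pair follows one strand before and after the move, by the points it
  visits and the passages between them.\<close>

lemma block_match_sym_sym:
  "block_match th r i [[Sym a b], [Sym b a]] [[Strand a, Strand b]]
    [(strand a [(r, i), (Suc r, Suc i), (Suc (Suc r), i)] [Plain, Plain],
      strand a [(r, i), (Suc r, i)] [Plain]),
     (strand b [(r, Suc i), (Suc r, i), (Suc (Suc r), Suc i)] [Plain, Plain],
      strand b [(r, Suc i), (Suc r, Suc i)] [Plain])] [] id"
  by (rule block_match_rename) (simp_all add: block_simps)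

lemma block_match_sym_braid:
  "block_match th r i
     [[Sym a b, Strand c], [Strand b, Sym a c], [Sym b c, Strand a]]
     [[Strand a, Sym b c], [Sym a c, Strand b], [Strand c, Sym a b]]
    [(strand a [(r, i), (Suc r, Suc i), (r + 2, i + 2), (r + 3, i + 2)] [Plain, Plain, Plain],
      strand a [(r, i), (Suc r, i), (r + 2, Suc i), (r + 3, i + 2)] [Plain, Plain, Plain]),
     (strand b [(r, Suc i), (Suc r, i), (r + 2, i), (r + 3, Suc i)] [Plain, Plain, Plain],
      strand b [(r, Suc i), (Suc r, i + 2), (r + 2, i + 2), (r + 3, Suc i)] [Plain, Plain, Plain]),
     (strand c [(r, i + 2), (Suc r, i + 2), (r + 2, Suc i), (r + 3, i)] [Plain, Plain, Plain],
      strand c [(r, i + 2), (Suc r, Suc i), (r + 2, i), (r + 3, i)] [Plain, Plain, Plain])] [] id"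
  by (rule block_match_rename) (simp_all add: block_simps numeral_2_3)

lemma
  shows under_factor_thin: "under_factor False Down x = x" and under_factor_thick:
      "under_factor True Down x = antipode x"
    and over_factor_thin: "over_factor False Down f = f" and over_factor_thick:
      "over_factor True Down f = f \<circ> antipode_inv"
  by (simp_all add: under_factor_def under_label_def over_factor_def dual_inv_antipode_def)

text \<open>The block has a single crossing, so a constant renaming is injective. The functions
  \<open>pa\<close> and \<open>pb\<close> give the two passages and treat both signs alike.\<close>

lemma block_match_sym_crossing_right:
  assumes "X = XPlus \<and> pa = (\<lambda>q. Under q Pos (snd a)) \<and> pb = (\<lambda>q. Over q Pos (snd b)) \<or>
    X = XMinus \<and> pa = (\<lambda>q. Over q Neg (snd a)) \<and> pb = (\<lambda>q. Under q Neg (snd b))"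
  shows "block_match th r i
    [[X a b, Strand c], [Strand b, Sym a c], [Sym b c, Strand a]]
    [[Strand a, Sym b c], [Sym a c, Strand b], [Strand c, X a b]]
    [(strand a [(r, i), (Suc r, Suc i), (r + 2, i + 2), (r + 3, i + 2)] [pa (r, i), Plain, Plain],
      strand a [(r, i), (Suc r, i), (r + 2, Suc i), (r + 3, i + 2)]
        [Plain, Plain, pa (r + 2, Suc i)]),
     (strand b [(r, Suc i), (Suc r, i), (r + 2, i), (r + 3, Suc i)] [pb (r, i), Plain, Plain],
      strand b [(r, Suc i), (Suc r, i + 2), (r + 2, i + 2), (r + 3, Suc i)]
        [Plain, Plain, pb (r + 2, Suc i)]),
     (strand c [(r, i + 2), (Suc r, i + 2), (r + 2, Suc i), (r + 3, i)] [Plain, Plain, Plain],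
      strand c [(r, i + 2), (Suc r, Suc i), (r + 2, i), (r + 3, i)] [Plain, Plain, Plain])] []
        (\<lambda>_. (r + 2, Suc i))"
  using assms by (elim disjE conjE; intro block_match_rename)
    (simp_all add: block_simps numeral_2_3)

lemma block_match_sym_crossing_left:
  assumes "X = XPlus \<and> pa = (\<lambda>q. Under q Pos (snd a)) \<and> pb = (\<lambda>q. Over q Pos (snd b)) \<or>
    X = XMinus \<and> pa = (\<lambda>q. Over q Neg (snd a)) \<and> pb = (\<lambda>q. Under q Neg (snd b))"
  shows "block_match th r i
    [[Strand c, X a b], [Sym c b, Strand a], [Strand b, Sym c a]]
    [[Sym c a, Strand b], [Strand a, Sym c b], [X a b, Strand c]]
    [(strand a [(r, Suc i), (Suc r, i + 2), (r + 2, i + 2), (r + 3, Suc i)]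
      [pa (r, Suc i), Plain, Plain],
      strand a [(r, Suc i), (Suc r, i), (r + 2, i), (r + 3, Suc i)] [Plain, Plain, pa (r + 2, i)]),
     (strand b [(r, i + 2), (Suc r, Suc i), (r + 2, i), (r + 3, i)] [pb (r, Suc i), Plain, Plain],
      strand b [(r, i + 2), (Suc r, i + 2), (r + 2, Suc i), (r + 3, i)]
        [Plain, Plain, pb (r + 2, i)]),
     (strand c [(r, i), (Suc r, i), (r + 2, Suc i), (r + 3, i + 2)] [Plain, Plain, Plain],
      strand c [(r, i), (Suc r, Suc i), (r + 2, i + 2), (r + 3, i + 2)] [Plain, Plain, Plain])] []
        (\<lambda>_. (r + 2, i))"
  using assms by (elim disjE conjE; intro block_match_rename)
    (simp_all add: block_simps numeral_2_3)

lemma block_match_sym_max: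
  "block_match th r i
    [[Strand t, Maximum c d], [Sym t (max_left c d), Strand (max_right c d)]]
    [[Maximum c d, Strand t], [Strand (max_left c d), Sym (max_right c d) t]]
    [(strand t [(r, i), (Suc r, i), (r + 2, Suc i)] [Plain, Plain],
      strand t [(r, i), (Suc r, i + 2), (r + 2, Suc i)] [Plain, Plain]),
     (bend c d [(r + 2, i), (Suc r, Suc i), (Suc r, i + 2), (r + 2, i + 2)] [Plain, Plain, Plain],
      bend c d [(r + 2, i), (Suc r, i), (Suc r, Suc i), (r + 2, i + 2)] [Plain, Plain, Plain])] []
        id"
  by (cases d; rule block_match_rename) (simp_all add: block_simps leg_defs link_def numeral_2_3)

lemma block_match_sym_min:
  "block_match th r i
    [[Sym (min_left c d) t, Strand (min_right c d)], [Strand t, Minimum c d]]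
    [[Strand (min_left c d), Sym t (min_right c d)], [Minimum c d, Strand t]]
    [(strand t [(r, Suc i), (Suc r, i), (r + 2, i)] [Plain, Plain],
      strand t [(r, Suc i), (Suc r, i + 2), (r + 2, i)] [Plain, Plain]),
     (bend c d [(r, i), (Suc r, Suc i), (Suc r, i + 2), (r, i + 2)] [Plain, Plain, Plain],
      bend c d [(r, i), (Suc r, i), (Suc r, Suc i), (r, i + 2)] [Plain, Plain, Plain])] [] id"
  by (cases d; rule block_match_rename) (simp_all add: block_simps leg_defs link_def numeral_2_3)

text \<open>Followed from its lower end, the strand is oriented along the list exactly when
  \<open>d = LR\<close>, on its vertical parts as well as on the two bends.\<close>

lemma block_match_zigzag_left:
  "block_match th r i
    [[Maximum c d, Strand (max_left c d)], [Strand (max_left c d), Minimum c d]]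
    [[Strand (max_left c d)]]
    [(bend c d [(r + 2, i), (Suc r, i), (Suc r, Suc i), (Suc r, i + 2), (r, i)]
      [Plain, Plain, Plain, Plain],
      bend c d [(Suc r, i), (r, i)] [Plain])] [] id"
  by (cases d; rule block_match_rename) (simp_all add: block_simps leg_defs link_def numeral_2_3)

lemma block_match_zigzag_right:
  "block_match th r i
    [[Strand (max_right c d), Maximum c d], [Minimum c d, Strand (max_right c d)]]
    [[Strand (max_right c d)]]
    [(bend c d [(r, i), (Suc r, i), (Suc r, Suc i), (Suc r, i + 2), (r + 2, i)]
      [Plain, Plain, Plain, Plain],
      bend c d [(r, i), (Suc r, i)] [Plain])] [] id"
  by (cases d; rule block_match_rename) (simp_all add: block_simps leg_defs link_def numeral_2_3)

lemma block_match_zero_two_plus: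
  "block_match th r i
    [[XPlus a b], [XMinus b a]]
    [[Strand a, Strand b]]
    [] [(strand a [(r, i), (Suc r, Suc i), (r + 2, i)] [Under (r, i) Pos (snd a), Under (Suc r, i)
      Neg (snd a)],
      strand a [(r, i), (Suc r, i)] [Plain]),
     (strand b [(r, Suc i), (Suc r, i), (r + 2, Suc i)] [Over (r, i) Pos (snd b), Over (Suc r, i)
       Neg (snd b)],
      strand b [(r, Suc i), (Suc r, Suc i)] [Plain])] id"
\<comment> \<open>The lower crossing is listed first, so that the nested sums appear in the order of
  \<open>canonical_element_inverse\<close>; the empty set on the other side leaves one term, with
  both products equal to 1.\<close>
proof (rule block_match_algebra[where C = "{(Suc r, i), (r, i)}" and C' = "{}"], goal_cases)
  case (6 \<phi>)
  then have \<phi>: "multilin_form 2 \<phi>" by (simp add: numeral_2_3)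
  show ?case
    using canonical_element_inverse(1)[OF \<phi>]
    by (simp add: block_simps product_simps split del: if_split)
qed (auto simp: block_simps numeral_2_3)+

lemma block_match_zero_two_minus:
  "block_match th r i
    [[XMinus a b], [XPlus b a]]
    [[Strand a, Strand b]]
    [] [(strand b [(r, Suc i), (Suc r, i), (r + 2, Suc i)]
      [Under (r, i) Neg (snd b), Under (Suc r, i) Pos (snd b)],
      strand b [(r, Suc i), (Suc r, Suc i)] [Plain]),
     (strand a [(r, i), (Suc r, Suc i), (r + 2, i)] [Over (r, i) Neg (snd a), Over (Suc r, i) Pos
       (snd a)],
      strand a [(r, i), (Suc r, i)] [Plain])] id"
proof (rule block_match_algebra[where C = "{(Suc r, i), (r, i)}" and C' = "{}"], goal_cases)
  case (6 \<phi>)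
  then have \<phi>: "multilin_form 2 \<phi>" by (simp add: numeral_2_3)
  show ?case
    using canonical_element_inverse(2)[OF \<phi>]
    by (simp add: block_simps product_simps split del: if_split)
qed (auto simp: block_simps numeral_2_3)+

text \<open>In the letters of \<open>pentagon\<close>, the crossings {1,2}, {1,3}, {2,3} of the
  first block carry c, d, f, and the crossings {2,3}, {1,2} of the second carry a, b. Strand 2 is
  read from below.\<close>

lemma block_match_pachner_thin:
  assumes "snd e2 = Down" "\<not> th ! fst e2"
  shows "block_match th r i
    [[Strand e1, XPlus e2 e3], [XPlus e1 e3, Strand e2], [Strand e3, XPlus e1 e2]]
    [[XPlus e1 e2, Strand e3], [Strand e2, Sym e1 e3], [XPlus e2 e3, Strand e1]]
    [] [(strand e1 [(r, i), (Suc r, i), (r + 2, Suc i), (r + 3, i + 2)]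
      [Plain, Under (Suc r, i) Pos (snd e1), Under (r + 2, Suc i) Pos (snd e1)],
      strand e1 [(r, i), (Suc r, Suc i), (r + 2, i + 2), (r + 3, i + 2)]
        [Under (r, i) Pos (snd e1), Plain, Plain]),
     (path True (fst e2) [(r, Suc i), (Suc r, i + 2), (r + 2, i + 2), (r + 3, Suc i)]
       [Under (r, Suc i) Pos Down, Plain, Over (r + 2, Suc i) Pos Down],
      path True (fst e2) [(r, Suc i), (Suc r, i), (r + 2, i), (r + 3, Suc i)]
        [Over (r, i) Pos Down, Plain, Under (r + 2, i) Pos Down]),
     (strand e3 [(r, i + 2), (Suc r, Suc i), (r + 2, i), (r + 3, i)]
       [Over (r, Suc i) Pos (snd e3), Over (Suc r, i) Pos (snd e3), Plain],
      strand e3 [(r, i + 2), (Suc r, i + 2), (r + 2, Suc i), (r + 3, i)]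
        [Plain, Plain, Over (r + 2, i) Pos (snd e3)])] id"
proof (rule block_match_algebra[where C = "{(r + 2, Suc i), (Suc r, i), (r, Suc i)}" and C' =
  "{(r + 2, i), (r, i)}"], goal_cases)
  case (6 \<phi>)
  then have \<phi>: "multilin_form 3 \<phi>" by (simp add: numeral_2_3)
  show ?case
    using pentagon[OF \<phi>] assms
    by (simp add: block_simps product_simps word_product_pair colored_mult_def under_factor_thin
      over_factor_thin numeral_2_3 split del: if_split)
qed (auto simp: assms block_simps numeral_2_3)+

text \<open>In the letters of \<open>pentagon_opposite\<close>, {1,2}, {1,3}, {2,3} carry c, d, f in
  the first block, and {2,3}, {1,2} carry a, b in the second. Strand 2 is read from below but
  multiplied in the opposite algebra, so its labels appear from top to bottom.\<close>

lemma block_match_pachner_thick: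
  assumes "snd e2 = Down" "th ! fst e2"
  shows "block_match th r i
    [[XPlus e1 e2, Strand e3], [Strand e2, XPlus e1 e3], [XPlus e2 e3, Strand e1]]
    [[Strand e1, XPlus e2 e3], [Sym e1 e3, Strand e2], [Strand e3, XPlus e1 e2]]
    [] [(strand e1 [(r, i), (Suc r, Suc i), (r + 2, i + 2), (r + 3, i + 2)]
      [Under (r, i) Pos (snd e1), Under (Suc r, Suc i) Pos (snd e1), Plain],
      strand e1 [(r, i), (Suc r, i), (r + 2, Suc i), (r + 3, i + 2)]
        [Plain, Plain, Under (r + 2, Suc i) Pos (snd e1)]),
     (path True (fst e2) [(r, Suc i), (Suc r, i), (r + 2, i), (r + 3, Suc i)]
       [Over (r, i) Pos Down, Plain, Under (r + 2, i) Pos Down],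
      path True (fst e2) [(r, Suc i), (Suc r, i + 2), (r + 2, i + 2), (r + 3, Suc i)]
        [Under (r, Suc i) Pos Down, Plain, Over (r + 2, Suc i) Pos Down]),
     (strand e3 [(r, i + 2), (Suc r, i + 2), (r + 2, Suc i), (r + 3, i)]
       [Plain, Over (Suc r, Suc i) Pos (snd e3), Over (r + 2, i) Pos (snd e3)],
      strand e3 [(r, i + 2), (Suc r, Suc i), (r + 2, i), (r + 3, i)]
        [Over (r, Suc i) Pos (snd e3), Plain, Plain])] id"
proof (rule block_match_algebra[where C = "{(r, i), (Suc r, Suc i), (r + 2, i)}" and C' =
  "{(r, Suc i), (r + 2, Suc i)}"], goal_cases)
  case (6 \<phi>)
  then have \<phi>: "multilin_form 3 \<phi>" by (simp add: numeral_2_3)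
  show ?case
    using pentagon_opposite[OF \<phi>] assms
    by (simp add: block_simps product_simps word_product_pair colored_mult_def under_factor_thick
      over_factor_thick numeral_2_3 split del: if_split)
qed (auto simp: assms block_simps numeral_2_3)+

text \<open>The slide exchanges a negative crossing on one leg with a positive crossing on the
  other. For \<open>RL\<close> the antipode of the negative sign is replaced by that of the upward
  leg; for \<open>LR\<close> sign and upward orientation fall on the same leg, and their two
  antipodes must cancel.\<close>

lemma slide_over_label:
  assumes "d = RL \<or> antipode \<circ> antipode = id"
  shows "under_factor th (snd (max_left c d)) (antipode x) = under_factor th (snd (max_right c d))
      x"
    "under_factor th (snd (min_right c d)) (antipode x) = under_factor th (snd (min_left c d)) x"
  using assms by (cases d; auto simp: under_factor_def under_label_def leg_defs pointfree_idE)+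

text \<open>The antipode of the negative crossing has here been transposed to the form on the bend.
  For \<open>RL\<close> it cancels the inverse antipode of the upward leg; for \<open>LR\<close> the
  two legs agree once the antipode is its own inverse.\<close>

lemma slide_under_label:
  assumes "d = RL \<or> antipode \<circ> antipode = id"
  shows "over_factor th (snd (max_right c d)) (\<lambda>x. f (antipode x)) = over_factor th
      (snd (max_left c d)) f"
    "over_factor th (snd (min_left c d)) (\<lambda>x. f (antipode x)) = over_factor th (snd (min_right c d))
      f"
proof -
  have "antipode_inv = antipode" if "antipode \<circ> antipode = id"
    using pointfree_idE[OF that] by (intro ext antipode_inv_eq)
  then show "over_factor th (snd (max_right c d)) (\<lambda>x. f (antipode x)) = over_factor th
    (snd (max_left c d)) f"
    "over_factor th (snd (min_left c d)) (\<lambda>x. f (antipode x)) = over_factor th (snd (min_right c d))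
      f"
    using assms antipode_antipode_inv antipode_inv_antipode
    by (cases d; cases th; auto simp: over_factor_def dual_inv_antipode_def leg_defs fun_eq_iff)+
qed

lemma antipode_carrier: "antipode \<in> heis_carrier"
  by (simp add: heis_carrier_iff antipode_add antipode_scale)

lemma block_match_slide_max_over:
  assumes "d = RL \<or> antipode \<circ> antipode = id"
  shows "block_match th r i
    [[Strand t, Maximum c d], [XMinus t (max_left c d), Strand (max_right c d)]]
    [[Maximum c d, Strand t], [Strand (max_left c d), XPlus (max_right c d) t]]
    [] [(bend c d [(r + 2, i), (Suc r, Suc i), (Suc r, i + 2), (r + 2, i + 2)]
      [Under (Suc r, i) Neg (snd (max_left c d)), Plain, Plain],
      bend c d [(r + 2, i), (Suc r, i), (Suc r, Suc i), (r + 2, i + 2)]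
        [Plain, Plain, Under (Suc r, Suc i) Pos (snd (max_right c d))]),
     (strand t [(r, i), (Suc r, i), (r + 2, Suc i)] [Plain, Over (Suc r, i) Neg (snd t)],
      strand t [(r, i), (Suc r, i + 2), (r + 2, Suc i)] [Plain, Over (Suc r, Suc i) Pos (snd t)])]
        id"
proof (rule block_match_algebra[where C = "{(Suc r, i)}" and C' = "{(Suc r, Suc i)}"], goal_cases)
  case (6 \<phi>)
  then have \<phi>: "multilin_form 2 \<phi>" by (simp add: numeral_2_3)
  show ?case
    using slide_over_label(1)[OF assms]
    by (simp add: block_simps product_simps numeral_2_3 split del: if_split)
qed (cases d; auto simp: block_simps leg_defs link_def numeral_2_3)+

lemma block_match_slide_max_under:
  assumes "d = RL \<or> antipode \<circ> antipode = id"
  shows "block_match th r i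
    [[Strand t, Maximum c d], [XPlus t (max_left c d), Strand (max_right c d)]]
    [[Maximum c d, Strand t], [Strand (max_left c d), XMinus (max_right c d) t]]
    [] [(strand t [(r, i), (Suc r, i), (r + 2, Suc i)] [Plain, Under (Suc r, i) Pos (snd t)],
      strand t [(r, i), (Suc r, i + 2), (r + 2, Suc i)] [Plain, Under (Suc r, Suc i) Neg (snd t)]),
     (bend c d [(r + 2, i), (Suc r, Suc i), (Suc r, i + 2), (r + 2, i + 2)]
       [Over (Suc r, i) Pos (snd (max_left c d)), Plain, Plain],
      bend c d [(r + 2, i), (Suc r, i), (Suc r, Suc i), (r + 2, i + 2)]
        [Plain, Plain, Over (Suc r, Suc i) Neg (snd (max_right c d))])] id"
proof (rule block_match_algebra[where C = "{(Suc r, i)}" and C' = "{(Suc r, Suc i)}"], goal_cases)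
  case (6 \<phi>)
  then have \<phi>: "multilin_form 2 \<phi>" by (simp add: numeral_2_3)
  show ?case
    \<comment> \<open>After the move the antipode of the negative crossing sits on the transversal;
      transposing moves it to the form on the bend.\<close>
    using canonical_element_transpose[OF \<phi> antipode_carrier, of "th ! fst t" "snd t" "th ! c"
      "snd (max_right c d)"]
    by (simp add: block_simps product_simps slide_under_label[OF assms] numeral_2_3 split del:
      if_split)
qed (cases d; auto simp: block_simps leg_defs link_def numeral_2_3)+

lemma block_match_slide_min_over:
  assumes "d = RL \<or> antipode \<circ> antipode = id"
  shows "block_match th r i
    [[XPlus (min_left c d) t, Strand (min_right c d)], [Strand t, Minimum c d]]
    [[Strand (min_left c d), XMinus t (min_right c d)], [Minimum c d, Strand t]]
    [] [(bend c d [(r, i), (Suc r, Suc i), (Suc r, i + 2), (r, i + 2)]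
      [Under (r, i) Pos (snd (min_left c d)), Plain, Plain],
      bend c d [(r, i), (Suc r, i), (Suc r, Suc i), (r, i + 2)]
        [Plain, Plain, Under (r, Suc i) Neg (snd (min_right c d))]),
     (strand t [(r, Suc i), (Suc r, i), (r + 2, i)] [Over (r, i) Pos (snd t), Plain],
      strand t [(r, Suc i), (Suc r, i + 2), (r + 2, i)] [Over (r, Suc i) Neg (snd t), Plain])] id"
proof (rule block_match_algebra[where C = "{(r, i)}" and C' = "{(r, Suc i)}"], goal_cases)
  case (6 \<phi>)
  then have \<phi>: "multilin_form 2 \<phi>" by (simp add: numeral_2_3)
  show ?case
    using slide_over_label(2)[OF assms]
    by (simp add: block_simps product_simps numeral_2_3 split del: if_split)
qed (cases d; auto simp: block_simps leg_defs link_def numeral_2_3)+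

lemma block_match_slide_min_under:
  assumes "d = RL \<or> antipode \<circ> antipode = id"
  shows "block_match th r i
    [[XMinus (min_left c d) t, Strand (min_right c d)], [Strand t, Minimum c d]]
    [[Strand (min_left c d), XPlus t (min_right c d)], [Minimum c d, Strand t]]
    [] [(strand t [(r, Suc i), (Suc r, i), (r + 2, i)] [Under (r, i) Neg (snd t), Plain],
      strand t [(r, Suc i), (Suc r, i + 2), (r + 2, i)] [Under (r, Suc i) Pos (snd t), Plain]),
     (bend c d [(r, i), (Suc r, Suc i), (Suc r, i + 2), (r, i + 2)]
       [Over (r, i) Neg (snd (min_left c d)), Plain, Plain],
      bend c d [(r, i), (Suc r, i), (Suc r, Suc i), (r, i + 2)]
        [Plain, Plain, Over (r, Suc i) Pos (snd (min_right c d))])] id"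
proof (rule block_match_algebra[where C = "{(r, i)}" and C' = "{(r, Suc i)}"], goal_cases)
  case (6 \<phi>)
  then have \<phi>: "multilin_form 2 \<phi>" by (simp add: numeral_2_3)
  show ?case
    using canonical_element_transpose[OF \<phi> antipode_carrier, of "th ! fst t" "snd t" "th ! c"
      "snd (min_left c d)"]
    by (simp add: block_simps product_simps slide_under_label[OF assms] numeral_2_3 split del:
      if_split)
qed (cases d; auto simp: block_simps leg_defs link_def numeral_2_3)+

end

section \<open>Height moves\<close>

text \<open>In a height move a piece stays in the row where it is (upper) or moves to the row above
  (lower);
  in the two rows it is prolonged by vertical strands.  The columns \<open>i\<close>, \<open>j\<close>, \<open>k\<close> are those of its
  left corner on the top, middle and bottom lines.\<close>

fun upper_piece :: "nat \<Rightarrow> nat \<Rightarrow> nat \<Rightarrow> nat \<Rightarrow> piece \<Rightarrow> (arc list \<times> arc list) list" where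
  "upper_piece r i j k (Strand e) =
     [(strand e [(r, i), (Suc r, j), (Suc (Suc r), k)] [Plain, Plain],
       strand e [(r, i), (Suc r, k)] [Plain])]"
| "upper_piece r i j k (XPlus a b) =
     [(strand a [(r, i), (Suc r, Suc j), (Suc (Suc r), Suc k)] [Under (r, i) Pos (snd a), Plain],
       strand a [(r, i), (Suc r, Suc k)] [Under (r, i) Pos (snd a)]),
      (strand b [(r, Suc i), (Suc r, j), (Suc (Suc r), k)] [Over (r, i) Pos (snd b), Plain],
       strand b [(r, Suc i), (Suc r, k)] [Over (r, i) Pos (snd b)])]"
| "upper_piece r i j k (XMinus a b) =
     [(strand a [(r, i), (Suc r, Suc j), (Suc (Suc r), Suc k)] [Over (r, i) Neg (snd a), Plain],
       strand a [(r, i), (Suc r, Suc k)] [Over (r, i) Neg (snd a)]),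
      (strand b [(r, Suc i), (Suc r, j), (Suc (Suc r), k)] [Under (r, i) Neg (snd b), Plain],
       strand b [(r, Suc i), (Suc r, k)] [Under (r, i) Neg (snd b)])]"
| "upper_piece r i j k (Sym a b) =
     [(strand a [(r, i), (Suc r, Suc j), (Suc (Suc r), Suc k)] [Plain, Plain],
       strand a [(r, i), (Suc r, Suc k)] [Plain]),
      (strand b [(r, Suc i), (Suc r, j), (Suc (Suc r), k)] [Plain, Plain],
       strand b [(r, Suc i), (Suc r, k)] [Plain])]"
| "upper_piece r i j k (Maximum c d) =
     [(bend c d [(Suc (Suc r), k), (Suc r, j), (Suc r, Suc j), (Suc (Suc r), Suc k)]
       [Plain, Plain, Plain],
       bend c d [(Suc r, k), (Suc r, Suc k)] [Plain])]"
| "upper_piece r i j k (Minimum c d) =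
     [(bend c d [(r, i), (r, Suc i)] [Plain],
       bend c d [(r, i), (r, Suc i)] [Plain])]"

fun lower_piece :: "nat \<Rightarrow> nat \<Rightarrow> nat \<Rightarrow> nat \<Rightarrow> piece \<Rightarrow> (arc list \<times> arc list) list" where
  "lower_piece r i j k (Strand e) =
     [(strand e [(r, i), (Suc r, j), (Suc (Suc r), k)] [Plain, Plain],
       strand e [(r, i), (Suc r, k)] [Plain])]"
| "lower_piece r i j k (XPlus a b) =
     [(strand a [(r, i), (Suc r, j), (Suc (Suc r), Suc k)] [Plain, Under (Suc r, j) Pos (snd a)],
       strand a [(r, i), (Suc r, Suc k)] [Under (r, i) Pos (snd a)]),
      (strand b [(r, Suc i), (Suc r, Suc j), (Suc (Suc r), k)] [Plain, Over (Suc r, j) Pos (snd b)],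
       strand b [(r, Suc i), (Suc r, k)] [Over (r, i) Pos (snd b)])]"
| "lower_piece r i j k (XMinus a b) =
     [(strand a [(r, i), (Suc r, j), (Suc (Suc r), Suc k)] [Plain, Over (Suc r, j) Neg (snd a)],
       strand a [(r, i), (Suc r, Suc k)] [Over (r, i) Neg (snd a)]),
      (strand b [(r, Suc i), (Suc r, Suc j), (Suc (Suc r), k)]
        [Plain, Under (Suc r, j) Neg (snd b)],
       strand b [(r, Suc i), (Suc r, k)] [Under (r, i) Neg (snd b)])]"
| "lower_piece r i j k (Sym a b) =
     [(strand a [(r, i), (Suc r, j), (Suc (Suc r), Suc k)] [Plain, Plain],
       strand a [(r, i), (Suc r, Suc k)] [Plain]),
      (strand b [(r, Suc i), (Suc r, Suc j), (Suc (Suc r), k)] [Plain, Plain],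
       strand b [(r, Suc i), (Suc r, k)] [Plain])]"
| "lower_piece r i j k (Maximum c d) =
     [(bend c d [(Suc (Suc r), k), (Suc (Suc r), Suc k)] [Plain],
       bend c d [(Suc r, k), (Suc r, Suc k)] [Plain])]"
| "lower_piece r i j k (Minimum c d) =
     [(bend c d [(r, i), (Suc r, j), (Suc r, Suc j), (r, Suc i)] [Plain, Plain, Plain],
       bend c d [(r, i), (r, Suc i)] [Plain])]"

fun upper_row :: "nat \<Rightarrow> nat \<Rightarrow> nat \<Rightarrow> nat \<Rightarrow> row \<Rightarrow> (arc list \<times> arc list) list" where
  "upper_row r i j k [] = []"
| "upper_row r i j k (p # R) = upper_piece r i j k p @
     upper_row r (i + length (piece_top p)) (j + length (piece_bot p)) (k + length (piece_bot p)) R"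

fun lower_row :: "nat \<Rightarrow> nat \<Rightarrow> nat \<Rightarrow> nat \<Rightarrow> row \<Rightarrow> (arc list \<times> arc list) list" where
  "lower_row r i j k [] = []"
| "lower_row r i j k (p # R) = lower_piece r i j k p @
     lower_row r (i + length (piece_top p)) (j + length (piece_top p)) (k + length (piece_bot p)) R"

lemma mset_upper_row:
  "mset (concat (map fst (upper_row r i j k R))) =
     mset (row_arcs r i j R) + mset (row_arcs (Suc r) j k (map Strand (row_bot R)))"
  "mset (concat (map snd (upper_row r i j k R))) = mset (row_arcs r i k R)"
proof (induction R arbitrary: i j k)
  case (Cons p R)
  {
    case 1
    then show ?case using Cons(1) by (cases p) (auto simp: block_simps link_def)
  next
    case 2
    then show ?case using Cons(2) by (cases p) (auto simp: block_simps link_def)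
  }
qed simp_all

lemma mset_lower_row:
  "mset (concat (map fst (lower_row r i j k R))) =
     mset (row_arcs r i j (map Strand (row_top R))) + mset (row_arcs (Suc r) j k R)"
  "mset (concat (map snd (lower_row r i j k R))) = mset (row_arcs r i k R)"
proof (induction R arbitrary: i j k)
  case (Cons p R)
  {
    case 1
    then show ?case using Cons(1) by (cases p) (auto simp: block_simps link_def)
  next
    case 2
    then show ?case using Cons(2) by (cases p) (auto simp: block_simps link_def)
  }
qed simp_all

lemma upper_row_path_match: "\<forall>(p, p')\<in>set (upper_row r i j k R). path_match r 2 1 p p'"
proof (induction R arbitrary: i j k)
  case (Cons p R)
  have "\<forall>(q, q')\<in>set (upper_piece r i j k p). path_match r 2 1 q q'"
    by (cases p) (simp_all add: block_simps)
  with Cons show ?case by (simp add: ball_Un)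
qed simp

lemma lower_row_path_match: "\<forall>(p, p')\<in>set (lower_row r i j k R). path_match r 2 1 p p'"
proof (induction R arbitrary: i j k)
  case (Cons p R)
  have "\<forall>(q, q')\<in>set (lower_piece r i j k p). path_match r 2 1 q q'"
    by (cases p) (simp_all add: block_simps)
  with Cons show ?case by (simp add: ball_Un)
qed simp

lemma upper_row_word:
  assumes "\<And>x. \<beta> (r, x) = (r, x)"
  shows "\<forall>(p, p')\<in>set (upper_row r i j k R). word p' = map (rename_passage \<beta>) (word p)"
proof (induction R arbitrary: i j k)
  case (Cons p R)
  have "\<forall>(q, q')\<in>set (upper_piece r i j k p). word q' = map (rename_passage \<beta>) (word q)"
    by (cases p) (simp_all add: block_simps assms)
  with Cons show ?case by (simp add: ball_Un)
qed simp

text \<open>A lowered crossing is named by its corner on the middle line, the merged one by its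
  corner on the top line. Along the row both columns grow by the same amounts, so one offset relates
  them.\<close>

lemma lower_row_word:
  assumes "\<And>x. \<beta> (Suc r, j + x) = (r, i + x)"
  shows "\<forall>(p, p')\<in>set (lower_row r i j k R). word p' = map (rename_passage \<beta>) (word p)"
  using assms
proof (induction R arbitrary: i j k)
  case (Cons p R)
  have "\<beta> (Suc r, j) = (r, i)" using Cons.prems[of 0] by simp
  then have "\<forall>(q, q')\<in>set (lower_piece r i j k p). word q' = map (rename_passage \<beta>) (word q)"
    by (cases p) (simp_all add: block_simps)
  moreover have "\<forall>(q, q')\<in>set (lower_row r (i + length (piece_top p)) (j + length (piece_top p))
      (k + length (piece_bot p)) R). word q' = map (rename_passage \<beta>) (word q)"
  proof (rule Cons.IH)
    show "\<beta> (Suc r, j + length (piece_top p) + x) = (r, i + length (piece_top p) + x)" for x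
      using Cons.prems[of "length (piece_top p) + x"] by (simp add: add.assoc)
  qed
  ultimately show ?case by (simp add: ball_Un)
qed simp

lemma arc_crossings_row:
  assumes "q \<in> arc_crossings (set (row_arcs r i j R))"
  shows "fst q = r \<and> i \<le> snd q \<and> snd q < i + length (row_top R)"
  using assms
proof (induction R arbitrary: i j)
  case (Cons p R)
  have "fst q = r \<and> i \<le> snd q \<and> snd q < i + length (piece_top p)"
    if "q \<in> arc_crossings (set (piece_arcs r i j p))"
    using that by (cases p) (auto simp: arc_crossings_def strand_arc_def bend_arc_def split:
      if_splits)
  then show ?case
    using Cons.IH[of "i + length (piece_top p)" "j + length (piece_bot p)"] Cons.prems
    by (auto simp: arc_crossings_Un)
qed (simp add: arc_crossings_def)

lemma arc_crossings_Strands: "arc_crossings (set (row_arcs r i j (map Strand es))) = {}"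
proof -
  have "\<forall>x\<in>set (row_arcs r i j (map Strand es)). passage x = Plain"
    by (induction es arbitrary: i j) (auto simp: strand_arc_def)
  then show ?thesis by (auto simp: arc_crossings_def)
qed

context bijective_antipode
begin

lemma block_match_height_left:
  "\<exists>outs \<beta>. block_match th r i [P @ map Strand (row_top Q), map Strand (row_bot P) @ Q] [P @ Q] outs
    [] \<beta>"
proof (intro exI block_match_rename)
  let ?t = "length (row_top P)" and ?b = "length (row_bot P)"
  let ?outs = "upper_row r i i i P @ lower_row r (i + ?t) (i + ?b) (i + ?b) Q"
  \<comment> \<open>Crossings of \<open>Q\<close> are named on the middle line, where
    \<open>P\<close> has its lower width, and move to the top line, where it has its upper width.
    Their columns are at least \<open>?b\<close>, so the subtraction is exact.\<close>
  let ?\<beta> = "\<lambda>q. if fst q = r then q else (r, snd q + ?t - ?b)"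
  show 1: "mset (concat (map fst ?outs)) = mset (rows_arcs r i
      [P @ map Strand (row_top Q), map Strand (row_bot P) @ Q])"
    by (simp only: map_append concat_append mset_append mset_upper_row mset_lower_row)
      (simp add: row_arcs_append add_ac)
  show "mset (concat (map snd ?outs)) = mset (rows_arcs r i [P @ Q])"
    by (simp only: map_append concat_append mset_append mset_upper_row mset_lower_row)
      (simp add: row_arcs_append)
  show "\<forall>(p, p')\<in>set ?outs. path_match r (length [P @ map Strand (row_top Q), map Strand (row_bot P)
      @ Q]) (length [P @ Q]) p p'"
    using upper_row_path_match[of r i i i P] lower_row_path_match[of r "i + ?t" "i + ?b" "i + ?b" Q]
    by (simp add: ball_Un numeral_2_eq_2)
  have "\<forall>(p, p')\<in>set (upper_row r i i i P). word p' = map (rename_passage ?\<beta>) (word p)"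
    by (rule upper_row_word) simp
  moreover have "\<forall>(p, p')\<in>set (lower_row r (i + ?t) (i + ?b) (i + ?b) Q). word p' = map
    (rename_passage ?\<beta>) (word p)"
    by (rule lower_row_word) simp
  ultimately show "\<forall>(p, p')\<in>set ?outs. word p' = map (rename_passage ?\<beta>) (word p)"
    by (simp only: set_append ball_Un)
  have "set (concat (map fst ?outs)) = set (row_arcs r i i P) \<union> set
      (row_arcs r (i + ?t) (i + ?b) (map Strand (row_top Q))) \<union>
      (set (row_arcs (Suc r) i i (map Strand (row_bot P))) \<union> set
        (row_arcs (Suc r) (i + ?b) (i + ?b) Q))"
    unfolding mset_eq_setD[OF 1] by (simp add: row_arcs_append Un_assoc)
  then have "path_crossings fst ?outs =
      arc_crossings (set (row_arcs r i i P)) \<union> arc_crossings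
        (set (row_arcs (Suc r) (i + ?b) (i + ?b) Q))"
    by (simp only: arc_crossings_Un arc_crossings_Strands Un_empty_left Un_empty_right)
  \<comment> \<open>Crossings of \<open>P\<close> stay left of column \<open>i + ?t\<close> and
    those of \<open>Q\<close> are sent to its right, which gives injectivity.\<close>
  also have "\<dots> \<subseteq> {q. fst q = r \<and> snd q < i + ?t \<or> fst q = Suc r \<and> i + ?b \<le> snd q}"
    using arc_crossings_row[of _ r i i P] arc_crossings_row[of _ "Suc r" "i + ?b" "i + ?b" Q] by
      blast
  finally have sub: "path_crossings fst ?outs \<subseteq> \<dots>" .
  show "inj_on ?\<beta> (path_crossings fst ?outs)"
    by (rule inj_on_subset[OF _ sub]) (auto simp: inj_on_def prod_eq_iff)
qed

lemma block_match_height_right: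
  "\<exists>outs \<beta>. block_match th r i [map Strand (row_top P) @ Q, P @ map Strand (row_bot Q)] [P @ Q] outs
    [] \<beta>"
proof (intro exI block_match_rename)
  let ?t = "length (row_top P)" and ?b = "length (row_bot P)"
  let ?outs = "lower_row r i i i P @ upper_row r (i + ?t) (i + ?t) (i + ?b) Q"
  \<comment> \<open>The middle line still shows the upper boundary of \<open>P\<close>, so columns
    agree with those of the top line and only the row changes.\<close>
  let ?\<beta> = "\<lambda>q. (r, snd q) :: point"
  show 1: "mset (concat (map fst ?outs)) = mset (rows_arcs r i
      [map Strand (row_top P) @ Q, P @ map Strand (row_bot Q)])"
    by (simp only: map_append concat_append mset_append mset_upper_row mset_lower_row)
      (simp add: row_arcs_append add_ac)
  show "mset (concat (map snd ?outs)) = mset (rows_arcs r i [P @ Q])"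
    by (simp only: map_append concat_append mset_append mset_upper_row mset_lower_row)
      (simp add: row_arcs_append)
  show "\<forall>(p, p')\<in>set ?outs. path_match r (length [map Strand (row_top P) @ Q, P @ map Strand
      (row_bot Q)]) (length [P @ Q]) p p'"
    using lower_row_path_match[of r i i i P] upper_row_path_match[of r "i + ?t" "i + ?t" "i + ?b" Q]
    by (simp add: ball_Un numeral_2_eq_2)
  have "\<forall>(p, p')\<in>set (upper_row r (i + ?t) (i + ?t) (i + ?b) Q). word p' = map (rename_passage ?\<beta>)
      (word p)"
    by (rule upper_row_word) simp
  moreover have "\<forall>(p, p')\<in>set (lower_row r i i i P). word p' = map (rename_passage ?\<beta>) (word p)"
    by (rule lower_row_word) simp
  ultimately show "\<forall>(p, p')\<in>set ?outs. word p' = map (rename_passage ?\<beta>) (word p)"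
    by (simp only: set_append ball_Un)
  have "set (concat (map fst ?outs)) = set (row_arcs r i i (map Strand (row_top P))) \<union> set
      (row_arcs r (i + ?t) (i + ?t) Q) \<union>
      (set (row_arcs (Suc r) i i P) \<union> set (row_arcs (Suc r) (i + ?t) (i + ?b)
        (map Strand (row_bot Q))))"
    unfolding mset_eq_setD[OF 1] by (simp add: row_arcs_append Un_assoc)
  then have "path_crossings fst ?outs =
      arc_crossings (set (row_arcs r (i + ?t) (i + ?t) Q)) \<union> arc_crossings
        (set (row_arcs (Suc r) i i P))"
    by (simp only: arc_crossings_Un arc_crossings_Strands Un_empty_left Un_empty_right)
  also have "\<dots> \<subseteq> {q. fst q = r \<and> i + ?t \<le> snd q \<or> fst q = Suc r \<and> snd q < i + ?t}"
    using arc_crossings_row[of _ "Suc r" i i P] arc_crossings_row[of _ r "i + ?t" "i + ?t" Q] by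
      blast
  finally have sub: "path_crossings fst ?outs \<subseteq> \<dots>" .
  show "inj_on ?\<beta> (path_crossings fst ?outs)"
    by (rule inj_on_subset[OF _ sub]) (auto simp: inj_on_def prod_eq_iff)
qed

text \<open>The condition on \<open>T\<close> covers both claims: it holds for \<open>{RL}\<close>,
  and for \<open>UNIV\<close> when the antipode is an involution.\<close>

lemma local_move_block_match:
  assumes "local_move T th B B'" and T: "\<forall>d\<in>T. d = RL \<or> antipode \<circ> antipode = id"
  shows "\<exists>outs bs \<beta>. block_match th r i B B' outs bs \<beta>"
proof -
  consider "pachner_move th B B'" | "zero_two_move B B'" | "symmetry_move B B'" |
    "isotopy_move B B'"
    | d where "d \<in> T" "slide_move d B B'"
    using assms(1) by (auto simp: local_move_def)
  then show ?thesis
  proof cases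
    case 1
    then show ?thesis
      by cases (blast intro: block_match_pachner_thin block_match_pachner_thick)+
  next
    case 2
    then show ?thesis
      by cases (blast intro: block_match_zero_two_plus block_match_zero_two_minus)+
  next
    case 3
    then show ?thesis
    proof cases
      case (sym_crossing_right X a b c)
      then show ?thesis
        by (elim disjE) (blast intro: block_match_sym_crossing_right)+
    next
      case (sym_crossing_left X c a b)
      then show ?thesis
        by (elim disjE) (blast intro: block_match_sym_crossing_left)+
    qed (blast intro: block_match_sym_sym block_match_sym_braid block_match_sym_max
      block_match_sym_min)+
  next
    case 4
    then show ?thesis
    proof cases
      case (height_left P Q)
      then show ?thesis using block_match_height_left by blast
    next
      case (height_right P Q)
      then show ?thesis using block_match_height_right by blast
    qed (blast intro: block_match_zigzag_left block_match_zigzag_right)+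
  next
    case 5
    then have d: "d = RL \<or> antipode \<circ> antipode = id" using T by blast
    from 5(2) show ?thesis
      by cases (blast intro: block_match_slide_max_over[OF d] block_match_slide_max_under[OF d]
        block_match_slide_min_over[OF d] block_match_slide_min_under[OF d])+
  qed
qed

lemma J'_colored_move:
  assumes "colored_move T Z Z'" and T: "\<forall>d\<in>T. d = RL \<or> antipode \<circ> antipode = id"
  shows "J' Z = J' Z'"
  using assms(1)
proof cases
  case (1 th B B' U u v V)
  obtain outs bs \<beta> where "block_match th (length U) (length u) B B' outs bs \<beta>"
    using local_move_block_match[OF 1(1) T] by blast
  moreover have "B \<noteq> [] \<and> B' \<noteq> [] \<and> row_top (hd B) = row_top (hd B') \<and> row_bot (last B) = row_bot
    (last B')"
    using 1(1) unfolding local_move_def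
    by (auto elim!: pachner_move.cases zero_two_move.cases symmetry_move.cases isotopy_move.cases
      slide_move.cases
        simp: leg_defs)
  ultimately show ?thesis using block_replacement[OF 1(2-5)] by blast
qed

lemma J'_equivclp:
  assumes "equivclp (colored_move T) Z Z'" and T: "\<forall>d\<in>T. d = RL \<or> antipode \<circ> antipode = id"
  shows "J' Z = J' Z'"
  using assms(1) by (induction rule: equivclp_induct) (use J'_colored_move[OF _ T] in auto)

end

theorem theorem5p1:
  fixes scale :: "'k::field \<Rightarrow> 'a::ring_1 \<Rightarrow> 'a"
    and Basis :: "'a set"
    and comul :: "'a \<Rightarrow> ('a \<times> 'a) list"
    and counit :: "'a \<Rightarrow> 'k"
    and antipode :: "'a \<Rightarrow> 'a"
  assumes "finite_dimensional_hopf_algebra scale Basis comul counit antipode"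
    and "bij antipode"
  shows "(\<forall>Z Z'. Z \<sim>'\<^sub>c Z' \<longrightarrow>
        finite_dimensional_hopf_algebra.J' scale Basis comul counit antipode Z =
        finite_dimensional_hopf_algebra.J' scale Basis comul counit antipode Z') \<and>
    (antipode \<circ> antipode = id \<longrightarrow>
      (\<forall>Z Z'. Z \<sim>\<^sub>c Z' \<longrightarrow>
        finite_dimensional_hopf_algebra.J' scale Basis comul counit antipode Z =
        finite_dimensional_hopf_algebra.J' scale Basis comul counit antipode Z'))"
proof -
  interpret bijective_antipode scale Basis comul counit antipode
    using assms by (simp add: bijective_antipode_def bijective_antipode_axioms_def)
  show ?thesis
    using J'_equivclp[of "{RL}"] J'_equivclp[of UNIV]
    unfolding restricted_colored_equiv_def colored_equiv_def by blast
qed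

end
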